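(* Let $\epsilon>0$, $y_1>3$ and $\eta>1$, and let $r$ be an integer with $|r-\mu|<\mu^{2/3}$, where $\mu=\frac12\log\log x$. For $n\in S_r(x)$ write its prime factors as $p_1<\dots<p_r$. Then: (i) apart from $\ll\Phi_r(x)\big((\log y_1)^{-1}+(\log x)^{-1/2+\epsilon}\big)$ exceptions, every $n\in S_r(x)$ is comfortably spaced above $y_1$, i.e. $2y_1<p_i<p_{i+1}/2$ for every $p_i>y_1$; (ii) apart from $\ll\Phi_r(x)\exp(-k\eta)$ exceptions, where $k>0$ is an absolute constant, every $n\in S_r(x)$ is $\eta$-regularly spaced, i.e. $\left|\frac12\log\log p_i-i\right|<\eta^{1/5}\max\{i,\eta\}^{4/5}$ for all $i<\frac13 r$; (iii) apart from $\ll\Phi_r(x)\exp\big(-(\log\log\log x)^{1/3-\epsilon}\big)$ exceptions, every $n\in S_r(x)$ is extravagantly spaced, i.e. there is some $i$ with $\frac12 r^{1/2}<i<\frac12 r$ such that \[ \log p_i\ge(\log\log p_i)^2\cdot\log\log\log x\cdot\sum_{j=1}^{i-1}\log p_j. \]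
   Context: $S(x)=\{n<x: n \text{ squarefree and no prime } p\mid n \text{ has } p\equiv3\bmod4\}$, $S_r(x)=\{n\in S(x):\omega(n)=r\}$ where $\omega(n)$ is the number of distinct prime factors, and $\Phi_r(x)=\#S_r(x)$. Implied constants may depend on $\epsilon$ only; $x$ is large. *)

theory Defs
  imports Complex_Main "HOL-Computational_Algebra.Computational_Algebra"
begin

definition omega :: "nat \<Rightarrow> nat" where
  "omega n = card (prime_factors n)"

text \<open>The prime factors of \<open>n\<close> in increasing order are indexed from 1:
  \<open>pfac n 1 < \<dots> < pfac n (omega n)\<close>; other indices carry no meaning.\<close>

definition pfac :: "nat \<Rightarrow> nat \<Rightarrow> nat" where
  "pfac n i = sorted_list_of_set (prime_factors n) ! (i - 1)"

definition S :: "real \<Rightarrow> nat set" where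
  "S x = {n. real n < x \<and> squarefree n \<and> \<not> (\<exists>p. prime p \<and> p dvd n \<and> p mod 4 = 3)}"

definition S_r :: "nat \<Rightarrow> real \<Rightarrow> nat set" where
  "S_r r x = {n \<in> S x. omega n = r}"

definition Phi :: "nat \<Rightarrow> real \<Rightarrow> nat" where
  "Phi r x = card (S_r r x)"

text \<open>For the largest prime factor there is no next prime, so only the lower bound is required.\<close>

definition comfortably_spaced :: "real \<Rightarrow> nat \<Rightarrow> bool" where
  "comfortably_spaced y1 n \<longleftrightarrow>
     (\<forall>i\<in>{1..omega n}. real (pfac n i) > y1 \<longrightarrow>
        2 * y1 < real (pfac n i) \<and>
        (i < omega n \<longrightarrow> real (pfac n i) < real (pfac n (i + 1)) / 2))"

definition regularly_spaced :: "real \<Rightarrow> nat \<Rightarrow> bool" where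
  "regularly_spaced \<eta> n \<longleftrightarrow>
     (\<forall>i\<ge>1. real i < real (omega n) / 3 \<longrightarrow>
        \<bar>ln (ln (real (pfac n i))) / 2 - real i\<bar> < \<eta> powr (1/5) * max (real i) \<eta> powr (4/5))"

definition extravagantly_spaced :: "real \<Rightarrow> nat \<Rightarrow> bool" where
  "extravagantly_spaced x n \<longleftrightarrow>
     (\<exists>i. sqrt (real (omega n)) / 2 < real i \<and> real i < real (omega n) / 2 \<and>
        ln (real (pfac n i)) \<ge>
          (ln (ln (real (pfac n i))))\<^sup>2 * ln (ln (ln x)) * (\<Sum>j=1..i-1. ln (real (pfac n j))))"

end

theory Submission
  imports Defs "HOL-Number_Theory.Prime_Powers" "HOL-Real_Asymp.Real_Asymp" "HOL-Analysis.Harmonic_Numbers"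
begin

text \<open>
  Let \<open>L\<close> be the sum of \<open>1 / p\<close> over the admissible primes up to \<open>x\<close>, so that \<open>L = mu x + O(1)\<close>
  by Mertens' theorem modulo 4, and let \<open>k = r - 1\<close>. Weighting \<open>n\<close> by \<open>ln n\<close> and removing one
  prime factor shows that a set of \<open>n\<close> with \<open>r\<close> prime factors has size
  \<open>O(x / ln x)\<close> times the sum of \<open>1 / m\<close> over the cofactors \<open>m\<close> that inherit the defining
  property; without any property this sum is at most \<open>L ^ k / fact k\<close>, and a matching lower bound for
  \<open>Phi\<close> comes from appending one large prime to a product of \<open>k\<close> small ones. This reduces (i)-(iii)
  to estimates for sums of \<open>1 / m\<close>. For (i) one sums over the close pairs of primes, for (ii)
  one uses Chernoff bounds for the number of primes below a given height.

  For (iii) the prime factors \<open>p\<close> of \<open>m\<close> with \<open>ln (ln p) \<le> ln (ln x) / 4\<close> behave up to a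
  constant factor like an independent random set of primes (binomial versus Poisson weights). On the scale
  \<open>ln (ln p)\<close> a gap of length about \<open>2 ln v\<close> starting at height \<open>v\<close> has probability
  about \<open>1 / v\<close> up to powers of \<open>ln (ln (ln x))\<close>; attempts at successive heights are nearly
  independent, and the harmonic sum over \<open>v\<close> yields the exponent \<open>1/3\<close> once the size
  condition on the sum of the preceding \<open>ln p\<close> has been paid for.
\<close>

section \<open>Chebyshev and Mertens estimates\<close>

text \<open>The delicate point is that cofactors must inherit the defect of \<open>n\<close>: the
  primes whose removal leaves a witness behind have to carry a fixed share, here 1/8, of
  \<open>ln x\<close>. In (ii) a count of primes below a given height changes by at most one, so
  every removal is harmless. In (iii) only small primes matter, and they carry little of
  \<open>ln n\<close>. In (i) a close pair may itself carry almost all of \<open>ln n\<close>;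
  obstructions with product above \<open>x powr (1/4)\<close> are therefore counted as plain
  divisors. That leaves O(x / ln x) numbers, and since \<open>Phi\<close> is at least of order (x /
  ln x) (ln x)^(1/2 - eps), it is the source of the second error term in (i). Everything is measured
  against \<open>Lam x ^ k / fact k\<close>. Changing the index by one multiplies this by about k /
  L = 1 + O(mu^(-1/3)), and this tilt enters both the Chernoff bounds and the random set of primes.
  It is harmless because (ii) tolerates deviations of order i^(4/5) at index i and because the gaps
  in (iii) have length only O(ln mu).\<close>

definition psi :: "nat \<Rightarrow> real" where
  "psi n = (\<Sum>d\<in>{1..n}. mangoldt d)"

lemma psi_mono: "m \<le> n \<Longrightarrow> psi m \<le> psi n"
  unfolding psi_def by (intro sum_mono2) (auto simp: mangoldt_nonneg)

text \<open>Since \<open>ln n\<close> is the sum of \<open>mangoldt d\<close> over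
  \<open>d dvd n\<close>, writing \<open>n = d * m\<close> swaps the two sums. With
  \<open>f = 1\<close> this evaluates \<open>ln (fact N)\<close>; with
  \<open>f n = chi n / n\<close> it drives \<open>chi_mangoldt_sum\<close>.\<close>

lemma sum_mult_ln:
  fixes f :: "nat \<Rightarrow> real"
  shows "(\<Sum>n\<in>{1..N}. f n * ln (real n)) = (\<Sum>d\<in>{1..N}. mangoldt d * (\<Sum>m\<in>{1..N div d}. f (d * m)))"
proof -
  have "(\<Sum>n\<in>{1..N}. f n * ln (real n)) = (\<Sum>n\<in>{1..N}. \<Sum>d\<in>{d. d dvd n}. mangoldt d * f n)"
  proof (rule sum.cong)
    fix n assume "n \<in> {1..N}"
    hence "(\<Sum>d | d dvd n. mangoldt d :: real) = ln (real n)"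
      using mangoldt_sum[of n, where ?'a = real] by simp
    thus "f n * ln (real n) = (\<Sum>d | d dvd n. mangoldt d * f n)"
      by (simp add: sum_distrib_right[symmetric] mult.commute)
  qed simp
  also have "\<dots> = (\<Sum>(n,d)\<in>(SIGMA n:{1..N}. {d. d dvd n}). mangoldt d * f n)"
    by (subst sum.Sigma) (auto intro: finite_divisors_nat)
  also have "\<dots> = (\<Sum>(d,m)\<in>(SIGMA d:{1..N}. {1..N div d}). mangoldt d * f (d * m))"
  proof (rule sum.reindex_bij_witness[where i = "\<lambda>(d,m). (d * m, d)" and j = "\<lambda>(n,d). (d, n div d)"], goal_cases)
    case (2 a)
    then obtain n d where a: "a = (n,d)" "1 \<le> n" "n \<le> N" "d dvd n" by auto
    then obtain m where m: "n = d * m" by auto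
    have "d > 0" using a m by (cases d) auto
    thus ?case using a m by (auto simp: less_eq_div_iff_mult_less_eq mult.commute Suc_le_eq)
       (metis Suc_leI dvd_mult_div_cancel dvd_triv_left le_trans nat_0_less_mult_iff nonzero_mult_div_cancel_left dvd_imp_le)
  next
    case (4 a)
    then obtain d m where a: "a = (d,m)" "1 \<le> d" "d \<le> N" "1 \<le> m" "m \<le> N div d" by auto
    have "d * m \<le> N" using a by (metis less_eq_div_iff_mult_less_eq mult.commute less_le_trans zero_less_one)
    thus ?case using a by (auto simp: Suc_le_eq)
  qed auto
  also have "\<dots> = (\<Sum>d\<in>{1..N}. \<Sum>m\<in>{1..N div d}. mangoldt d * f (d * m))"
    by (subst sum.Sigma) auto
  finally show ?thesis by (simp add: sum_distrib_left)
qed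

lemma ln_fact_mangoldt: "ln (fact N :: real) = (\<Sum>d\<in>{1..N}. mangoldt d * real (N div d))"
proof -
  have "ln (fact N :: real) = (\<Sum>n\<in>{1..N}. ln (real n))"
    by (induction N) (auto simp: ln_mult)
  thus ?thesis using sum_mult_ln[of "\<lambda>_. 1" N] by simp
qed

text \<open>The coefficient \<open>(2*m) div d - 2 * (m div d)\<close> is never negative and equals
  1 for \<open>m < d \<le> 2*m\<close>, so the difference is at most the logarithm of the central
  binomial coefficient.\<close>

lemma psi_double: "psi (2 * m) \<le> psi m + 2 * real m"
proof -
  have "psi (2*m) - psi m = (\<Sum>d\<in>{m<..2*m}. mangoldt d)"
  proof -
    have "{1..2*m} = {1..m} \<union> {m<..2*m}" by auto
    hence "psi (2*m) = psi m + (\<Sum>d\<in>{m<..2*m}. mangoldt d)"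
      unfolding psi_def by (metis finite_atLeastAtMost finite_greaterThanAtMost ivl_disj_int_two(7) sum.union_disjoint Int_commute greaterThanAtMost_iff atLeastAtMost_iff disjoint_iff not_less)
    thus ?thesis by simp
  qed
  also have "\<dots> = (\<Sum>d\<in>{m<..2*m}. mangoldt d * (real ((2*m) div d) - 2 * real (m div d)))"
  proof (rule sum.cong)
    fix d assume d: "d \<in> {m<..2*m}"
    hence "(2*m) div d = 1" "m div d = 0" by (auto intro: div_nat_eqI)
    thus "mangoldt d = mangoldt d * (real ((2*m) div d) - 2 * real (m div d))" by simp
  qed simp
  also have "\<dots> \<le> (\<Sum>d\<in>{1..2*m}. mangoldt d * (real ((2*m) div d) - 2 * real (m div d)))"
  proof (rule sum_mono2)
    fix d
    have "2 * (m div d) \<le> (2*m) div d"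
      by (cases "d = 0") (auto simp: less_eq_div_iff_mult_less_eq)
    hence "2 * real (m div d) \<le> real ((2*m) div d)" by linarith
    thus "0 \<le> mangoldt d * (real ((2*m) div d) - 2 * real (m div d))"
      by (intro mult_nonneg_nonneg mangoldt_nonneg) auto
  qed auto
  also have "\<dots> = ln (fact (2*m)) - 2 * ln (fact m)"
  proof -
    have "(\<Sum>d\<in>{1..2*m}. mangoldt d * real (m div d)) = (\<Sum>d\<in>{1..m}. mangoldt d * real (m div d))"
      by (intro sum.mono_neutral_right) auto
    thus ?thesis
      by (simp add: ln_fact_mangoldt right_diff_distrib sum_subtractf sum_distrib_left[symmetric] mult.assoc mult.left_commute[of _ 2])
  qed
  also have "\<dots> = ln (real ((2*m) choose m))"
  proof -
    have "real ((2*m) choose m) = fact (2*m) / (fact m * fact m)"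
      by (subst binomial_fact) (auto simp: mult_2)
    thus ?thesis by (simp add: ln_div ln_mult )
  qed
  also have "\<dots> \<le> ln (2 ^ (2*m))"
  proof -
    have "(2*m) choose m \<le> 2 ^ (2*m)" by (rule binomial_le_pow2)
    hence "real ((2*m) choose m) \<le> 2 ^ (2*m)" by (metis of_nat_le_iff of_nat_numeral of_nat_power)
    moreover have "(2*m) choose m > 0" by (simp add: zero_less_binomial)
    ultimately show ?thesis by (subst ln_le_cancel_iff) auto
  qed
  also have "\<dots> = 2 * real m * ln 2" by (simp add: ln_realpow)
  also have "\<dots> \<le> 2 * real m * 1" using ln_2_less_1 by (intro mult_left_mono) auto
  finally show ?thesis by simp
qed

text \<open>Repeated halving alone would give the constant 2; the constant 4 leaves room for
  rounding an odd \<open>n = 2 * m + 1\<close> up, since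
  \<open>6 * (m + 1) \<le> 4 * (2 * m + 1)\<close> for \<open>m \<ge> 1\<close>.\<close>

lemma psi_le: "psi n \<le> 4 * real n"
proof (induction n rule: less_induct)
  case (less n)
  show ?case
  proof (cases "n \<le> 1")
    case True
    hence "n = 0 \<or> n = 1" by auto
    thus ?thesis by (auto simp: psi_def)
  next
    case False
    show ?thesis
    proof (cases "even n")
      case True
      then obtain m where m: "n = 2 * m" by auto
      thus ?thesis using less.IH[of m] psi_double[of m] False by auto
    next
      case odd: False
      then obtain m where m: "n = 2 * m + 1" by (auto elim: oddE)
      have "psi n \<le> psi (2 * (m + 1))" using m by (intro psi_mono) auto
      also have "\<dots> \<le> psi (m+1) + 2 * real (m+1)" by (rule psi_double)
      also have "psi (m+1) \<le> 4 * real (m+1)" using m False by (intro less.IH) auto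
      finally show ?thesis using m False by auto
    qed
  qed
qed

text \<open>Replacing \<open>N div d\<close> by \<open>N / d\<close> in
  \<open>ln_fact_mangoldt\<close> costs at most \<open>psi N \<le> 4 * N\<close>, while
  \<open>ln (fact N)\<close> lies between \<open>N * ln N - N\<close> and \<open>N * ln N\<close>.
  Division by \<open>N\<close> leaves an error between -1 and 4.\<close>

lemma mangoldt_mertens:
  assumes "N \<ge> 1"
  shows "\<bar>(\<Sum>d\<in>{1..N}. mangoldt d / real d) - ln (real N)\<bar> \<le> 4"
proof -
  define Y where "Y = (\<Sum>d\<in>{1..N}. mangoldt d / real d :: real)"
  have NY: "real N * Y = (\<Sum>d\<in>{1..N}. mangoldt d * (real N / real d))"
    by (simp add: Y_def sum_distrib_left mult.commute mult.left_commute)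
  have "ln (fact N) \<le> real N * Y"
    unfolding NY ln_fact_mangoldt
    by (intro sum_mono mult_left_mono mangoldt_nonneg) (rule of_nat_div_le_of_nat)
  moreover have "real N * Y - psi N \<le> ln (fact N)"
  proof -
    have "real N * Y - psi N = (\<Sum>d\<in>{1..N}. mangoldt d * (real N / real d - 1))"
      by (simp add: NY psi_def sum_subtractf right_diff_distrib)
    also have "\<dots> \<le> (\<Sum>d\<in>{1..N}. mangoldt d * real (N div d))"
    proof (intro sum_mono mult_left_mono mangoldt_nonneg)
      fix d show "real N / real d - 1 \<le> real (N div d)"
        proof -
        have "\<lfloor>real N / real d\<rfloor> = int (N div d)" by (rule floor_divide_of_nat_eq)
        thus ?thesis by linarith
      qed
    qed
    finally show ?thesis by (simp add: ln_fact_mangoldt)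
  qed
  moreover have "ln (fact N :: real) \<le> real N * ln (real N)"
  proof -
    have "(fact N :: real) \<le> real (N ^ N)" by (rule fact_le_power)
    hence "ln (fact N :: real) \<le> ln (real (N^N))" using assms by (subst ln_le_cancel_iff) auto
    thus ?thesis using assms by (simp add: ln_realpow)
  qed
  moreover have "ln (fact N :: real) \<ge> real N * ln (real N) - real N"
  proof -
    have "real N ^ N / fact N \<le> exp (real N)"
    proof -
      have "(\<lambda>n. inverse (fact n) *\<^sub>R real N ^ n) sums exp (real N)" by (rule exp_converges)
      hence s: "(\<lambda>n. real N ^ n / fact n) sums exp (real N)" by (simp add: field_simps)
      have "sum (\<lambda>n. real N ^ n / fact n) {N} \<le> exp (real N)"
        using sum_le_suminf[OF sums_summable[OF s], of "{N}"] sums_unique[OF s] by simp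
      thus ?thesis by simp
    qed
    hence "ln (real N ^ N / fact N) \<le> real N" using assms
      by (subst ln_le_cancel_iff[of _ "exp (real N)", simplified]) auto
    thus ?thesis using assms by (simp add: ln_div ln_realpow)
  qed
  moreover note psi_le[of N]
  ultimately have "real N * (Y - ln (real N)) \<le> real N * 4" "real N * (-1) \<le> real N * (Y - ln (real N))"
    by (auto simp: right_diff_distrib)
  hence "Y - ln (real N) \<le> 4" "-1 \<le> Y - ln (real N)"
    using assms mult_le_cancel_left_pos[of "real N" "-1" "Y - ln (real N)"]
      mult_le_cancel_left_pos[of "real N" "Y - ln (real N)" 4] by auto
  thus ?thesis unfolding Y_def by linarith
qed

text \<open>The bound telescopes: each summand is at most the decrease of
  \<open>(ln t + 2) / t\<close> from \<open>t = p - 1\<close> to \<open>t = p\<close>.\<close>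

lemma sum_ln_over_p_p1:
  assumes "N \<ge> 1"
  shows "(\<Sum>p\<in>{2..N}. ln (real p) / (real p * (real p - 1))) \<le> 2 - (ln (real N) + 2) / real N"
  using assms
proof (induction N rule: dec_induct)
  case base thus ?case by simp
next
  case (step n)
  define p where "p = real n"
  have p: "p \<ge> 1" using step by (simp add: p_def)
  have "ln ((p+1) / p) \<le> (p+1) / p - 1" using p by (intro ln_le_minus_one) auto
  hence l: "ln (p+1) - ln p \<le> 1 / p" using p by (simp add: ln_div field_simps)
  hence "(p+1) * (ln (p+1) - ln p) \<le> (p+1) * (1/p)" using p by (intro mult_left_mono) auto
  also have "\<dots> \<le> 2" using p by (simp add: field_simps)
  finally have "ln (p+1) \<le> (p+1) * (ln p + 2) - p * (ln (p+1) + 2)" by (simp add: algebra_simps)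
  hence "ln (p+1) / ((p+1) * p) \<le> ((p+1) * (ln p + 2) - p * (ln (p+1) + 2)) / ((p+1) * p)"
    using p by (intro divide_right_mono) auto
  also have "\<dots> = (ln p + 2) / p - (ln (p+1) + 2) / (p+1)" using p by (simp add: field_simps)
  finally have "ln (p+1) / ((p+1) * p) \<le> (ln p + 2) / p - (ln (p+1) + 2) / (p+1)" .
  moreover have "{2..Suc n} = insert (Suc n) {2..n}" using step by auto
  ultimately show ?case using step.IH by (simp add: p_def add.commute)
qed

text \<open>Only proper prime powers contribute, and \<open>ln p * (1/p) ^ k\<close> summed over
  \<open>k \<ge> 2\<close> is at most \<open>ln p / (p * (p - 1))\<close>. Both \<open>p\<close> and
  \<open>k\<close> may be confined to \<open>{2..N}\<close> because
  \<open>k < p ^ k\<close>.\<close>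

lemma mangoldt_nonprime_sum:
  "(\<Sum>d | d \<in> {1..N} \<and> \<not> prime d. mangoldt d / real d) \<le> (2::real)"
proof (cases "N \<ge> 1")
  case True
  have "(\<Sum>d | d \<in> {1..N} \<and> \<not> prime d. mangoldt d / real d :: real) = 
        (\<Sum>d | d \<in> {1..N} \<and> \<not> prime d \<and> primepow d. mangoldt d / real d)"
    by (intro sum.mono_neutral_right) (auto simp: mangoldt_def)
  also have "\<dots> \<le> (\<Sum>(p,k)\<in>{2..N} \<times> {2..N}. ln (real p) * (1 / real p) ^ k)"
  proof (rule sum_le_included[where i = "\<lambda>(p,k). p ^ k"])
    show "\<forall>d\<in>{d \<in> {1..N}. \<not> prime d \<and> primepow d}.
       \<exists>y\<in>{2..N} \<times> {2..N}. (case y of (p, k) \<Rightarrow> p ^ k) = d \<and>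
          mangoldt d / real d \<le> (case y of (p, k) \<Rightarrow> ln (real p) * (1 / real p) ^ k)"
    proof
      fix d assume d: "d \<in> {d \<in> {1..N}. \<not> prime d \<and> primepow d}"
      then obtain p k where pk: "prime p" "k > 0" "d = p ^ k" by (auto simp: primepow_def)
      have k1: "k \<noteq> 1" using d pk by auto
      have p2: "p \<ge> 2" using pk prime_ge_2_nat by auto
      have "k < p ^ k" using p2 less_exp[of k] power_mono[of 2 p k] by (meson le_trans not_le order_less_le_trans zero_le)
      moreover have "p \<le> p ^ k" using pk p2 by (simp add: self_le_power)
      moreover have "p ^ k \<le> N" using d pk by auto
      ultimately have "(p, k) \<in> {2..N} \<times> {2..N}" using p2 k1 pk by auto
      thus "\<exists>y\<in>{2..N} \<times> {2..N}. (case y of (p, k) \<Rightarrow> p ^ k) = d \<and>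
          mangoldt d / real d \<le> (case y of (p, k) \<Rightarrow> ln (real p) * (1 / real p) ^ k)"
        using pk by (intro bexI[of _ "(p,k)"]) (auto simp: field_simps)
    qed
  qed auto
  also have "\<dots> = (\<Sum>p\<in>{2..N}. ln (real p) * (\<Sum>k\<in>{2..N}. (1 / real p) ^ k))"
    by (simp add: sum.cartesian_product[symmetric] sum_distrib_left)
  also have "\<dots> \<le> (\<Sum>p\<in>{2..N}. ln (real p) * (1 / (real p * (real p - 1))))"
  proof (intro sum_mono mult_left_mono)
    fix p assume p: "p \<in> {2..N}"
    define q where "q = 1 / real p"
    have q: "0 < q" "q < 1" using p by (auto simp: q_def)
    have "(\<Sum>k\<in>{2..N}. q ^ k) \<le> q^2 / (1 - q)"
    proof (cases "N \<ge> 2")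
      case True
      thus ?thesis using q by (subst sum_gp) (auto simp: divide_right_mono)
    qed (use q in auto)
    also have "\<dots> = 1 / (real p * (real p - 1))" using p by (simp add: q_def field_simps power2_eq_square)
    finally show "(\<Sum>k\<in>{2..N}. (1 / real p) ^ k) \<le> 1 / (real p * (real p - 1))" by (simp add: q_def)
  qed auto
  also have "\<dots> \<le> 2"
  proof -
    have "0 \<le> (ln (real N) + 2) / real N" using True by (intro divide_nonneg_nonneg add_nonneg_nonneg) auto
    thus ?thesis using sum_ln_over_p_p1[OF True] by simp
  qed
  finally show ?thesis .
qed auto

section \<open>The nonprincipal character modulo 4\<close>

definition chi :: "nat \<Rightarrow> real" where
  "chi n = (if n mod 4 = 1 then 1 else if n mod 4 = 3 then -1 else 0)"

lemma mod4_cases: "(n::nat) mod 4 = 0 \<or> n mod 4 = 1 \<or> n mod 4 = 2 \<or> n mod 4 = 3"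
  by presburger

lemma chi_mult: "chi (m * n) = chi m * chi n"
proof -
  have "(m * n) mod 4 = ((m mod 4) * (n mod 4)) mod 4" by (simp add: mod_mult_eq)
  thus ?thesis using mod4_cases[of m] mod4_cases[of n] unfolding chi_def by (elim disjE) simp_all
qed

lemma abs_chi_le: "\<bar>chi n\<bar> \<le> 1" by (simp add: chi_def)

lemma sum_chi_lessThan: "(\<Sum>j<n. chi j) = (if n mod 4 = 2 \<or> n mod 4 = 3 then 1 else 0)"
proof (induction n)
  case (Suc n)
  thus ?case using mod4_cases[of n] unfolding chi_def by (elim disjE) (simp_all add: mod_Suc)
qed simp

lemma abs_sum_chi_le: "\<bar>\<Sum>j\<in>{a..<n}. chi j\<bar> \<le> 1"
proof (cases "a \<le> n")
  case True
  have "(\<Sum>j\<in>{a..<n}. chi j) = (\<Sum>j<n. chi j) - (\<Sum>j<a. chi j)"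
    using True sum_diff_nat_ivl[of 0 a n chi] by (simp add: lessThan_atLeast0)
  thus ?thesis by (simp add: sum_chi_lessThan)
qed simp

text \<open>Abel summation: character sums over intervals are at most 1 in absolute value, so a
  decreasing nonnegative weight contributes at most its first value.\<close>

lemma sum_chi_antimono:
  fixes b :: "nat \<Rightarrow> real"
  assumes nonneg: "\<And>j. j \<ge> a \<Longrightarrow> b j \<ge> 0" and anti: "\<And>j. j \<ge> a \<Longrightarrow> b (Suc j) \<le> b j"
  shows "\<bar>\<Sum>j\<in>{a..<n}. chi j * b j\<bar> \<le> b a"
proof (cases "a \<le> n")
  case True
  define S T where "S = (\<lambda>n. \<Sum>j\<in>{a..<n}. chi j * b j)" and "T = (\<lambda>n. \<Sum>j\<in>{a..<n}. chi j)"
  \<comment> \<open>The claim for \<open>c = 0\<close> alone does not reproduce itself. Lowering all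
    weights by a common \<open>c\<close>, at most the last weight used, gives one that does: the
    step uses the old claim at \<open>c = b n\<close>.\<close>
  have "\<forall>c. 0 \<le> c \<and> c \<le> b (if n = a then a else n - 1) \<longrightarrow> \<bar>S n - T n * c\<bar> \<le> b a - c"
    using True
  proof (induction n rule: dec_induct)
    case base thus ?case by (auto simp: S_def T_def)
  next
    case (step n)
    show ?case
    proof (intro allI impI)
      fix c assume c: "0 \<le> c \<and> c \<le> b (if Suc n = a then a else Suc n - 1)"
      hence c': "0 \<le> c" "c \<le> b n" using step by auto
      have "b n \<le> b (if n = a then a else n - 1)" using anti[of "n-1"] step by (cases n) auto
      hence 1: "\<bar>S n - T n * b n\<bar> \<le> b a - b n" using step.IH nonneg[of n] step by auto
      have "\<bar>T (Suc n) * (b n - c)\<bar> \<le> 1 * (b n - c)"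
        unfolding abs_mult T_def using c' abs_sum_chi_le[of a "Suc n"] by (intro mult_mono) auto
      moreover have "S (Suc n) - T (Suc n) * c = (S n - T n * b n) + T (Suc n) * (b n - c)"
        using step by (simp add: S_def T_def algebra_simps)
      ultimately show "\<bar>S (Suc n) - T (Suc n) * c\<bar> \<le> b a - c"
        using 1 abs_triangle_ineq[of "S n - T n * b n" "T (Suc n) * (b n - c)"] by simp
    qed
  qed
  from this[rule_format, of 0] show ?thesis using nonneg[of a] nonneg[of "n-1"] True by (auto simp: S_def split: if_splits)
qed (use nonneg[of a] in auto)

lemma ln_div_antimono:
  fixes a b :: real assumes "3 \<le> a" "a \<le> b" shows "ln b / b \<le> ln a / a"
proof (rule DERIV_nonpos_imp_nonincreasing[OF assms(2)])
  fix x assume x: "a \<le> x" "x \<le> b"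
  have "ln x \<ge> 1" using x assms exp_le by (subst ln_ge_iff) auto
  thus "\<exists>y. ((\<lambda>x. ln x / x) has_real_derivative y) (at x) \<and> y \<le> 0"
    using x assms by (intro exI[of _ "(1 / x * x - ln x * 1) / (x * x)"] conjI)
       (auto intro!: derivative_eq_intros simp: divide_nonpos_nonneg field_simps)
qed

text \<open>By \<open>sum_mult_ln\<close>, \<open>chi n * ln n / n\<close> summed over
  \<open>n\<close> is the sum of \<open>chi d * mangoldt d / d * X (N div d)\<close>, where
  \<open>X\<close> is the partial sum of L(1, chi). The former is at most 1 in absolute value, and
  replacing \<open>X (N div d)\<close> by \<open>X N\<close> costs at most
  \<open>psi N / N \<le> 4\<close>. So \<open>X N\<close> times the wanted sum is at most 5, and
  \<open>X N\<close> is bounded below.\<close>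

lemma chi_mangoldt_sum: "\<bar>\<Sum>d\<in>{1..N}. chi d * mangoldt d / real d\<bar> \<le> 8"
proof (cases "N \<ge> 1")
  case True
  define X where "X = (\<lambda>m. \<Sum>j\<in>{1..m}. chi j / real j)"
  define Y where "Y = (\<Sum>d\<in>{1..N}. chi d * mangoldt d / real d)"
  have Xdiff: "\<bar>X n - X m\<bar> \<le> 1 / real (Suc m)" if "m \<le> n" for m n
  proof -
    have "X n - X m = (\<Sum>j\<in>{Suc m..<Suc n}. chi j / real j)"
    proof -
      have "{1..n} = {1..m} \<union> {Suc m..<Suc n}" using that by auto
      thus ?thesis unfolding X_def by (subst (1) \<open>{1..n} = _\<close>, subst sum.union_disjoint) auto
    qed
    thus ?thesis using sum_chi_antimono[of "Suc m" "\<lambda>j. 1 / real j" "Suc n"]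
      by (auto simp: frac_le)
  qed
  \<comment> \<open>A quantitative form of L(1, chi) > 0: the first term is 1 and the tail from 3 on
    is at most 1/3.\<close>
  have X1: "X N \<ge> 2/3"
  proof (cases "N \<ge> 2")
    case True
    have "X 2 = 1" by (simp add: X_def chi_def numeral_2_eq_2)
    thus ?thesis using Xdiff[OF True] by (simp add: abs_if split: if_splits)
  next
    case False
    hence "N = 1" using \<open>N \<ge> 1\<close> by auto
    thus ?thesis by (simp add: X_def chi_def)
  qed
  have "(\<Sum>n\<in>{1..N}. chi n / real n * ln (real n)) 
      = (\<Sum>d\<in>{1..N}. mangoldt d * (\<Sum>m\<in>{1..N div d}. chi (d * m) / real (d * m)))"
    by (rule sum_mult_ln)
  also have "\<dots> = (\<Sum>d\<in>{1..N}. chi d * mangoldt d / real d * X (N div d))"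
    by (intro sum.cong) (auto simp: X_def chi_mult sum_distrib_left field_simps)
  also have "\<dots> = X N * Y + (\<Sum>d\<in>{1..N}. chi d * mangoldt d / real d * (X (N div d) - X N))"
    unfolding Y_def sum_distrib_left sum.distrib[symmetric] by (intro sum.cong) (auto simp: algebra_simps diff_divide_distrib)
  finally have eq: "X N * Y = (\<Sum>n\<in>{1..N}. chi n / real n * ln (real n))
      - (\<Sum>d\<in>{1..N}. chi d * mangoldt d / real d * (X (N div d) - X N))" by simp
  have "\<bar>\<Sum>d\<in>{1..N}. chi d * mangoldt d / real d * (X (N div d) - X N)\<bar>
      \<le> (\<Sum>d\<in>{1..N}. \<bar>chi d * mangoldt d / real d * (X (N div d) - X N)\<bar>)" by (rule sum_abs)
  also have "\<dots> \<le> (\<Sum>d\<in>{1..N}. mangoldt d / real N)"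
  proof (rule sum_mono)
    fix d assume d: "d \<in> {1..N}"
    have "\<bar>X (N div d) - X N\<bar> \<le> 1 / real (Suc (N div d))"
      using Xdiff[of "N div d" N] by (simp add: abs_minus_commute)
    also have "\<dots> \<le> real d / real N"
    proof -
      have "N < d * Suc (N div d)" using d by (metis atLeastAtMost_iff dividend_less_times_div less_le_trans mult_Suc_right zero_less_one add.commute)
      hence "real N \<le> real d * real (Suc (N div d))" by (metis less_imp_le of_nat_le_iff of_nat_mult)
      thus ?thesis using True by (auto simp: field_simps simp del: of_nat_Suc)
    qed
    finally have 1: "\<bar>X (N div d) - X N\<bar> \<le> real d / real N" .
    have "\<bar>chi d * mangoldt d / real d * (X (N div d) - X N)\<bar> = \<bar>chi d\<bar> * (mangoldt d / real d) * \<bar>X (N div d) - X N\<bar>"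
      by (simp add: abs_mult)
    also have "\<dots> \<le> 1 * (mangoldt d / real d) * (real d / real N)"
      by (intro mult_mono 1 abs_chi_le) (auto intro!: mult_nonneg_nonneg divide_nonneg_nonneg mangoldt_nonneg)
    finally show "\<bar>chi d * mangoldt d / real d * (X (N div d) - X N)\<bar> \<le> mangoldt d / real N"
      using d by simp
  qed
  also have "\<dots> = psi N / real N" by (simp add: psi_def sum_divide_distrib)
  also have "\<dots> \<le> 4" using psi_le[of N] True by (simp add: field_simps)
  finally have e1: "\<bar>\<Sum>d\<in>{1..N}. chi d * mangoldt d / real d * (X (N div d) - X N)\<bar> \<le> 4" .
  have "\<bar>\<Sum>n\<in>{1..N}. chi n / real n * ln (real n)\<bar> \<le> 1"
  proof -
    have "(\<Sum>n\<in>{1..N}. chi n / real n * ln (real n)) = (\<Sum>n\<in>{3..<Suc N}. chi n * (ln (real n) / real n))"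
    proof -
      have "n = 1 \<or> n = 2" if "1 \<le> n" "\<not> 3 \<le> n" for n :: nat using that by auto
      thus ?thesis by (intro sum.mono_neutral_cong_right) (auto, auto simp: chi_def)
    qed
    also have "\<bar>\<dots>\<bar> \<le> ln (real 3) / real 3"
      by (intro sum_chi_antimono ln_div_antimono) auto
    also have "\<dots> \<le> 1" using ln_le_minus_one[of 3] by simp
    finally show ?thesis .
  qed
  hence XY: "\<bar>X N * Y\<bar> \<le> 5" using e1 eq by linarith
  have "2/3 * \<bar>Y\<bar> \<le> X N * \<bar>Y\<bar>" using X1 by (intro mult_right_mono) auto
  also have "\<dots> = \<bar>X N * Y\<bar>" using X1 by (simp add: abs_mult)
  finally show ?thesis using XY unfolding Y_def by linarith
qed auto

section \<open>Mertens estimates for the admissible primes\<close>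

definition GP :: "nat set" where "GP = {p. prime p \<and> p mod 4 \<noteq> 3}"

lemma GP_prime: "p \<in> GP \<Longrightarrow> prime p" by (simp add: GP_def)

lemma GP_ge2: "p \<in> GP \<Longrightarrow> p \<ge> 2" using prime_ge_2_nat by (auto simp: GP_def)

text \<open>On odd primes the indicator of \<open>GP\<close> is \<open>(1 + chi) / 2\<close>, so the
  sum is the mean of the plain sum and the character sum. The prime 2 is admissible although
  \<open>chi 2 = 0\<close>, whence the correction \<open>f 2 / 2\<close>. Proper prime powers cost
  at most 2 in either sum.\<close>

lemma GP_mertens_nat:
  assumes "N \<ge> 1"
  shows "\<bar>(\<Sum>p | p \<in> GP \<and> p \<le> N. ln (real p) / real p) - ln (real N) / 2\<bar> \<le> 10"
proof -
  define P where "P = {p. prime p \<and> p \<le> N}"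
  have finP: "finite P" by (simp add: P_def)
  define f where "f = (\<lambda>p. ln (real p) / real p)"
  have f0: "f p \<ge> 0" if "p \<in> P" for p
    using that prime_ge_1_nat[of p] by (auto simp: f_def P_def)
  have split: "(\<Sum>d\<in>{1..N}. c d * (mangoldt d / real d)) = (\<Sum>p\<in>P. c p * f p) + 
       (\<Sum>d | d \<in> {1..N} \<and> \<not> prime d. c d * (mangoldt d / real d))" for c :: "nat \<Rightarrow> real"
  proof -
    have "{1..N} = P \<union> {d. d \<in> {1..N} \<and> \<not> prime d}" by (auto simp: P_def Suc_le_eq prime_gt_0_nat)
    hence "(\<Sum>d\<in>{1..N}. c d * (mangoldt d / real d)) = (\<Sum>p\<in>P. c p * (mangoldt p / real p)) + 
       (\<Sum>d | d \<in> {1..N} \<and> \<not> prime d. c d * (mangoldt d / real d))"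
      by (metis (no_types, lifting) finP P_def finite_atLeastAtMost finite_Collect_conjI disjoint_iff mem_Collect_eq sum.union_disjoint finite_Un)
    thus ?thesis by (simp add: P_def f_def)
  qed
  define R where "R = (\<Sum>d | d \<in> {1..N} \<and> \<not> prime d. mangoldt d / real d :: real)"
  have R: "0 \<le> R" "R \<le> 2" using mangoldt_nonprime_sum[of N] 
    by (auto simp: R_def intro!: sum_nonneg divide_nonneg_nonneg mangoldt_nonneg)
  have "\<bar>\<Sum>d | d \<in> {1..N} \<and> \<not> prime d. chi d * (mangoldt d / real d)\<bar> 
      \<le> (\<Sum>d | d \<in> {1..N} \<and> \<not> prime d. \<bar>chi d * (mangoldt d / real d)\<bar>)" by (rule sum_abs)
  also have "\<dots> \<le> R" unfolding R_def
  proof (rule sum_mono)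
    fix d :: nat
    have "\<bar>chi d\<bar> * (mangoldt d / real d) \<le> 1 * (mangoldt d / real d)"
      by (intro mult_right_mono abs_chi_le) (simp add: mangoldt_nonneg)
    thus "\<bar>chi d * (mangoldt d / real d)\<bar> \<le> mangoldt d / real d" by (simp add: abs_mult)
  qed
  finally have R': "\<bar>\<Sum>d | d \<in> {1..N} \<and> \<not> prime d. chi d * (mangoldt d / real d)\<bar> \<le> 2" using R by simp
  have a: "\<bar>(\<Sum>p\<in>P. f p) - ln N\<bar> \<le> 6"
    using split[of "\<lambda>_. 1"] mangoldt_mertens[OF assms] R by (simp add: R_def)
  have b: "\<bar>\<Sum>p\<in>P. chi p * f p\<bar> \<le> 10"
    using split[of chi] chi_mangoldt_sum[of N] R' by simp
  have "(\<Sum>p | p \<in> GP \<and> p \<le> N. ln (real p) / real p) = (\<Sum>p\<in>P. if p mod 4 = 3 then 0 else f p)"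
    by (intro sum.mono_neutral_cong_left) (auto simp: P_def GP_def f_def)
  also have "\<dots> = (\<Sum>p\<in>P. (f p + chi p * f p) / 2 + (if p = 2 then f 2 / 2 else 0))"
  proof (rule sum.cong)
    fix p assume p: "p \<in> P"
    show "(if p mod 4 = 3 then 0 else f p) = (f p + chi p * f p) / 2 + (if p = 2 then f 2 / 2 else 0)"
    proof (cases "p = 2")
      case False
      hence "odd p" using p primes_dvd_imp_eq[of 2 p] by (auto simp: P_def)
      hence "p mod 4 = 1 \<or> p mod 4 = 3" by presburger
      thus ?thesis using False by (auto simp: chi_def)
    qed (simp add: chi_def)
  qed simp
  also have "\<dots> = ((\<Sum>p\<in>P. f p) + (\<Sum>p\<in>P. chi p * f p)) / 2 + (\<Sum>p\<in>P. if p = 2 then f 2 / 2 else 0)"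
    by (simp add: sum.distrib sum_divide_distrib add_divide_distrib)
  also have "(\<Sum>p\<in>P. if p = 2 then f 2 / 2 else 0) = (if 2 \<in> P then f 2 / 2 else 0)"
    using finP by (simp add: sum.delta')
  finally have "(\<Sum>p | p \<in> GP \<and> p \<le> N. ln (real p) / real p) = ((\<Sum>p\<in>P. f p) + (\<Sum>p\<in>P. chi p * f p)) / 2 + (if 2 \<in> P then f 2 / 2 else 0)" .
  moreover have "0 \<le> f 2" "f 2 \<le> 1" using ln_2_less_1 by (auto simp: f_def)
  moreover define g where "g = (if 2 \<in> P then f 2 / 2 else 0)"
  ultimately have "(\<Sum>p | p \<in> GP \<and> p \<le> N. ln (real p) / real p) = ((\<Sum>p\<in>P. f p) + (\<Sum>p\<in>P. chi p * f p)) / 2 + g"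
    "0 \<le> g" "g \<le> 1" by auto
  moreover define T where "T = (\<Sum>p | p \<in> GP \<and> p \<le> N. ln (real p) / real p)"
  ultimately show ?thesis using a b unfolding T_def[symmetric] abs_le_iff add_divide_distrib by linarith
qed

text \<open>Partial summation against \<open>1 / ln n\<close>. The summatory function
  \<open>A\<close> splits into \<open>ln n / 2\<close>, which leads to the Riemann sum
  \<open>H\<close> for the increment of \<open>ln (ln t)\<close>, and a remainder \<open>R\<close>
  bounded by 10, whose contribution \<open>G\<close> is at most \<open>20 / ln M\<close>.\<close>

lemma GP_mertens_inv_nat:
  assumes "2 \<le> M" "M \<le> N"
  shows "\<bar>(\<Sum>p\<in>GP \<inter> {M<..N}. 1 / real p) - (ln (ln (real N)) - ln (ln (real M))) / 2\<bar> \<le> 21 / ln (real M)"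
proof -
  define A where "A = (\<lambda>n. \<Sum>p | p \<in> GP \<and> p \<le> n. ln (real p) / real p)"
  define R where "R = (\<lambda>n. A n - ln (real n) / 2)"
  have R: "\<bar>R n\<bar> \<le> 10" if "n \<ge> 1" for n
    using GP_mertens_nat[OF that] by (simp add: R_def A_def)
  define G where "G = (\<lambda>N. \<Sum>n\<in>{M<..N}. (R n - R (n - 1)) / ln (real n))"
  define H where "H = (\<lambda>N. \<Sum>n\<in>{M<..N}. (ln (real n) - ln (real (n - 1))) / ln (real n))"
  have ins: "{M<..Suc n} = insert (Suc n) {M<..n}" if "M \<le> n" for n using that by auto
  have lnM: "ln (real M) > 0" using assms by simp
  \<comment> \<open>With the boundary term \<open>R N / ln N\<close> on the left, the increments are
    \<open>R n * (1 / ln n - 1 / ln (Suc n))\<close>, whose bounds telescope.\<close>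
  have "\<bar>G N - R N / ln N\<bar> \<le> 10 * (2 / ln M - 1 / ln N)"
    using assms(2)
  proof (induction N rule: dec_induct)
    case base
    have "\<bar>R M / ln M\<bar> \<le> 10 / ln M" using R[of M] lnM assms by (auto simp: abs_divide divide_right_mono)
    thus ?case by (simp add: G_def)
  next
    case (step n)
    have l: "0 < ln (real n)" "ln (real n) \<le> ln (real (Suc n))" using assms step by auto
    have "0 \<le> 1 / ln (real n) - 1 / ln (real (Suc n))" using l by (simp add: frac_le del: of_nat_Suc)
    hence "\<bar>R n * (1 / ln (real n) - 1 / ln (real (Suc n)))\<bar> \<le> 10 * (1 / ln (real n) - 1 / ln (real (Suc n)))"
      unfolding abs_mult using R[of n] step assms by (intro mult_mono) auto
    moreover have "G (Suc n) - R (Suc n) / ln (Suc n) = (G n - R n / ln n) + R n * (1 / ln n - 1 / ln (Suc n))"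
      using step by (simp add: G_def ins diff_divide_distrib algebra_simps del: of_nat_Suc)
    ultimately show ?case using step.IH
      abs_triangle_ineq[of "G n - R n / ln n" "R n * (1 / ln n - 1 / ln (Suc n))"] by (simp add: algebra_simps del: of_nat_Suc)
  qed
  moreover have "\<bar>R N / ln N\<bar> \<le> 10 / ln N" using R[of N] assms by (auto simp: abs_divide divide_right_mono)
  ultimately have G: "\<bar>G N\<bar> \<le> 20 * (1 / ln M)"
    using abs_triangle_ineq[of "G N - R N / ln N" "R N / ln N"] by simp
  have H: "0 \<le> ln (ln N) - ln (ln M) - H N \<and> ln (ln N) - ln (ln M) - H N \<le> 1 / ln M - 1 / ln N"
    using assms(2)
  proof (induction N rule: dec_induct)
    case base thus ?case by (simp add: H_def)
  next
    case (step n)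
    define a b where "a = ln (real n)" and "b = ln (real (Suc n))"
    have ab: "0 < a" "a \<le> b" using assms step by (auto simp: a_def b_def)
    have ab1: "b - a \<le> 1"
    proof -
      have "b - a = ln (real (Suc n) / real n)" using assms step by (simp add: a_def b_def ln_div)
      also have "\<dots> \<le> real (Suc n) / real n - 1" using assms step by (intro ln_le_minus_one) auto
      also have "\<dots> \<le> 1" using assms step by (simp add: field_simps)
      finally show ?thesis .
    qed
    have 1: "(b - a) / b \<le> ln b - ln a"
    proof -
      have "ln (a / b) \<le> a / b - 1" using ab by (intro ln_le_minus_one) auto
      thus ?thesis using ab by (simp add: ln_div diff_divide_distrib)
    qed
    have "ln (b / a) \<le> b / a - 1" using ab by (intro ln_le_minus_one) auto
    hence 2: "ln b - ln a \<le> (b - a) / a" using ab by (simp add: ln_div diff_divide_distrib)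
    have "(b - a) * (1 / a - 1 / b) \<le> 1 * (1 / a - 1 / b)" using ab ab1 by (intro mult_right_mono) (auto simp: frac_le)
    hence 3: "(b - a) / a - (b - a) / b \<le> 1 / a - 1 / b" by (simp add: algebra_simps diff_divide_distrib)
    have "H (Suc n) = H n + (b - a) / b" using step unfolding H_def a_def b_def by (subst ins) simp_all
    thus ?case using step.IH 1 2 3 unfolding a_def[symmetric] b_def[symmetric] by auto
  qed
  have "(\<Sum>p\<in>GP \<inter> {M<..N}. 1 / real p) = (\<Sum>n\<in>{M<..N}. (A n - A (n - 1)) / ln (real n))"
  proof (rule sum.mono_neutral_cong_left)
    have AS: "A n = (if n \<in> GP then ln (real n) / real n else 0) + A (n - 1)" if "n > M" for n
    proof -
      have "{p. p \<in> GP \<and> p \<le> n} = (if n \<in> GP then {n} else {}) \<union> {p. p \<in> GP \<and> p \<le> n - 1}"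
        using that by (auto simp: le_eq_less_or_eq[of _ n])
      moreover have "n \<notin> {p. p \<in> GP \<and> p \<le> n - 1}" using that by auto
      moreover have "finite {p. p \<in> GP \<and> p \<le> n - 1}" by (rule finite_subset[of _ "{..n-1}"]) auto
      ultimately show ?thesis unfolding A_def by (cases "n \<in> GP") simp_all
    qed
    show "\<forall>i\<in>{M<..N} - GP \<inter> {M<..N}. (A i - A (i - 1)) / ln (real i) = 0" by (auto simp: AS)
    fix n assume "n \<in> GP \<inter> {M<..N}"
    moreover from this have "ln (real n) > 0" using assms by auto
    ultimately show "1 / real n = (A n - A (n - 1)) / ln (real n)" using AS[of n] by auto
  qed auto
  also have "\<dots> = G N + H N / 2"
    unfolding G_def H_def sum_divide_distrib sum.distrib[symmetric]
    by (intro sum.cong) (auto simp: R_def diff_divide_distrib add_divide_distrib)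
  finally have eq: "(\<Sum>p\<in>GP \<inter> {M<..N}. 1 / real p) = G N + H N / 2" .
  have "1 / ln N > 0" using assms by simp
  hence "\<bar>(\<Sum>p\<in>GP \<inter> {M<..N}. 1 / real p) - (ln (ln N) - ln (ln M)) / 2\<bar> \<le> 21 * (1 / ln M)"
    using G H unfolding eq abs_le_iff diff_divide_distrib by linarith
  thus ?thesis by simp
qed

lemma ln_floor_bounds:
  fixes x :: real assumes "x \<ge> 2"
  shows "ln (real (nat \<lfloor>x\<rfloor>)) \<le> ln x" "ln x \<le> ln (real (nat \<lfloor>x\<rfloor>)) + 1 / 2"
    "ln x \<le> 2 * ln (real (nat \<lfloor>x\<rfloor>))" "ln (ln x) - ln (ln (real (nat \<lfloor>x\<rfloor>))) \<le> 1 / ln x"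
    "ln (ln (real (nat \<lfloor>x\<rfloor>))) \<le> ln (ln x)" "ln (real (nat \<lfloor>x\<rfloor>)) > 0"
proof -
  define f where "f = real (nat \<lfloor>x\<rfloor>)"
  have "f = real_of_int \<lfloor>x\<rfloor>" "\<lfloor>x\<rfloor> \<ge> 2" using assms by (auto simp: f_def le_floor_iff)
  hence f: "f \<le> x" "x \<le> f + 1" "f \<ge> 2" by linarith+
  show g1: "ln (real (nat \<lfloor>x\<rfloor>)) \<le> ln x" "ln (real (nat \<lfloor>x\<rfloor>)) > 0" unfolding f_def[symmetric] using f by auto
  have "ln (x / f) \<le> x / f - 1" using f by (intro ln_le_minus_one) auto
  also have "\<dots> = (x - f) / f" using f by (simp add: diff_divide_distrib)
  also have "\<dots> \<le> 1 / f" using f by (intro divide_right_mono) auto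
  also have "\<dots> \<le> 1 / 2" using f by (intro divide_left_mono) auto
  finally have d: "ln x - ln f \<le> 1 / 2" using f by (simp add: ln_div)
  thus "ln x \<le> ln (real (nat \<lfloor>x\<rfloor>)) + 1 / 2" by (simp add: f_def)
  have "x \<le> f * f" using f mult_left_mono[of 2 f f] by linarith
  hence "ln x \<le> ln (f * f)" using f assms by (subst ln_le_cancel_iff) auto
  hence e: "ln x \<le> 2 * ln f" using f by (simp add: ln_mult)
  thus "ln x \<le> 2 * ln (real (nat \<lfloor>x\<rfloor>))" by (simp add: f_def)
  have lf: "0 < ln f" using f by simp
  have lx: "0 < ln x" using assms by simp
  have "ln (ln x / ln f) \<le> ln x / ln f - 1" using lf lx by (intro ln_le_minus_one) auto
  also have "\<dots> = (ln x - ln f) / ln f" using lf by (simp add: diff_divide_distrib)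
  also have "\<dots> \<le> (1/2) / ln f" using d lf by (intro divide_right_mono) auto
  also have "\<dots> \<le> 1 / ln x" using e lf lx by (simp add: field_simps)
  finally show "ln (ln x) - ln (ln (real (nat \<lfloor>x\<rfloor>))) \<le> 1 / ln x"
    using lf lx by (simp add: f_def[symmetric] ln_div)
  show "ln (ln (real (nat \<lfloor>x\<rfloor>))) \<le> ln (ln x)" using g1 lx by simp
qed

lemma GP_mertens_inv:
  fixes x y :: real
  assumes "2 \<le> y" "y \<le> x"
  shows "\<bar>(\<Sum>p | p \<in> GP \<and> y < real p \<and> real p \<le> x. 1 / real p) - (ln (ln x) - ln (ln y)) / 2\<bar> \<le> 43 / ln y"
proof -
  define M N where "M = nat \<lfloor>y\<rfloor>" and "N = nat \<lfloor>x\<rfloor>"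
  have MN: "2 \<le> M" "M \<le> N" using assms unfolding M_def N_def by (simp add: le_nat_iff le_floor_iff, intro nat_mono floor_mono)
  have "{p. p \<in> GP \<and> y < real p \<and> real p \<le> x} = GP \<inter> {M<..N}"
    using assms by (auto simp: M_def N_def le_nat_iff nat_less_iff le_floor_iff floor_less_iff)
  hence 1: "\<bar>(\<Sum>p | p \<in> GP \<and> y < real p \<and> real p \<le> x. 1 / real p) - (ln (ln (real N)) - ln (ln (real M))) / 2\<bar> \<le> 21 / ln (real M)"
    using GP_mertens_inv_nat[OF MN] by simp
  define T where "T = (\<Sum>p | p \<in> GP \<and> y < real p \<and> real p \<le> x. 1 / real p)"
  have ly: "ln y > 0" "ln y \<le> ln x" and x2: "x \<ge> 2" using assms by auto
  have "21 / ln (real M) \<le> 42 / ln y"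
    using ln_floor_bounds(3,6)[of y] assms ly by (simp add: M_def field_simps)
  moreover have "1 / ln x \<le> 1 / ln y" using ly by (intro divide_left_mono) auto
  ultimately have "\<bar>(\<Sum>p | p \<in> GP \<and> y < real p \<and> real p \<le> x. 1 / real p) - (ln (ln x) - ln (ln y)) / 2\<bar> \<le> 42 / ln y + 1 / ln y"
    using 1 ln_floor_bounds(4,5)[OF assms(1)] ln_floor_bounds(4,5)[OF x2]
    unfolding M_def[symmetric] N_def[symmetric] T_def[symmetric] abs_le_iff diff_divide_distrib by linarith
  thus ?thesis by (simp add: add_divide_distrib[symmetric])
qed

definition Lam :: "real \<Rightarrow> real" where "Lam x = (\<Sum>p | p \<in> GP \<and> real p \<le> x. 1 / real p)"

lemma finite_GP_le [simp]: "finite {p. p \<in> GP \<and> real p \<le> x}"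
  by (rule finite_subset[of _ "{..nat \<lfloor>x\<rfloor>}"]) (auto simp: le_nat_floor)

lemma Lam_split:
  assumes "y \<le> x"
  shows "Lam x = Lam y + (\<Sum>p | p \<in> GP \<and> y < real p \<and> real p \<le> x. 1 / real p)"
proof -
  have eq: "{p. p \<in> GP \<and> real p \<le> x} = {p. p \<in> GP \<and> real p \<le> y} \<union> {p. p \<in> GP \<and> y < real p \<and> real p \<le> x}"
    using assms by auto
  have "finite {p. p \<in> GP \<and> y < real p \<and> real p \<le> x}"
    by (rule finite_subset[OF _ finite_GP_le[of x]]) auto
  thus ?thesis unfolding Lam_def eq by (intro sum.union_disjoint) auto
qed

lemma Lam_mono: "y \<le> x \<Longrightarrow> Lam y \<le> Lam x"
  unfolding Lam_def by (intro sum_mono2) auto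

lemma Lam_2: "Lam 2 = 1/2"
proof -
  have "{p. p \<in> GP \<and> real p \<le> 2} = {2}"
  proof (intro equalityI subsetI)
    fix p assume "p \<in> {p. p \<in> GP \<and> real p \<le> 2}"
    thus "p \<in> {2}" using GP_ge2[of p] by auto
  qed (auto simp: GP_def)
  thus ?thesis by (simp add: Lam_def)
qed

lemma Lam_bounds:
  "\<exists>C. C > 0 \<and> (\<forall>x\<ge>2. \<bar>Lam x - ln (ln x) / 2\<bar> \<le> C)"
proof (intro exI conjI allI impI)
  show "43 / ln 2 + 1/2 + \<bar>ln (ln 2)\<bar> > (0::real)" by (intro add_pos_nonneg add_pos_pos) auto
  fix x :: real assume "x \<ge> 2"
  thus "\<bar>Lam x - ln (ln x) / 2\<bar> \<le> 43 / ln 2 + 1/2 + \<bar>ln (ln 2)\<bar>"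
    using GP_mertens_inv[OF _ \<open>x \<ge> 2\<close>] Lam_split[OF \<open>x \<ge> 2\<close>] Lam_2 unfolding abs_le_iff
    by (simp add: diff_divide_distrib) (linarith)
qed

lemma GP_mertens:
  fixes x :: real assumes "x \<ge> 1"
  shows "\<bar>(\<Sum>p | p \<in> GP \<and> real p \<le> x. ln (real p) / real p) - ln x / 2\<bar> \<le> 11"
proof -
  define N where "N = nat \<lfloor>x\<rfloor>"
  have N: "N \<ge> 1" using assms by (simp add: N_def le_nat_iff le_floor_iff)
  have eq: "{p. p \<in> GP \<and> real p \<le> x} = {p. p \<in> GP \<and> p \<le> N}"
    using assms by (auto simp: N_def le_nat_iff le_floor_iff)
  have f: "real N \<le> x" "x \<le> real N + 1" "real N \<ge> 1" using assms N by (auto simp: N_def)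
  have "ln (x / N) \<le> x / N - 1" using f by (intro ln_le_minus_one) auto
  also have "\<dots> \<le> 1" using f by (simp add: field_simps)
  finally have "ln x - ln N \<le> 1" "ln N \<le> ln x" using f by (simp_all add: ln_div)
  thus ?thesis using GP_mertens_nat[OF N] unfolding eq by (simp add: abs_le_iff)
qed

definition theta :: "real \<Rightarrow> real" where "theta x = (\<Sum>p | prime p \<and> real p \<le> x. ln (real p))"

lemma finite_prime_le [simp]: "finite {p. prime p \<and> real p \<le> x}"
  by (rule finite_subset[of _ "{..nat \<lfloor>x\<rfloor>}"]) (auto simp: le_nat_floor)

lemma theta_le:
  assumes "x \<ge> 0" shows "theta x \<le> 4 * x"
proof -
  have "theta x = (\<Sum>p | prime p \<and> real p \<le> x. mangoldt p)"
    unfolding theta_def by (intro sum.cong) auto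
  also have "\<dots> \<le> psi (nat \<lfloor>x\<rfloor>)"
    unfolding psi_def using assms
    by (intro sum_mono2) (auto simp: mangoldt_nonneg le_nat_floor Suc_le_eq prime_gt_0_nat)
  also have "\<dots> \<le> 4 * x" using psi_le[of "nat \<lfloor>x\<rfloor>"] of_nat_floor[OF assms] by linarith
  finally show ?thesis .
qed

text \<open>Compare \<open>GP_mertens\<close> at \<open>x\<close> and at \<open>x / exp 50\<close>:
  the main terms differ by 25 and the two errors amount to at most 22, so over the primes in between
  \<open>ln p / p\<close> sums to at least 1. Each such term is at most
  \<open>exp 50 * ln x / x\<close>.\<close>

lemma GP_count_lower:
  fixes x :: real assumes "x \<ge> exp 50"
  shows "real (card {p. p \<in> GP \<and> x / exp 50 < real p \<and> real p \<le> x}) \<ge> x / (exp 50 * ln x)"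
proof -
  define c :: real where "c = exp 50"
  define P where "P = {p. p \<in> GP \<and> x / c < real p \<and> real p \<le> x}"
  have c0: "c > 0" "c \<ge> 1" by (auto simp: c_def)
  have fin: "finite P" unfolding P_def by (rule finite_subset[OF _ finite_GP_le[of x]]) auto
  have xc: "x / c \<ge> 1" "x \<ge> c" using assms by (auto simp: c_def)
  have x2: "x \<ge> 51" using exp_ge_add_one_self[of 50] assms by simp
  hence x1: "x \<ge> 1" by simp
  have eq: "{p. p \<in> GP \<and> real p \<le> x} = {p. p \<in> GP \<and> real p \<le> x / c} \<union> P"
  proof -
    have "x / c \<le> x" using c0 x2 by (simp add: field_simps)
    thus ?thesis by (auto simp: P_def)
  qed
  have "(\<Sum>p | p \<in> GP \<and> real p \<le> x. ln (real p) / real p) = 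
      (\<Sum>p | p \<in> GP \<and> real p \<le> x / c. ln (real p) / real p) + (\<Sum>p\<in>P. ln (real p) / real p)"
    unfolding eq using fin by (intro sum.union_disjoint) (auto simp: P_def)
  moreover have "ln (x / c) = ln x - 50" using c0 x2 by (simp add: ln_div c_def)
  ultimately have "1 \<le> (\<Sum>p\<in>P. ln (real p) / real p)"
    using GP_mertens[OF x1] GP_mertens[OF xc(1)] unfolding abs_le_iff diff_divide_distrib by linarith
  also have "\<dots> \<le> (\<Sum>p\<in>P. ln x * c / x)"
  proof (rule sum_mono)
    fix p assume p: "p \<in> P"
    hence p': "x / c < real p" "real p \<le> x" "p \<ge> 2" using GP_ge2 by (auto simp: P_def)
    have "ln x \<ge> 0" using x2 by simp
    moreover have "ln (real p) \<le> ln x" using p' by (subst ln_le_cancel_iff) auto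
    ultimately have "ln (real p) / real p \<le> ln x / (x / c)"
      using p' xc c0 x2 by (intro frac_le) linarith+
    thus "ln (real p) / real p \<le> ln x * c / x" by simp
  qed
  finally have "1 \<le> real (card P) * (ln x * c / x)" by simp
  moreover have "ln x > 0" using x2 by simp
  ultimately show ?thesis using x2 c0 by (simp add: P_def c_def field_simps)
qed

section \<open>Elementary symmetric sums\<close>

text \<open>The elementary symmetric polynomial of degree \<open>k\<close>. For a set
  \<open>P\<close> of primes and \<open>w p = 1 / p\<close> it is the sum of \<open>1 / m\<close>
  over the products \<open>m\<close> of \<open>k\<close> distinct elements of
  \<open>P\<close>.\<close>

definition esym :: "('a \<Rightarrow> real) \<Rightarrow> 'a set \<Rightarrow> nat \<Rightarrow> real" where
  "esym w P k = (\<Sum>A | A \<subseteq> P \<and> card A = k. \<Prod>p\<in>A. w p)"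

lemma esym_0: "finite P \<Longrightarrow> esym w P 0 = 1"
proof -
  assume "finite P"
  hence "{A. A \<subseteq> P \<and> card A = 0} = {{}}" by (auto simp: card_eq_0_iff dest: finite_subset)
  thus ?thesis by (simp add: esym_def)
qed

lemma esym_empty_Suc: "esym w {} (Suc k) = 0"
proof -
  have "{A :: 'a set. A \<subseteq> {} \<and> card A = Suc k} = {}" by auto
  thus ?thesis unfolding esym_def by (simp only: sum.empty)
qed

lemma esym_insert:
  assumes "finite P" "x \<notin> P"
  shows "esym w (insert x P) (Suc k) = esym w P (Suc k) + w x * esym w P k"
proof -
  have eq: "{A. A \<subseteq> insert x P \<and> card A = Suc k} = {A. A \<subseteq> P \<and> card A = Suc k} \<union> insert x ` {A. A \<subseteq> P \<and> card A = k}"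
  proof (intro equalityI subsetI)
    fix A assume A: "A \<in> {A. A \<subseteq> insert x P \<and> card A = Suc k}"
    show "A \<in> {A. A \<subseteq> P \<and> card A = Suc k} \<union> insert x ` {A. A \<subseteq> P \<and> card A = k}"
    proof (cases "x \<in> A")
      case True
      hence "A = insert x (A - {x})" "A - {x} \<subseteq> P" "card (A - {x}) = k" using A by auto
      thus ?thesis by blast
    qed (use A in auto)
  next
    fix A assume A: "A \<in> {A. A \<subseteq> P \<and> card A = Suc k} \<union> insert x ` {A. A \<subseteq> P \<and> card A = k}"
    thus "A \<in> {A. A \<subseteq> insert x P \<and> card A = Suc k}"
      using assms by (auto simp: card_insert_if finite_subset)
  qed
  have "esym w (insert x P) (Suc k) = esym w P (Suc k) + (\<Sum>A\<in>insert x ` {A. A \<subseteq> P \<and> card A = k}. \<Prod>p\<in>A. w p)"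
    unfolding esym_def eq using assms by (intro sum.union_disjoint) auto
  also have "(\<Sum>A\<in>insert x ` {A. A \<subseteq> P \<and> card A = k}. \<Prod>p\<in>A. w p) = (\<Sum>A | A \<subseteq> P \<and> card A = k. \<Prod>p\<in>insert x A. w p)"
  proof (rule sum.reindex[unfolded o_def], rule inj_onI)
    fix A B assume "A \<in> {A. A \<subseteq> P \<and> card A = k}" "B \<in> {A. A \<subseteq> P \<and> card A = k}" "insert x A = insert x B"
    thus "A = B" using assms insert_ident[of x A B] by auto
  qed
  also have "\<dots> = w x * esym w P k"
    unfolding esym_def sum_distrib_left
  proof (rule sum.cong)
    fix A assume A: "A \<in> {A. A \<subseteq> P \<and> card A = k}"
    hence "finite A" "x \<notin> A" using assms finite_subset by auto
    thus "(\<Prod>p\<in>insert x A. w p) = w x * (\<Prod>p\<in>A. w p)" by simp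
  qed simp
  finally show ?thesis .
qed

lemma power_add_ge:
  fixes L w :: real assumes "L \<ge> 0" "w \<ge> 0"
  shows "(L + w) ^ Suc n \<ge> L ^ Suc n + real (Suc n) * w * L ^ n"
proof (induction n)
  case (Suc n)
  have "L ^ Suc (Suc n) + real (Suc (Suc n)) * w * L ^ Suc n \<le> (L + w) * (L ^ Suc n + real (Suc n) * w * L ^ n)"
    using assms by (simp add: algebra_simps)
  also have "\<dots> \<le> (L + w) * (L + w) ^ Suc n" using assms Suc.IH by (intro mult_left_mono) auto
  finally show ?case by simp
qed simp

text \<open>Second-order Taylor estimate with the remainder taken at the right end
  \<open>L + w\<close>; it feeds the inductive step of \<open>esym_ge\<close>.\<close>

lemma power_add_le:
  fixes L w :: real assumes "L \<ge> 0" "w \<ge> 0"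
  shows "(L + w) ^ (n + 2) \<le> L ^ (n + 2) + real (n + 2) * w * L ^ (n + 1) + real ((n + 2) * (n + 1)) / 2 * w\<^sup>2 * (L + w) ^ n"
proof (induction n)
  case 0 thus ?case by (simp add: power2_eq_square algebra_simps)
next
  case (Suc n)
  have "(L + w) ^ (Suc n + 2) = (L + w) * (L + w) ^ (n + 2)" by simp
  also have "\<dots> \<le> (L + w) * (L ^ (n + 2) + real (n + 2) * w * L ^ (n + 1) + real ((n + 2) * (n + 1)) / 2 * w\<^sup>2 * (L + w) ^ n)"
    using assms Suc.IH by (intro mult_left_mono) auto
  also have "\<dots> = L ^ (n + 3) + real (n + 3) * w * L ^ (n + 2) + real (n + 2) * w\<^sup>2 * L ^ (n + 1) 
      + real ((n + 2) * (n + 1)) / 2 * w\<^sup>2 * (L + w) ^ (n + 1)"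
    by (simp add: algebra_simps power2_eq_square eval_nat_numeral)
  also have "real (n + 2) * w\<^sup>2 * L ^ (n + 1) \<le> real (n + 2) * w\<^sup>2 * (L + w) ^ (n + 1)"
    using assms by (intro mult_left_mono power_mono) auto
  also have "L ^ (n + 3) + real (n + 3) * w * L ^ (n + 2) + real (n + 2) * w\<^sup>2 * (L + w) ^ (n + 1)
      + real ((n + 2) * (n + 1)) / 2 * w\<^sup>2 * (L + w) ^ (n + 1) =
      L ^ (Suc n + 2) + real (Suc n + 2) * w * L ^ (Suc n + 1) + real ((Suc n + 2) * (Suc n + 1)) / 2 * w\<^sup>2 * (L + w) ^ Suc n"
    by (simp add: field_simps eval_nat_numeral)
  finally show ?case by simp
qed

text \<open>Expanding \<open>sum w P ^ k\<close> produces every \<open>k\<close>-subset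
  \<open>fact k\<close> times besides nonnegative terms. Induction on \<open>P\<close> reduces this
  to \<open>power_add_ge\<close>.\<close>

lemma esym_le:
  assumes "finite P" "\<And>p. p \<in> P \<Longrightarrow> w p \<ge> 0"
  shows "esym w P k \<le> (sum w P) ^ k / fact k"
  using assms
proof (induction P arbitrary: k rule: finite_induct)
  case empty
  thus ?case by (cases k) (auto simp: esym_0 esym_empty_Suc)
next
  case (insert x P)
  define L where "L = sum w P"
  have L: "L \<ge> 0" "w x \<ge> 0" using insert unfolding L_def by (auto intro: sum_nonneg)
  show ?case
  proof (cases k)
    case (Suc n)
    have "esym w (insert x P) (Suc n) \<le> L ^ Suc n / fact (Suc n) + w x * (L ^ n / fact n)"
      unfolding esym_insert[OF insert(1,2)] L_def using insert
      by (intro add_mono mult_left_mono) (auto simp del: fact_Suc power_Suc)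
    also have "w x * (L ^ n / fact n) = (real (Suc n) * w x * L ^ n) / fact (Suc n)"
      by (simp del: of_nat_Suc)
    also have "L ^ Suc n / fact (Suc n) + \<dots> = (L ^ Suc n + real (Suc n) * w x * L ^ n) / fact (Suc n)"
      by (simp add: add_divide_distrib)
    also have "\<dots> \<le> (L + w x) ^ Suc n / fact (Suc n)"
      using L by (intro divide_right_mono power_add_ge) auto
    finally show ?thesis using insert Suc by (simp add: L_def add.commute)
  qed (use insert in \<open>auto simp: esym_0\<close>)
qed

lemma esym_1: assumes "finite P" shows "esym w P (Suc 0) = sum w P"
  using assms by (induction P rule: finite_induct) (auto simp: esym_empty_Suc esym_insert esym_0)

text \<open>What \<open>esym_le\<close> overcounts are tuples with a repeated entry; choosing two
  positions that agree bounds them by the subtracted term. The index \<open>k + 2\<close> avoids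
  truncated subtraction.\<close>

lemma esym_ge:
  assumes "finite P" "\<And>p. p \<in> P \<Longrightarrow> w p \<ge> 0"
  shows "esym w P (k + 2) \<ge> (sum w P) ^ (k + 2) / fact (k + 2) - (\<Sum>p\<in>P. (w p)\<^sup>2) / 2 * ((sum w P) ^ k / fact k)"
  using assms
proof (induction P arbitrary: k rule: finite_induct)
  case empty
  thus ?case by (simp add: esym_empty_Suc)
next
  case (insert x P)
  define L V u where "L = sum w P" and "V = (\<Sum>p\<in>P. (w p)\<^sup>2) / 2" and "u = w x"
  have L: "L \<ge> 0" "u \<ge> 0" "V \<ge> 0" using insert unfolding L_def V_def u_def by (auto intro: sum_nonneg)
  have b: "(L + u) ^ (k + 2) / fact (k + 2) \<le> L ^ (k + 2) / fact (k + 2) + u * (L ^ (k + 1) / fact (k + 1)) + u\<^sup>2 / 2 * ((L + u) ^ k / fact k)"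
  proof -
    have f1: "(fact (k + 2) :: real) = real (k + 2) * fact (k + 1)" "(fact (k + 2) :: real) = real ((k + 2) * (k + 1)) * fact k"
      by (auto simp: algebra_simps)
    have "(L + u) ^ (k + 2) / fact (k + 2) \<le> (L ^ (k + 2) + real (k + 2) * u * L ^ (k + 1) + real ((k + 2) * (k + 1)) / 2 * u\<^sup>2 * (L + u) ^ k) / fact (k + 2)"
      using L by (intro divide_right_mono power_add_le) auto
    also have "\<dots> = L ^ (k + 2) / fact (k + 2) + (real (k + 2) * u * L ^ (k + 1)) / (real (k + 2) * fact (k + 1)) 
       + (real ((k + 2) * (k + 1)) / 2 * u\<^sup>2 * (L + u) ^ k) / (real ((k + 2) * (k + 1)) * fact k)"
      unfolding add_divide_distrib f1[symmetric] by (rule refl)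
    also have "\<dots> = L ^ (k + 2) / fact (k + 2) + u * (L ^ (k + 1) / fact (k + 1)) + u\<^sup>2 / 2 * ((L + u) ^ k / fact k)"
      by (simp del: fact_Suc of_nat_add of_nat_Suc of_nat_mult)
    finally show ?thesis .
  qed
  have main: "(L + u) ^ (k + 2) / fact (k + 2) - (V + u\<^sup>2 / 2) * ((L + u) ^ k / fact k) \<le> esym w (insert x P) (k + 2)"
  proof (cases k)
    case 0
    have "esym w (insert x P) (0 + 2) = esym w P (0 + 2) + u * L"
      using esym_insert[OF insert(1,2), of w 1] esym_1[OF insert(1), of w] by (simp add: L_def u_def numeral_2_eq_2)
    moreover have "esym w P (0 + 2) \<ge> L ^ 2 / 2 - V" using insert.IH[of 0] insert.prems by (simp add: L_def V_def power2_eq_square)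
    ultimately show ?thesis using 0 by (simp add: power2_eq_square algebra_simps add_divide_distrib)
  next
    case (Suc n)
    have "esym w (insert x P) (k + 2) = esym w P (k + 2) + u * esym w P (n + 2)"
      using esym_insert[OF insert(1,2), of w "k+1"] Suc by (simp add: u_def)
    also have "\<dots> \<ge> (L ^ (k + 2) / fact (k + 2) - V * (L ^ k / fact k)) + u * (L ^ (n + 2) / fact (n + 2) - V * (L ^ n / fact n))"
      unfolding L_def V_def u_def using insert by (intro add_mono mult_left_mono insert.IH) auto
    finally have 1: "(L ^ (k + 2) / fact (k + 2) - V * (L ^ k / fact k)) + u * (L ^ (n + 2) / fact (n + 2) - V * (L ^ n / fact n)) \<le> esym w (insert x P) (k + 2)" .
    have "L ^ k / fact k + u * (L ^ n / fact n) \<le> (L + u) ^ k / fact k"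
    proof -
      have "u * (L ^ n / fact n) = (real (Suc n) * u * L ^ n) / fact (Suc n)" by (simp del: of_nat_Suc)
      hence "L ^ k / fact k + u * (L ^ n / fact n) = (L ^ Suc n + real (Suc n) * u * L ^ n) / fact (Suc n)"
        by (simp only: Suc add_divide_distrib)
      also have "\<dots> \<le> (L + u) ^ Suc n / fact (Suc n)" using L by (intro divide_right_mono power_add_ge) auto
      finally show ?thesis by (simp add: Suc)
    qed
    hence "V * (L ^ k / fact k + u * (L ^ n / fact n)) \<le> V * ((L + u) ^ k / fact k)" using L by (intro mult_left_mono) auto
    \<comment> \<open>Abstracting the factorial quotients to variables leaves an easy
      rearrangement.\<close>
    moreover have "f - (V + s) * c \<le> E" 
      if "V * (a + u * b) \<le> V * c" "(d - V * a) + u * (e - V * b) \<le> E" "f \<le> d + u * e + s * c" for a b c d e f s E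
      using that by (simp add: algebra_simps)
    moreover have "k + 1 = n + 2" by (simp add: Suc)
    ultimately show ?thesis using 1 b by metis
  qed
  have s: "sum w (insert x P) = L + u" "(\<Sum>p\<in>insert x P. (w p)\<^sup>2) / 2 = V + u\<^sup>2 / 2"
    using insert by (auto simp: L_def u_def V_def add_divide_distrib)
  show ?case unfolding s by (rule main)
qed

section \<open>Counting by extracting a prime factor\<close>

lemma finite_S [simp]: "finite (S x)"
proof (rule finite_subset)
  show "S x \<subseteq> {..nat \<lfloor>x\<rfloor>}" by (auto simp: S_def le_nat_floor)
qed auto

lemma finite_S_r [simp]: "finite (S_r k x)"
  by (rule finite_subset[OF _ finite_S[of x]]) (auto simp: S_r_def)

lemma S_pos: "n \<in> S x \<Longrightarrow> n > 0"
  by (auto simp: S_def intro!: Nat.gr0I)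

lemma prime_factors_S: "n \<in> S x \<Longrightarrow> prime_factors n \<subseteq> GP"
  by (auto simp: S_def GP_def)

lemma prod_prime_factors_squarefree:
  fixes n :: nat assumes "squarefree n" shows "\<Prod>(prime_factors n) = n"
proof -
  have n: "n > 0" using assms by (auto intro!: Nat.gr0I)
  have "n = (\<Prod>p\<in>prime_factors n. p ^ multiplicity p n)" using n by (rule prime_factorization_nat)
  also have "\<dots> = (\<Prod>p\<in>prime_factors n. p)"
  proof (rule prod.cong)
    fix p assume p: "p \<in> prime_factors n"
    have "multiplicity p n = 1"
      using assms p n squarefree_factorial_semiring'[of n] by auto
    thus "p ^ multiplicity p n = p" by simp
  qed simp
  finally show ?thesis by simp
qed

lemma prime_factors_prod_primes:
  fixes A :: "nat set" assumes "finite A" "\<And>p. p \<in> A \<Longrightarrow> prime p"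
  shows "prime_factors (\<Prod>A) = A" "squarefree (\<Prod>A)" "\<Prod>A > 0"
proof -
  have "prime_factors (\<Prod>A) = A \<and> squarefree (\<Prod>A) \<and> \<Prod>A > 0"
    using assms
  proof (induction A rule: finite_induct)
    case (insert p A)
    have p: "prime p" "p > 0" using insert by (auto simp: prime_gt_0_nat)
    have IH: "prime_factors (\<Prod>A) = A" "squarefree (\<Prod>A)" "\<Prod>A > 0" using insert by auto
    have "coprime p q" if "q \<in> A" for q using that insert p by (intro primes_coprime) auto
    hence "coprime p (\<Prod>A)" by (rule prod_coprime_right)
    hence "squarefree (p * \<Prod>A)" using IH p squarefree_prime[of p] by (intro squarefree_mult_coprime) auto
    moreover have "prime_factors (p * \<Prod>A) = insert p A"
      using IH p by (subst prime_factors_product) (auto simp: prime_prime_factors)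
    ultimately show ?case using insert IH p by simp
  qed auto
  thus "prime_factors (\<Prod>A) = A" "squarefree (\<Prod>A)" "\<Prod>A > 0" by auto
qed

lemma S_r_prod:
  assumes "n \<in> S_r k x"
  shows "\<Prod>(prime_factors n) = n" "card (prime_factors n) = k" "prime_factors n \<subseteq> GP" "n > 0" "real n < x"
  using assms prod_prime_factors_squarefree prime_factors_S[of n x] S_pos[of n x] by (auto simp: S_r_def S_def omega_def)

lemma prod_mem_S_r:
  assumes "finite A" "A \<subseteq> GP" "card A = k" "real (\<Prod>A) < x"
  shows "\<Prod>A \<in> S_r k x"
proof -
  have pr: "\<And>p. p \<in> A \<Longrightarrow> prime p" using assms GP_prime by auto
  note A = prime_factors_prod_primes[OF assms(1) pr]
  have "p mod 4 \<noteq> 3" if "prime p" "p dvd \<Prod>A" for p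
  proof -
    have "p \<in> prime_factors (\<Prod>A)" using that A(3) by (simp add: prime_factors_dvd)
    thus ?thesis using A(1) assms by (auto simp: GP_def)
  qed
  thus ?thesis using A assms by (auto simp: S_r_def S_def omega_def)
qed

lemma prime_factors_le_S_r: "n \<in> S_r k x \<Longrightarrow> p \<in> prime_factors n \<Longrightarrow> p \<in> GP \<and> real p < x"
proof -
  assume n: "n \<in> S_r k x" and p: "p \<in> prime_factors n"
  have "p \<le> n" using p S_r_prod(4)[OF n] by (intro dvd_imp_le) auto
  thus ?thesis using S_r_prod[OF n] p by auto
qed

lemma inj_prime_factors_S_r: "inj_on prime_factors (S_r k x)"
  by (rule inj_onI) (metis S_r_prod(1))

lemma sum_S_r_le_esym:
  assumes "\<And>p. w p \<ge> 0"
  shows "(\<Sum>m\<in>S_r k x. \<Prod>p\<in>prime_factors m. w p) \<le> esym w {p. p \<in> GP \<and> real p \<le> x} k"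
proof -
  have "(\<Sum>m\<in>S_r k x. \<Prod>p\<in>prime_factors m. w p) = (\<Sum>A\<in>prime_factors ` S_r k x. \<Prod>p\<in>A. w p)"
    using inj_prime_factors_S_r by (simp add: sum.reindex)
  also have "\<dots> \<le> esym w {p. p \<in> GP \<and> real p \<le> x} k"
    unfolding esym_def
  proof (rule sum_mono2)
    show "prime_factors ` S_r k x \<subseteq> {A. A \<subseteq> {p \<in> GP. real p \<le> x} \<and> card A = k}"
      using prime_factors_le_S_r S_r_prod(2) by (auto intro: less_imp_le)
  qed (auto intro!: prod_nonneg assms)
  finally show ?thesis .
qed

lemma inverse_S_r: "m \<in> S_r k x \<Longrightarrow> 1 / real m = (\<Prod>p\<in>prime_factors m. 1 / real p)"
  using arg_cong[OF S_r_prod(1)[of m k x], of real] by (simp add: prod_dividef)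

lemma div_prime_S_r:
  assumes n: "n \<in> S_r (Suc k) x" and l: "l \<in> prime_factors n"
  shows "n div l \<in> S_r k x" "prime_factors (n div l) = prime_factors n - {l}" "n = (n div l) * l"
proof -
  define A where "A = prime_factors n - {l}"
  note n' = S_r_prod[OF n]
  have fin: "finite A" "l \<notin> A" by (auto simp: A_def)
  have l0: "l > 0" using l by (auto simp: in_prime_factors_iff prime_gt_0_nat)
  have "n = \<Prod>(insert l A)" using n'(1) l by (simp add: A_def insert_absorb)
  hence eq: "n = l * \<Prod>A" using fin by simp
  hence d: "n div l = \<Prod>A" using l0 by simp
  have pr: "\<And>p. p \<in> A \<Longrightarrow> prime p" by (auto simp: A_def)
  have "\<Prod>A \<le> n" using eq l0 by simp
  hence "real (\<Prod>A) < x" using n'(5) by (metis le_less_trans of_nat_le_iff)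
  thus "n div l \<in> S_r k x" unfolding d using n' l fin by (intro prod_mem_S_r) (auto simp: A_def)
  show "prime_factors (n div l) = prime_factors n - {l}"
    unfolding d using prime_factors_prod_primes(1)[OF fin(1) pr] by (simp add: A_def)
  show "n = (n div l) * l" using eq d by (simp add: mult.commute)
qed

lemma ln_prime_nonneg: "prime p \<Longrightarrow> 0 \<le> ln (real p)"
  using prime_ge_1_nat[of p] by (intro ln_ge_zero) linarith

lemma ln_S_r: "n \<in> S_r k x \<Longrightarrow> ln (real n) = (\<Sum>p\<in>prime_factors n. ln (real p))"
proof -
  assume n: "n \<in> S_r k x"
  have "real n = (\<Prod>p\<in>prime_factors n. real p)" using arg_cong[OF S_r_prod(1)[OF n], of real] by simp
  also have "ln \<dots> = (\<Sum>p\<in>prime_factors n. ln (real p))"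
    by (rule ln_prod) (auto simp: in_prime_factors_iff prime_gt_0_nat)
  finally show ?thesis .
qed

text \<open>This replaces an inductive Hardy--Ramanujan argument: counting \<open>n\<close> with weight \<open>ln n\<close> and
  splitting the weight over the prime factors \<open>l\<close> of \<open>n\<close> gains the factor \<open>1 / ln x\<close> at the price
  of a sum over the cofactors \<open>m = n / l\<close>, in which Chebyshev's bound replaces the sum over \<open>l\<close>.\<close>

lemma card_le_cofactor_sum:
  fixes x :: real
  assumes x: "x > 1" and B: "B \<subseteq> S_r (Suc k) x"
    and Q: "\<And>n. n \<in> B \<Longrightarrow> sqrt x \<le> real n \<Longrightarrow> ln x / 8 \<le> (\<Sum>l | l \<in> prime_factors n \<and> Q (n div l). ln (real l))"
  shows "real (card B) \<le> sqrt x + 32 * (x / ln x) * (\<Sum>m | m \<in> S_r k x \<and> Q m. 1 / real m)"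
proof -
  \<comment> \<open>Small \<open>n\<close> are counted trivially; for the others \<open>ln n\<close>
    is at least half of \<open>ln x\<close>, which is what makes the assumption on \<open>Q\<close>
    attainable.\<close>
  define B1 B2 where "B1 = {n\<in>B. real n < sqrt x}" and "B2 = {n\<in>B. sqrt x \<le> real n}"
  have finB: "finite B" using B finite_subset finite_S_r by blast
  have lx: "ln x > 0" using x by simp
  have "card B = card (B1 \<union> B2)" by (rule arg_cong[where f = card]) (auto simp: B1_def B2_def)
  also have "\<dots> \<le> card B1 + card B2" by (rule card_Un_le)
  finally have c: "real (card B) \<le> real (card B1) + real (card B2)" by linarith
  have "B1 \<subseteq> {1..nat \<lfloor>sqrt x\<rfloor>}"
    using B S_r_prod(4)[of _ "Suc k" x] by (auto simp: B1_def le_nat_floor Suc_le_eq)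
  hence "real (card B1) \<le> real (nat \<lfloor>sqrt x\<rfloor>)" using card_mono[of "{1..nat \<lfloor>sqrt x\<rfloor>}" B1] by simp
  also have "\<dots> \<le> sqrt x" using x by (intro of_nat_floor) simp
  finally have b1: "real (card B1) \<le> sqrt x" .
  have "ln x / 8 * real (card B2) = (\<Sum>n\<in>B2. ln x / 8)" by simp
  also have "\<dots> \<le> (\<Sum>n\<in>B2. \<Sum>l | l \<in> prime_factors n \<and> Q (n div l). ln (real l))"
    by (intro sum_mono Q) (auto simp: B2_def)
  also have "\<dots> = (\<Sum>(n,l)\<in>(SIGMA n:B2. {l. l \<in> prime_factors n \<and> Q (n div l)}). ln (real l))"
    using finB by (subst sum.Sigma) (auto simp: B2_def)
  \<comment> \<open>The pair \<open>(n, l)\<close> is recovered from \<open>(n div l, l)\<close>, so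
    a fixed cofactor \<open>m\<close> leaves the sum of \<open>ln l\<close> over primes
    \<open>l \<le> x / m\<close>. The bound \<open>theta t \<le> 4 * t\<close> and the share 1/8
    produce the factor 32.\<close>
  also have "\<dots> \<le> (\<Sum>(m,l)\<in>(SIGMA m:{m. m \<in> S_r k x \<and> Q m}. {p. prime p \<and> real p \<le> x / real m}). ln (real l))"
  proof (rule sum_le_included[where i = "\<lambda>(m,l). (m * l, l)"])
    show "\<forall>a\<in>SIGMA n:B2. {l. l \<in> prime_factors n \<and> Q (n div l)}.
       \<exists>b\<in>SIGMA m:{m. m \<in> S_r k x \<and> Q m}. {p. prime p \<and> real p \<le> x / real m}.
          (case b of (m, l) \<Rightarrow> (m * l, l)) = a \<and> (case a of (n, l) \<Rightarrow> ln (real l)) \<le> (case b of (m, l) \<Rightarrow> ln (real l))"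
    proof
      fix a assume "a \<in> (SIGMA n:B2. {l. l \<in> prime_factors n \<and> Q (n div l)})"
      then obtain n l where a: "a = (n,l)" "n \<in> B2" "l \<in> prime_factors n" "Q (n div l)" by auto
      hence n: "n \<in> S_r (Suc k) x" using B by (auto simp: B2_def)
      note d = div_prime_S_r[OF n a(3)]
      have "real (n div l) * real l < x" using S_r_prod(5)[OF n] d(3) by (metis of_nat_mult)
      moreover have "n div l > 0" using d(1) S_r_prod(4) by blast
      ultimately have "real l \<le> x / real (n div l)" by (simp add: field_simps)
      thus "\<exists>b\<in>SIGMA m:{m. m \<in> S_r k x \<and> Q m}. {p. prime p \<and> real p \<le> x / real m}.
          (case b of (m, l) \<Rightarrow> (m * l, l)) = a \<and> (case a of (n, l) \<Rightarrow> ln (real l)) \<le> (case b of (m, l) \<Rightarrow> ln (real l))"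
        using a d by (intro bexI[of _ "(n div l, l)"]) auto
    qed
    show "finite (SIGMA n:B2. {l. l \<in> prime_factors n \<and> Q (n div l)})"
      using finB by (intro finite_SigmaI) (auto simp: B2_def)
  qed (auto simp: ln_prime_nonneg)
  also have "\<dots> = (\<Sum>m | m \<in> S_r k x \<and> Q m. theta (x / real m))"
    unfolding theta_def by (subst sum.Sigma) auto
  also have "\<dots> \<le> (\<Sum>m | m \<in> S_r k x \<and> Q m. 4 * (x / real m))"
    using x by (intro sum_mono theta_le) auto
  also have "\<dots> = 4 * x * (\<Sum>m | m \<in> S_r k x \<and> Q m. 1 / real m)"
    by (simp add: sum_distrib_left)
  finally have "real (card B2) \<le> 32 * (x / ln x) * (\<Sum>m | m \<in> S_r k x \<and> Q m. 1 / real m)"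
    using lx by (simp add: field_simps)
  thus ?thesis using b1 c by linarith
qed

section \<open>Stirling-type bounds\<close>

text \<open>At \<open>x = 1 / t\<close> the lower bound, a Pade approximant of the logarithm, equals
  \<open>1 / (t + 1/2)\<close>, exactly what the Stirling recursion needs.\<close>

lemma ln_add_one_ge:
  fixes x :: real assumes "x \<ge> 0" shows "2 * x / (2 + x) \<le> ln (1 + x)"
proof -
  have "(\<lambda>x. ln (1 + x) - 2 * x / (2 + x)) 0 \<le> (\<lambda>x. ln (1 + x) - 2 * x / (2 + x)) x"
  proof (rule DERIV_nonneg_imp_nondecreasing[OF assms])
    fix t :: real assume t: "0 \<le> t" "t \<le> x"
    have "(2 * (2 + t) - 2 * t) / ((2 + t) * (2 + t)) \<le> 1 / (1 + t)"
      using t by (simp add: divide_simps) (simp add: algebra_simps)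
    thus "\<exists>y. ((\<lambda>x. ln (1 + x) - 2 * x / (2 + x)) has_real_derivative y) (at t) \<and> 0 \<le> y"
      using t by (intro exI[of _ "1 / (1 + t) - (2 * (2 + t) - 2 * t) / ((2 + t) * (2 + t))"] conjI)
        (auto intro!: derivative_eq_intros)
  qed
  thus ?thesis by simp
qed

text \<open>The quotient of consecutive instances reduces to
  \<open>exp 1 \<le> (1 + 1/t) powr (t + 1/2)\<close>, that is, to \<open>ln_add_one_ge\<close> at
  \<open>1 / t\<close>. The constant \<open>exp 1\<close> gives equality at
  \<open>k = 1\<close>.\<close>

lemma fact_le_stirling:
  assumes "k \<ge> 1"
  shows "fact k * exp (real k) \<le> exp 1 * sqrt (real k) * real k ^ k"
  using assms
proof (induction k rule: dec_induct)
  case base thus ?case by simp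
next
  case (step k)
  define t where "t = real k"
  have t: "t \<ge> 1" using step by (simp add: t_def)
  have "exp 1 \<le> sqrt ((t + 1) / t) * ((t + 1) / t) ^ k"
  proof -
    have "1 = (t + 1/2) * (2 * (1/t) / (2 + 1/t))" using t by (simp add: field_simps)
    also have "\<dots> \<le> (t + 1/2) * ln (1 + 1/t)" using t by (intro mult_left_mono ln_add_one_ge) auto
    also have "1 + 1 / t = (t + 1) / t" using t by (simp add: field_simps)
    finally have "exp 1 \<le> exp ((t + 1/2) * ln ((t + 1) / t))" by simp
    also have "\<dots> = ((t + 1) / t) powr (1/2) * ((t + 1) / t) powr t"
      using t by (simp add: powr_def algebra_simps exp_add[symmetric])
    also have "((t + 1) / t) powr (1/2) = sqrt ((t + 1) / t)" using t by (intro powr_half_sqrt) auto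
    also have "((t + 1) / t) powr t = ((t + 1) / t) ^ k" unfolding t_def using step by (subst powr_realpow) auto
    finally show ?thesis .
  qed
  hence e: "exp 1 * (sqrt t * t ^ k) \<le> sqrt (t + 1) * (t + 1) ^ k"
    using t by (simp add: real_sqrt_divide power_divide field_simps)
  have "fact (Suc k) * exp (real (Suc k)) = (t + 1) * exp 1 * (fact k * exp t)"
    by (simp add: t_def exp_add algebra_simps)
  also have "\<dots> \<le> (t + 1) * exp 1 * (exp 1 * sqrt t * t ^ k)"
    using t step.IH by (intro mult_left_mono) (auto simp: t_def)
  also have "\<dots> = (t + 1) * exp 1 * (exp 1 * (sqrt t * t ^ k))" by simp
  also have "\<dots> \<le> (t + 1) * exp 1 * (sqrt (t + 1) * (t + 1) ^ k)"
    using t e by (intro mult_left_mono) auto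
  finally show ?case by (simp add: t_def algebra_simps)
qed

text \<open>About \<open>sqrt \<beta>\<close> terms of the exponential series of \<open>\<beta>\<close> are comparable with the largest one.\<close>

lemma poisson_le:
  fixes \<beta> :: real assumes "\<beta> \<ge> 1"
  shows "\<beta> ^ j / fact j \<le> exp 1 * exp \<beta> / sqrt \<beta>"
proof -
  define a where "a = (\<lambda>j. \<beta> ^ j / fact j :: real)"
  \<comment> \<open>The terms increase up to this index and decrease afterwards, so it is enough to
    bound the term at \<open>j0\<close>.\<close>
  define j0 where "j0 = nat \<lfloor>\<beta>\<rfloor>"
  have j0: "real j0 \<le> \<beta>" "\<beta> < real j0 + 1" using assms unfolding j0_def by linarith+
  have a0: "a j > 0" for j using assms by (simp add: a_def)
  have step: "a (Suc j) = a j * (\<beta> / real (Suc j))" for j by (simp add: a_def field_simps)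
  have up: "a j \<le> a (Suc j)" if "j < j0" for j
  proof -
    have "real (Suc j) \<le> \<beta>" using that j0 by linarith
    hence "1 \<le> \<beta> / real (Suc j)" by simp
    thus ?thesis unfolding step using mult_left_mono[of 1 "\<beta> / real (Suc j)" "a j"] a0[of j] by simp
  qed
  have down: "a (Suc j) \<le> a j" if "j \<ge> j0" for j
  proof -
    have "\<beta> \<le> real (Suc j)" using that j0 by linarith
    hence "\<beta> / real (Suc j) \<le> 1" by simp
    thus ?thesis unfolding step using mult_left_mono[of "\<beta> / real (Suc j)" 1 "a j"] a0[of j] by simp
  qed
  have 1: "a j \<le> a j0"
  proof (cases "j \<le> j0")
    case True
    thus ?thesis by (induction j rule: inc_induct) (auto intro: order_trans up)
  next
    case False
    hence "j0 \<le> j" by simp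
    thus ?thesis by (induction j rule: dec_induct) (auto intro: order_trans down)
  qed
  define m where "m = nat \<lfloor>sqrt \<beta>\<rfloor>"
  have m: "real m \<le> sqrt \<beta>" "sqrt \<beta> < real m + 1" proof -
    have "sqrt \<beta> \<ge> 0" using assms by simp
    thus "real m \<le> sqrt \<beta>" "sqrt \<beta> < real m + 1" unfolding m_def by linarith+
  qed
  have 2: "a (j0 + i) \<ge> a j0 * (\<beta> / (\<beta> + real m)) ^ i" if "i \<le> m" for i
    using that
  proof (induction i)
    case (Suc i)
    have "a j0 * (\<beta> / (\<beta> + real m)) ^ Suc i = (a j0 * (\<beta> / (\<beta> + real m)) ^ i) * (\<beta> / (\<beta> + real m))" by simp
    also have "\<dots> \<le> a (j0 + i) * (\<beta> / real (Suc (j0 + i)))"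
      using Suc j0 assms a0[of "j0 + i"] by (intro mult_mono divide_left_mono) auto
    finally show ?case using step[of "j0 + i"] by simp
  qed simp
  have 3: "a j0 * exp (- 1) \<le> a (j0 + i)" if "i \<le> m" for i
  proof -
    define u where "u = real m / \<beta>"
    have u: "u \<ge> 0" using assms by (simp add: u_def)
    have "(1 + u) ^ i \<le> exp u ^ i" using u by (intro power_mono exp_ge_add_one_self) auto
    also have "\<dots> = exp (real i * u)" by (simp add: exp_of_nat_mult)
    also have "real i * u \<le> sqrt \<beta> * (sqrt \<beta> / \<beta>)"
      unfolding u_def using that m assms by (intro mult_mono divide_right_mono) auto
    also have "\<dots> = 1" using assms by simp
    finally have "(1 + u) ^ i \<le> exp 1" by simp
    moreover have "\<beta> / (\<beta> + real m) = inverse (1 + u)" using assms by (simp add: u_def field_simps)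
    ultimately have "(\<beta> / (\<beta> + real m)) ^ i \<ge> inverse (exp 1)"
      using u le_imp_inverse_le[of "(1 + u) ^ i" "exp 1"] by (simp add: power_inverse)
    hence "a j0 * exp (-1) \<le> a j0 * (\<beta> / (\<beta> + real m)) ^ i"
      using a0[of j0] by (intro mult_left_mono) (auto simp: exp_minus)
    thus ?thesis using 2[OF that] by simp
  qed
  have "(\<lambda>n. inverse (fact n) *\<^sub>R \<beta> ^ n) sums exp \<beta>" by (rule exp_converges)
  hence s: "a sums exp \<beta>" by (simp add: field_simps a_def)
  have "sqrt \<beta> * (a j0 * exp (- 1)) \<le> real (Suc m) * (a j0 * exp (-1))"
    using m a0[of j0] by (intro mult_right_mono) auto
  also have "\<dots> = (\<Sum>i\<in>{..m}. a j0 * exp (-1))" by simp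
  also have "\<dots> \<le> (\<Sum>i\<in>{..m}. a (j0 + i))" by (intro sum_mono 3) auto
  also have "\<dots> = sum a ((+) j0 ` {..m})" by (subst sum.reindex) (auto simp: inj_on_def)
  also have "\<dots> \<le> exp \<beta>"
    using sum_le_suminf[OF sums_summable[OF s], of "(+) j0 ` {..m}"] sums_unique[OF s] a0 by (auto intro: less_imp_le)
  finally have "a j0 \<le> exp 1 * exp \<beta> / sqrt \<beta>" using assms by (simp add: exp_minus field_simps)
  thus ?thesis using 1 by (simp add: a_def)
qed

text \<open>Passage from a binomial to a Poisson weight at the cost of a constant.\<close>

lemma binomial_poisson_le:
  fixes L B :: real
  assumes k: "k \<ge> 1" and L: "L > 0" and B: "L / 4 \<le> B" "B * real k / L \<ge> 1" and j: "j \<le> k"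
  shows "B ^ j / fact j \<le> 2 * exp 2 * (L ^ k / fact k) * (real k / L) ^ (k - j) * exp (- ((L - B) * (real k / L)))"
proof -
  define \<beta> where "\<beta> = B * real k / L"
  have B0: "B > 0" using L B by linarith
  have "B ^ j / fact j = (\<beta> ^ j / fact j) * (L / real k) ^ j"
    using k L by (simp add: \<beta>_def power_mult_distrib power_divide)
  also have "\<dots> \<le> exp 1 * exp \<beta> / sqrt \<beta> * (L / real k) ^ j"
    using B L by (intro mult_right_mono poisson_le) (auto simp: \<beta>_def)
  also have "\<dots> = exp \<beta> / sqrt \<beta> * (exp 1 * (L / real k) ^ j)" by simp
  \<comment> \<open>The assumption \<open>L / 4 \<le> B\<close> enters here: it makes the saving
    \<open>1 / sqrt \<beta>\<close> comparable with \<open>1 / sqrt k\<close>, which is what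
    Stirling's formula absorbs, so only a constant is lost.\<close>
  also have "exp \<beta> / sqrt \<beta> \<le> 2 * exp (\<beta> - real k) * (exp (real k) / sqrt (real k))"
  proof -
    have "k / 4 \<le> \<beta>" using mult_right_mono[OF B(1), of "real k / L"] L by (simp add: \<beta>_def)
    hence "sqrt (real k / 4) \<le> sqrt \<beta>" by simp
    hence "sqrt (real k) \<le> 2 * sqrt \<beta>" by (simp add: real_sqrt_divide)
    moreover have "sqrt \<beta> > 0" "sqrt (real k) > 0" using k B0 L by (auto simp: \<beta>_def)
    ultimately have "1 / sqrt \<beta> \<le> 2 / sqrt (real k)" by (simp add: field_simps)
    hence "exp \<beta> * (1 / sqrt \<beta>) \<le> exp \<beta> * (2 / sqrt (real k))" by (intro mult_left_mono) auto
    thus ?thesis by (simp add: exp_diff mult.commute)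
  qed
  also have "exp (real k) / sqrt (real k) \<le> exp 1 * (real k ^ k / fact k)"
    using fact_le_stirling[OF k] k by (simp add: field_simps)
  finally have "B ^ j / fact j \<le> 2 * exp (\<beta> - real k) * (exp 1 * (real k ^ k / fact k)) * (exp 1 * (L / real k) ^ j)"
    using L by (simp add: mult_right_mono mult_left_mono)
  also have "real k ^ k / fact k * (L / real k) ^ j = (L ^ k / fact k) * (real k / L) ^ (k - j)"
  proof -
    have "(real k / L) ^ k = (real k / L) ^ (k - j) * (real k / L) ^ j" using j by (simp add: power_add[symmetric])
    moreover have "(real k / L) ^ j * (L / real k) ^ j = 1" using k L by (simp add: power_mult_distrib[symmetric])
    moreover have "real k ^ k = L ^ k * (real k / L) ^ k" using L by (simp add: power_mult_distrib[symmetric])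
    ultimately show ?thesis by simp
  qed
  hence "2 * exp (\<beta> - real k) * (exp 1 * (real k ^ k / fact k)) * (exp 1 * (L / real k) ^ j) 
    = 2 * (exp 1 * exp 1) * ((L ^ k / fact k) * (real k / L) ^ (k - j)) * exp (\<beta> - real k)"
    by simp
  also have "exp 1 * exp 1 = (exp 2 :: real)" by (simp add: exp_add[symmetric])
  also have "\<beta> - real k = - ((L - B) * (real k / L))" using L by (simp add: \<beta>_def field_simps)
  finally show ?thesis by (simp add: mult.assoc)
qed

section \<open>The range of \<open>r\<close> and the size of \<open>Phi\<close>\<close>

definition mu :: "real \<Rightarrow> real" where "mu x = ln (ln x) / 2"

definition in_range :: "nat \<Rightarrow> real \<Rightarrow> bool" where
  "in_range r x \<longleftrightarrow> \<bar>real r - mu x\<bar> < mu x powr (2/3)"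

definition main_term :: "nat \<Rightarrow> real \<Rightarrow> real" where "main_term k x = Lam x ^ k / fact k"

lemma filterlim_mu: "filterlim mu at_top at_top"
  unfolding mu_def by real_asymp

lemma eventually_mu: "eventually P at_top \<Longrightarrow> eventually (\<lambda>x. P (mu x)) at_top"
  using filterlim_mu unfolding filterlim_iff by blast

text \<open>Facts about large \<open>x\<close>, uniform in \<open>r\<close>. The ratio
  \<open>(r - 1) / Lam x\<close> is recorded because it tilts all later weights; its distance from 1
  is of order \<open>mu x powr (-1/3)\<close>, since \<open>r\<close> may differ from
  \<open>mu x\<close> by nearly \<open>mu x powr (2/3)\<close>.\<close>

definition regime :: "real \<Rightarrow> real \<Rightarrow> bool" where
  "regime C x \<longleftrightarrow> x \<ge> 3 \<and> mu x \<ge> 1 \<and> \<bar>Lam x - mu x\<bar> \<le> C \<and> mu x / 2 \<le> Lam x \<and> Lam x \<le> 2 * mu x \<and>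
     (\<forall>r. in_range r x \<longrightarrow> r \<ge> 3 \<and> \<bar>real (r - 1) / Lam x - 1\<bar> \<le> C * mu x powr (-1/3) \<and> real r \<le> 2 * mu x)"

lemma in_range_facts:
  "\<exists>C>0. eventually (\<lambda>x. regime C x) at_top"
proof -
  obtain C0 where C0: "C0 > 0" "\<And>x. x \<ge> 2 \<Longrightarrow> \<bar>Lam x - ln (ln x) / 2\<bar> \<le> C0" using Lam_bounds by blast
  \<comment> \<open>The difference of \<open>r - 1\<close> and \<open>Lam x\<close> is at most
    \<open>m powr (2/3) + 1 + C0\<close>, hence at most \<open>(2 + C0) * m powr (2/3)\<close>;
    division by \<open>Lam x \<ge> m / 2\<close> doubles the constant.\<close>
  define C where "C = 2 * (2 + C0)"
  have ev: "eventually (\<lambda>m::real. m \<ge> 2 * C0 \<and> m \<ge> 1 \<and> m - m powr (2/3) \<ge> 3 \<and> m powr (2/3) \<le> m) at_top"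
    by (intro eventually_conj eventually_ge_at_top; real_asymp)
  show ?thesis
  proof (intro exI[of _ C] conjI)
    show "C > 0" using C0 by (simp add: C_def)
    show "eventually (\<lambda>x. regime C x) at_top"
      unfolding regime_def using eventually_ge_at_top[of 3] eventually_mu[OF ev]
    proof eventually_elim
      case (elim x)
      define m L where "m = mu x" and "L = Lam x"
      have m: "m \<ge> 2 * C0" "m \<ge> 1" "m - m powr (2/3) \<ge> 3" "m powr (2/3) \<le> m" using elim by (auto simp: m_def)
      have L: "\<bar>L - m\<bar> \<le> C0" using C0(2)[of x] elim by (simp add: L_def m_def mu_def)
      have L': "m / 2 \<le> L" "L \<le> 2 * m" using L m by linarith+
      have "r \<ge> 3 \<and> \<bar>real (r - 1) / L - 1\<bar> \<le> C * m powr (-1/3) \<and> real r \<le> 2 * m" if "in_range r x" for r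
      proof -
        have r: "\<bar>real r - m\<bar> < m powr (2/3)" using that by (simp add: in_range_def m_def)
        hence r3: "r \<ge> 3" using m by linarith
        have "m powr (2/3) \<ge> 1" using m by (intro ge_one_powr_ge_zero) auto
        hence "C0 * 1 \<le> C0 * m powr (2/3)" using C0 by (intro mult_left_mono) auto
        hence "\<bar>real (r - 1) - L\<bar> \<le> (2 + C0) * m powr (2/3)"
          using r r3 L \<open>m powr (2/3) \<ge> 1\<close> by (simp add: algebra_simps of_nat_diff)
        hence "\<bar>real (r - 1) - L\<bar> / L \<le> ((2 + C0) * m powr (2/3)) / (m / 2)"
          using L' m C0 by (intro frac_le) auto
        also have "\<dots> = C * m powr (-1/3)"
        proof -
          have "m powr (2/3) = m powr 1 * m powr (-1/3)" by (simp only: powr_add[symmetric]) simp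
          thus ?thesis using m by (simp add: C_def)
        qed
        finally have "\<bar>real (r - 1) - L\<bar> / L \<le> C * m powr (-1/3)" .
        moreover have "\<bar>real (r - 1) / L - 1\<bar> = \<bar>real (r - 1) - L\<bar> / L"
        proof -
          have "real (r - 1) / L - 1 = (real (r - 1) - L) / L" using L' m by (simp add: diff_divide_distrib)
          thus ?thesis using L' m by (simp add: abs_divide)
        qed
        ultimately show ?thesis using r3 r m by auto
      qed
      thus ?case using elim L L' m C0 unfolding m_def[symmetric] L_def[symmetric] by (auto simp: C_def)
    qed
  qed
qed

text \<open>With \<open>k = L * t\<close>, Stirling bounds \<open>L ^ k / fact k\<close> from below
  by about \<open>exp (L - L * (t - 1)\<^sup>2) / sqrt k\<close>, and the quadratic term is only of
  order \<open>mu x powr (1/3)\<close>. So the main term nearly reaches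
  \<open>exp (mu x) = sqrt (ln x)\<close>, which allows (i) to absorb exceptional sets of size
  \<open>x / ln x\<close>.\<close>

lemma main_term_lower:
  assumes eps: "\<epsilon> > 0"
  shows "eventually (\<lambda>x. \<forall>k. in_range (Suc k) x \<longrightarrow> main_term k x \<ge> ln x powr (1/2 - \<epsilon>)) at_top"
proof -
  obtain C where C: "C > 0" and "eventually (\<lambda>x. regime C x) at_top"
    using in_range_facts by blast
  note ev = this(2)[unfolded regime_def]
  have "eventually (\<lambda>m::real. m \<ge> 1 \<and> C * m powr (-1/3) \<le> 1 \<and> 
      (m - C) - (2 * m) * (C * m powr (-1/3))\<^sup>2 - 1 - ln (2 * m) / 2 \<ge> m * (1 - 2 * \<epsilon>)) at_top"
    using eps C by (intro eventually_conj; real_asymp)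
  from eventually_mu[OF this] ev show ?thesis
  proof eventually_elim
    case (elim x)
    define m L where "m = mu x" and "L = Lam x"
    show ?case
    proof (intro allI impI)
      fix k assume k: "in_range (Suc k) x"
      define t where "t = real k / L"
      have L0: "L > 0" "L \<le> 2 * m" "m - C \<le> L" using elim by (auto simp: m_def L_def)
      have kk: "k \<ge> 1" "\<bar>t - 1\<bar> \<le> C * m powr (-1/3)" "real k \<le> 2 * m"
        using elim k by (force simp: t_def m_def L_def)+
      have t: "t > 0" using kk L0 by (simp add: t_def)
      have "real k = L * t" using L0 by (simp add: t_def)
      have "(t - 1)\<^sup>2 \<le> (C * m powr (-1/3))\<^sup>2" using kk(2) by (metis abs_ge_zero power2_abs power_mono)
      hence "L * (t - 1)\<^sup>2 \<le> (2 * m) * (C * m powr (-1/3))\<^sup>2" using L0 by (intro mult_mono) auto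
      moreover have "ln (real k) \<le> ln (2 * m)" using kk by (subst ln_le_cancel_iff) auto
      ultimately have "m * (1 - 2 * \<epsilon>) \<le> L - L * (t - 1)\<^sup>2 - 1 - ln (real k) / 2"
        using elim L0 unfolding m_def by linarith
      \<comment> \<open>Since \<open>k = L * t\<close>, both sides equal
        \<open>L * t * (2 - t)\<close>; the next step uses \<open>ln t \<le> t - 1\<close>.\<close>
      also have "L - L * (t - 1)\<^sup>2 = real k - real k * (t - 1)"
        unfolding \<open>real k = L * t\<close> by (simp add: power2_eq_square algebra_simps)
      also have "\<dots> - 1 - ln (real k) / 2 \<le> real k - real k * ln t - 1 - ln (real k) / 2"
        using t mult_left_mono[OF ln_le_minus_one[OF t], of "real k"] by simp
      finally have "exp (m * (1 - 2 * \<epsilon>)) \<le> exp (real k - real k * ln t - 1 - ln (real k) / 2)" by simp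
      also have "\<dots> = exp (real k) * (L / real k) ^ k / (exp 1 * sqrt (real k))"
      proof -
        have "exp (ln (real k) / 2) = sqrt (real k)" using kk by (simp add: powr_half_sqrt[symmetric] powr_def)
        moreover have "exp (- (real k * ln t)) = (L / real k) ^ k"
        proof -
          have "exp (- (real k * ln t)) = inverse t ^ k" using t by (simp add: exp_minus exp_of_nat_mult power_inverse)
          thus ?thesis by (simp add: t_def)
        qed
        moreover have "exp (a + - b - 1 - c) = exp a * exp (- b) / (exp 1 * exp c)" for a b c :: real
          by (simp add: exp_diff exp_add) (simp add: exp_minus field_simps)
        ultimately show ?thesis by (metis add_uminus_conv_diff)
      qed
      also have "\<dots> \<le> L ^ k / fact k"
        using fact_le_stirling[OF kk(1)] kk(1) L0 by (simp add: power_divide divide_simps) (simp add: mult_ac mult_left_mono)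
      also have "exp (m * (1 - 2 * \<epsilon>)) = ln x powr (1/2 - \<epsilon>)"
      proof -
        have "ln x > 0" using elim by (auto intro!: ln_gt_zero)
        thus ?thesis by (simp add: m_def mu_def powr_def field_simps)
      qed
      finally show "ln x powr (1/2 - \<epsilon>) \<le> main_term k x" by (simp add: main_term_def L_def)
    qed
  qed
qed

text \<open>The prime 2 contributes 1/4. As 3 is not admissible, the others are at least 5 and
  contribute at most 1/4 by telescoping. This bound keeps the correction in \<open>esym_ge\<close>
  below the main term in \<open>Phi_lower\<close>.\<close>

lemma sum_inverse_squares_le:
  assumes "finite P" "P \<subseteq> GP"
  shows "(\<Sum>p\<in>P. (1 / real p)\<^sup>2) \<le> 1/2"
proof -
  have 5: "(\<Sum>n\<in>{5..N}. 1 / (real n)\<^sup>2) \<le> 1/4 - 1 / real N" if "N \<ge> 4" for N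
    using that
  proof (induction N rule: dec_induct)
    case (step n)
    have "{5..Suc n} = insert (Suc n) {5..n}" using step by auto
    moreover have "1 / (real (Suc n))\<^sup>2 \<le> 1 / (real n * real (Suc n))"
      using step by (intro divide_left_mono) (auto simp: power2_eq_square mult_right_mono)
    moreover have "1 / (real n * real (Suc n)) = 1 / real n - 1 / real (Suc n)" using step by (simp add: field_simps)
    ultimately show ?case using step.IH by simp
  qed simp
  define N where "N = Max (insert 4 P)"
  have N: "N \<ge> 4" "\<And>p. p \<in> P \<Longrightarrow> p \<le> N" using assms by (auto simp: N_def)
  have "P \<subseteq> insert 2 {5..N}"
  proof
    fix p assume p: "p \<in> P"
    hence "p \<in> GP" using assms by auto
    hence "prime p" "p mod 4 \<noteq> 3" "p \<ge> 2" using GP_ge2 by (auto simp: GP_def)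
    moreover have "\<not> prime (4::nat)" by (simp add: prime_nat_iff) (intro exI[of _ 2], auto)
    ultimately have "p \<noteq> 4" "p \<noteq> 3" by auto
    thus "p \<in> insert 2 {5..N}" using N p \<open>p \<ge> 2\<close> by auto
  qed
  hence "(\<Sum>p\<in>P. (1 / real p)\<^sup>2) \<le> (\<Sum>p\<in>insert 2 {5..N}. (1 / real p)\<^sup>2)"
    by (intro sum_mono2) auto
  also have "\<dots> = 1/4 + (\<Sum>n\<in>{5..N}. 1 / (real n)\<^sup>2)" by (simp add: power_divide)
  also have "\<dots> \<le> 1/2" using 5[OF N(1)] divide_nonneg_nonneg[of 1 "real N"] by linarith
  finally show ?thesis .
qed

text \<open>Mark one prime \<open>p\<close> of \<open>A\<close> and forget that it is absent from
  the rest: the sum factors. This is the first moment of \<open>ln m\<close> needed for Markov's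
  inequality in \<open>Phi_lower\<close>.\<close>

lemma esym_ln_weighted_le:
  assumes fin: "finite P" and P: "P \<subseteq> GP"
  shows "(\<Sum>A | A \<subseteq> P \<and> card A = Suc k. (\<Sum>p\<in>A. ln (real p)) * (\<Prod>p\<in>A. 1 / real p))
     \<le> (\<Sum>p\<in>P. ln (real p) / real p) * ((\<Sum>p\<in>P. 1 / real p) ^ k / fact k)"
proof -
  have l0: "0 \<le> ln (real p)" if "p \<in> P" for p using that P GP_ge2 by (intro ln_ge_zero) force
  have finP: "finite {A. A \<subseteq> P \<and> card A = j}" for j using fin by auto
  have "(\<Sum>A | A \<subseteq> P \<and> card A = Suc k. (\<Sum>p\<in>A. ln (real p)) * (\<Prod>p\<in>A. 1 / real p))
     = (\<Sum>A | A \<subseteq> P \<and> card A = Suc k. \<Sum>p\<in>A. ln (real p) * (\<Prod>p\<in>A. 1 / real p))"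
    by (simp add: sum_distrib_right)
  also have "\<dots> = (\<Sum>(A,p)\<in>(SIGMA A:{A. A \<subseteq> P \<and> card A = Suc k}. A). ln (real p) * (\<Prod>p\<in>A. 1 / real p))"
    using finP by (subst sum.Sigma) (auto dest: finite_subset[OF _ fin])
  also have "\<dots> \<le> (\<Sum>(p,A)\<in>P \<times> {A. A \<subseteq> P \<and> card A = k}. (ln (real p) / real p) * (\<Prod>p\<in>A. 1 / real p))"
  proof (rule sum_le_included[where i = "\<lambda>(p,A). (insert p A, p)"])
    show "\<forall>x\<in>SIGMA A:{A. A \<subseteq> P \<and> card A = Suc k}. A.
       \<exists>y\<in>P \<times> {A. A \<subseteq> P \<and> card A = k}. (case y of (p, A) \<Rightarrow> (insert p A, p)) = x \<and>
          (case x of (A, p) \<Rightarrow> ln (real p) * (\<Prod>p\<in>A. 1 / real p)) \<le> (case y of (p, A) \<Rightarrow> ln (real p) / real p * (\<Prod>p\<in>A. 1 / real p))"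
    proof
      fix x assume "x \<in> (SIGMA A:{A. A \<subseteq> P \<and> card A = Suc k}. A)"
      then obtain A p where x: "x = (A, p)" "A \<subseteq> P" "card A = Suc k" "p \<in> A" by auto
      have fA: "finite A" using x fin finite_subset by auto
      have "(\<Prod>p\<in>A. 1 / real p) = 1 / real p * (\<Prod>p\<in>A - {p}. 1 / real p)"
        using x fA by (subst prod.remove[of A p]) auto
      thus "\<exists>y\<in>P \<times> {A. A \<subseteq> P \<and> card A = k}. (case y of (p, A) \<Rightarrow> (insert p A, p)) = x \<and>
          (case x of (A, p) \<Rightarrow> ln (real p) * (\<Prod>p\<in>A. 1 / real p)) \<le> (case y of (p, A) \<Rightarrow> ln (real p) / real p * (\<Prod>p\<in>A. 1 / real p))"
        using x fA by (intro bexI[of _ "(p, A - {p})"]) (auto simp: insert_absorb)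
    qed
    show "finite (SIGMA A:{A. A \<subseteq> P \<and> card A = Suc k}. A)"
      using finP by (intro finite_SigmaI) (auto dest: finite_subset[OF _ fin])
    show "finite (P \<times> {A. A \<subseteq> P \<and> card A = k})" using fin finP by auto
  qed (use l0 in \<open>auto intro!: mult_nonneg_nonneg prod_nonneg divide_nonneg_nonneg\<close>)
  also have "\<dots> = (\<Sum>p\<in>P. ln (real p) / real p) * esym (\<lambda>p. 1 / real p) P k"
    unfolding esym_def by (simp add: sum.cartesian_product[symmetric] sum_product)
  also have "\<dots> \<le> (\<Sum>p\<in>P. ln (real p) / real p) * ((\<Sum>p\<in>P. 1 / real p) ^ k / fact k)"
    using fin l0 by (intro mult_left_mono esym_le sum_nonneg divide_nonneg_nonneg) auto
  finally show ?thesis .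
qed

text \<open>To each product of small primes append a prime from \<open>(y / exp 50, y]\<close>,
  where \<open>y = x / (2 * \<Prod>A)\<close>; \<open>GP_count_lower\<close> supplies enough of
  them. The bound on \<open>z\<close> puts the new prime above \<open>z\<close>, so it is the
  largest prime factor and the pair can be recovered from the product.\<close>

lemma Phi_ge_sum:
  fixes x z :: real
  assumes x: "sqrt x \<ge> 2 * exp 50" "z \<le> sqrt x / (2 * exp 50)"
  shows "real (Phi (Suc k) x) \<ge> x / (2 * exp 50 * ln x) *
    (\<Sum>A | A \<subseteq> {p. p \<in> GP \<and> real p \<le> z} \<and> card A = k \<and> real (\<Prod>A) \<le> sqrt x. \<Prod>p\<in>A. 1 / real p)"
proof -
  define c :: real where "c = exp 50"
  have c: "c \<ge> 51" using exp_ge_add_one_self[of 50] by (simp add: c_def)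
  define P where "P = {p. p \<in> GP \<and> real p \<le> z}"
  have finP: "finite P" by (simp add: P_def)
  define G where "G = {A. A \<subseteq> P \<and> card A = k \<and> real (\<Prod>A) \<le> sqrt x}"
  have finG: "finite G" unfolding G_def by (rule finite_subset[OF _ finite_Pow_iff[THEN iffD2, OF finP]]) auto
  \<comment> \<open>The factor 2 makes the resulting product strictly smaller than \<open>x\<close>,
    as \<open>S x\<close> demands.\<close>
  define y where "y = (\<lambda>A. x / (2 * real (\<Prod>A)))"
  define R where "R = (\<lambda>A. {p. p \<in> GP \<and> y A / c < real p \<and> real p \<le> y A})"
  have x0: "sqrt x > 0" using x c unfolding c_def[symmetric] by linarith
  hence x0': "x > 0" by simp
  have G: "finite A" "A \<subseteq> GP" "card A = k" "real (\<Prod>A) \<le> sqrt x" "real (\<Prod>A) > 0" "\<And>p. p \<in> A \<Longrightarrow> real p \<le> z" if "A \<in> G" for A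
  proof -
    have "A \<subseteq> P" using that by (auto simp: G_def)
    thus "finite A" "A \<subseteq> GP" "card A = k" "real (\<Prod>A) \<le> sqrt x" "\<And>p. p \<in> A \<Longrightarrow> real p \<le> z"
      using that finite_subset[OF _ finP] by (auto simp: G_def P_def)
    thus "real (\<Prod>A) > 0" using GP_ge2 by (auto simp: of_nat_prod[symmetric] simp del: of_nat_prod intro!: prod_pos) (metis GP_ge2 le_zero_eq not_gr0 subsetD zero_neq_numeral)
  qed
  have y: "y A \<ge> sqrt x / 2" "y A \<le> x" if "A \<in> G" for A
  proof -
    have "sqrt x * real (\<Prod>A) \<le> sqrt x * sqrt x" using G[OF that] x0 by (intro mult_left_mono) auto
    thus "y A \<ge> sqrt x / 2" using G[OF that] x0 x0' by (simp add: y_def field_simps del: of_nat_prod)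
    have "\<Prod>A \<ge> 1" using G(5)[OF that] by linarith
    hence "x * 1 \<le> x * (2 * real (\<Prod>A))" using x0' by (intro mult_left_mono) (linarith, simp)
    thus "y A \<le> x" using G[OF that] x0' by (simp add: y_def field_simps del: of_nat_prod)
  qed
  have Rz: "real p > z" if "A \<in> G" "p \<in> R A" for A p
  proof -
    have "z \<le> (sqrt x / 2) / c" using x by (simp add: c_def)
    also have "\<dots> \<le> y A / c" using y[OF that(1)] c by (intro divide_right_mono) auto
    finally show ?thesis using that by (simp add: R_def)
  qed
  have finR: "finite (R A)" for A unfolding R_def by (rule finite_subset[OF _ finite_GP_le[of "y A"]]) auto
  have cardR: "real (card (R A)) \<ge> x / (2 * c * ln x) * (\<Prod>p\<in>A. 1 / real p)" if "A \<in> G" for A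
  proof -
    have "y A \<ge> exp 50" using y[OF that] x by linarith
    hence 1: "real (card (R A)) \<ge> y A / (c * ln (y A))" using GP_count_lower[of "y A"] by (simp add: R_def c_def)
    have "ln (y A) > 0" "ln (y A) \<le> ln x" using \<open>y A \<ge> exp 50\<close> y[OF that] c unfolding c_def[symmetric] by (auto simp: x0')
    moreover from this have "ln x > 0" by linarith
    ultimately have "y A / (c * ln x) \<le> y A / (c * ln (y A))" 
      using \<open>y A \<ge> exp 50\<close> c unfolding c_def[symmetric] by (intro divide_left_mono mult_left_mono mult_pos_pos) auto
    moreover have "y A / (c * ln x) = x / (2 * c * ln x) * (\<Prod>p\<in>A. 1 / real p)"
      by (simp add: y_def prod_dividef)
    ultimately show ?thesis using 1 by linarith
  qed
  have "inj_on (\<lambda>(A,p). \<Prod>(insert p A)) (SIGMA A:G. R A)"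
  proof (rule inj_onI, clarify)
    fix A p A' p' assume a: "A \<in> G" "p \<in> R A" "A' \<in> G" "p' \<in> R A'" "\<Prod>(insert p A) = \<Prod>(insert p' A')"
    have pf: "prime_factors (\<Prod>(insert p A)) = insert p A" "prime_factors (\<Prod>(insert p' A')) = insert p' A'"
      using G(1,2)[OF a(1)] G(1,2)[OF a(3)] a(2,4) GP_prime by (auto intro!: prime_factors_prod_primes simp: R_def)
    have eq: "insert p A = insert p' A'" by (rule trans[OF pf(1)[unfolded a(5), symmetric] pf(2)])
    have "p = p'" using eq Rz[OF a(1,2)] Rz[OF a(3,4)] G(6)[OF a(1)] G(6)[OF a(3)] by (metis insert_iff not_less)
    moreover have "p \<notin> A" "p' \<notin> A'" using Rz[OF a(1,2)] Rz[OF a(3,4)] G(6)[OF a(1)] G(6)[OF a(3)] by force+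
    ultimately show "A = A' \<and> p = p'" using eq by (metis insert_ident)
  qed
  moreover have "(\<lambda>(A,p). \<Prod>(insert p A)) ` (SIGMA A:G. R A) \<subseteq> S_r (Suc k) x"
  proof clarify
    fix A p assume a: "A \<in> G" "p \<in> R A"
    have pA: "p \<notin> A" using Rz[OF a] G(6)[OF a(1)] by force
    have "real p \<le> y A" using a by (simp add: R_def)
    hence "real p * (2 * real (\<Prod>A)) \<le> x" using G(5)[OF a(1)] by (simp add: y_def field_simps del: of_nat_prod)
    moreover have "0 < real p * real (\<Prod>A)" using a G(5)[OF a(1)] GP_ge2[of p] by (auto simp: R_def simp del: of_nat_prod)
    ultimately have "real (\<Prod>(insert p A)) < x" using G(1)[OF a(1)] pA by simp
    thus "\<Prod>(insert p A) \<in> S_r (Suc k) x"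
      using G[OF a(1)] pA a by (intro prod_mem_S_r) (auto simp: R_def)
  qed
  ultimately have "card (SIGMA A:G. R A) \<le> card (S_r (Suc k) x)"
    by (intro card_inj_on_le) auto
  moreover have "card (SIGMA A:G. R A) = (\<Sum>A\<in>G. card (R A))"
    using finG finR by (intro card_SigmaI) auto
  ultimately have "(\<Sum>A\<in>G. card (R A)) \<le> Phi (Suc k) x" by (simp add: Phi_def)
  hence "(\<Sum>A\<in>G. real (card (R A))) \<le> real (Phi (Suc k) x)" by (metis of_nat_le_iff of_nat_sum)
  moreover have "(\<Sum>A\<in>G. real (card (R A))) \<ge> (\<Sum>A\<in>G. x / (2 * c * ln x) * (\<Prod>p\<in>A. 1 / real p))"
    by (intro sum_mono cardR)
  ultimately show ?thesis by (simp add: G_def P_def c_def sum_distrib_left)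
qed

text \<open>Products of \<open>k\<close> primes up to \<open>x powr (1/8)\<close> rarely exceed \<open>sqrt x\<close>: by Markov's
  inequality for the weight \<open>ln m\<close> these carry less than half of the mass.\<close>

lemma Phi_lower:
  "\<exists>c>0. eventually (\<lambda>x. \<forall>k. in_range (Suc k) x \<longrightarrow> real (Phi (Suc k) x) \<ge> c * (x / ln x) * main_term k x) at_top"
proof -
  obtain C where C: "C > 0" and "eventually (\<lambda>x. regime C x) at_top"
    using in_range_facts by blast
  note ev = this(2)[unfolded regime_def]
  have ev1: "eventually (\<lambda>m::real. C * m powr (-1/3) \<le> 1/100 \<and> m \<ge> 20000) at_top"
    using C by (intro eventually_conj; real_asymp)
  \<comment> \<open>\<open>ln x \<ge> 4400\<close> gives
    \<open>ln x / 16 + 11 \<le> (13/100) * (ln x / 2)\<close>. Markov's inequality then puts at most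
    15/100 of \<open>M'\<close> on products above \<open>sqrt x\<close>, against the 69/100
    guaranteed by \<open>esym_ge\<close>.\<close>
  have ev2: "eventually (\<lambda>x::real. sqrt x \<ge> 2 * exp 50 \<and> x powr (1/8) \<le> sqrt x / (2 * exp 50) \<and> ln x \<ge> 4400) at_top"
    by (intro eventually_conj; real_asymp)
  show ?thesis
  proof (intro exI[of _ "1 / (4 * exp 50 * exp 200)"] conjI)
    show "eventually (\<lambda>x. \<forall>k. in_range (Suc k) x \<longrightarrow> real (Phi (Suc k) x) \<ge> (1 / (4 * exp 50 * exp 200)) * (x / ln x) * main_term k x) at_top"
      using ev eventually_mu[OF ev1] ev2
    proof eventually_elim
      case (elim x)
      show ?case
      proof (intro allI impI)
        fix k assume k: "in_range (Suc k) x"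
        define L z where "L = Lam x" and "z = x powr (1/8)"
        define P where "P = {p. p \<in> GP \<and> real p \<le> z}"
        define l where "l = Lam z"
        define M' where "M' = l ^ k / fact k"
        have x: "x \<ge> 3" "ln x \<ge> 4400" using elim by auto
        have L: "L \<ge> 10000" using elim by (auto simp: L_def)
        have kL: "k \<ge> 2" "\<bar>real k / L - 1\<bar> \<le> 1/100" using elim k by (force simp: L_def)+
        have lnz: "ln z = ln x / 8" using x by (simp add: z_def ln_powr)
        have z: "2 \<le> z" "z \<le> x"
        proof -
          show "z \<le> x" using x powr_mono[of "1/8" 1 x] by (simp add: z_def)
          have "z > 0" using x by (simp add: z_def)
          hence "exp (ln z) = z" by simp
          moreover have "exp (ln z) \<ge> 1 + ln z" by (rule exp_ge_add_one_self)
          ultimately show "2 \<le> z" using lnz x by linarith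
        qed
        have lL: "l \<le> L" "L \<le> l + 45"
        proof -
          show "l \<le> L" unfolding l_def L_def using z by (intro Lam_mono) auto
          have "ln (ln x) - ln (ln z) = ln 8" using x by (simp add: lnz ln_div)
          moreover have "ln 8 \<le> (7::real)" using ln_le_minus_one[of 8] by simp
          moreover have "43 / ln z \<le> 1" using x lnz by (simp add: field_simps)
          ultimately show "L \<le> l + 45" using GP_mertens_inv[OF z] Lam_split[OF z(2)]
            unfolding L_def l_def abs_le_iff diff_divide_distrib by linarith
        qed
        have l0: "l \<ge> 9000" using lL L by linarith
        have kl: "real k \<le> 11/10 * l"
        proof -
          have "real k / L \<le> 101/100" using kL by linarith
          hence "real k \<le> 101/100 * L" using L by (simp add: field_simps)
          thus ?thesis using lL l0 by linarith
        qed
        have M'0: "M' > 0" using l0 by (simp add: M'_def)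
        have finP: "finite P" "P \<subseteq> GP" by (auto simp: P_def)
        have sumP: "(\<Sum>p\<in>P. 1 / real p) = l" by (simp add: P_def l_def Lam_def)
        obtain n where n: "k = n + 2" using kL(1) by (metis le_add_diff_inverse2)
        have fk: "l ^ n / fact n \<le> 121/100 * M'"
        proof -
          have "l ^ n / fact n = M' * (real k * real (k - 1) / l\<^sup>2)"
          proof -
            have "M' = (l ^ n / fact n) * (l\<^sup>2 / (real k * real (k - 1)))"
              by (simp add: M'_def n power2_eq_square mult_ac)
            thus ?thesis using l0 n by simp
          qed
          also have "real k * real (k - 1) / l\<^sup>2 \<le> (11/10 * l) * (11/10 * l) / l\<^sup>2"
            using kl l0 by (intro divide_right_mono mult_mono) auto
          also have "\<dots> = 121/100" using l0 by (simp add: power2_eq_square)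
          finally show ?thesis using M'0 by (simp add: mult_left_mono)
        qed
        have fk1: "l ^ (n + 1) / fact (n + 1) \<le> 11/10 * M'"
        proof -
          have "l ^ (n + 1) / fact (n + 1) = M' * (real k / l)"
          proof -
            have "M' = (l ^ (n + 1) / fact (n + 1)) * (l / real k)"
              by (simp add: M'_def n mult_ac)
            thus ?thesis using l0 n by simp
          qed
          also have "real k / l \<le> 11/10" using kl l0 by (simp add: field_simps)
          finally show ?thesis using M'0 by (simp add: mult_left_mono)
        qed
        define w where "w = (\<lambda>A::nat set. \<Prod>p\<in>A. 1 / real p)"
        have w0: "w A \<ge> 0" for A by (auto simp: w_def intro: prod_nonneg)
        have "esym (\<lambda>p. 1 / real p) P k \<ge> M' - (\<Sum>p\<in>P. (1 / real p)\<^sup>2) / 2 * (l ^ n / fact n)"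
          using esym_ge[OF finP(1), of "\<lambda>p. 1 / real p" n] sumP by (simp add: M'_def n)
        moreover have "(\<Sum>p\<in>P. (1 / real p)\<^sup>2) / 2 * (l ^ n / fact n) \<le> (1/4) * (121/100 * M')"
          using sum_inverse_squares_le[OF finP] fk l0 by (intro mult_mono) auto
        ultimately have e1: "esym (\<lambda>p. 1 / real p) P k \<ge> 69/100 * M'" using M'0 by linarith
        have e2: "(\<Sum>A | A \<subseteq> P \<and> card A = k \<and> \<not> real (\<Prod>A) \<le> sqrt x. w A) \<le> 15/100 * M'"
        proof -
          have "ln x / 2 * (\<Sum>A | A \<subseteq> P \<and> card A = k \<and> \<not> real (\<Prod>A) \<le> sqrt x. w A)
              \<le> (\<Sum>A | A \<subseteq> P \<and> card A = k \<and> \<not> real (\<Prod>A) \<le> sqrt x. (\<Sum>p\<in>A. ln (real p)) * w A)"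
            unfolding sum_distrib_left
          proof (intro sum_mono mult_right_mono w0)
            fix A assume A: "A \<in> {A. A \<subseteq> P \<and> card A = k \<and> \<not> real (\<Prod>A) \<le> sqrt x}"
            have fA: "\<And>p. p \<in> A \<Longrightarrow> real p > 0" using A finP GP_ge2 by force
            have "ln x / 2 = ln (sqrt x)" using x by (simp add: ln_sqrt)
            also have "\<dots> \<le> ln (real (\<Prod>A))" using A x by (subst ln_le_cancel_iff) (auto intro: less_trans[of 0 "sqrt x"])
            also have "\<dots> = (\<Sum>p\<in>A. ln (real p))" using fA finite_subset[of A P] A finP by (simp add: ln_prod)
            finally show "ln x / 2 \<le> (\<Sum>p\<in>A. ln (real p))" .
          qed
          also have "\<dots> \<le> (\<Sum>A | A \<subseteq> P \<and> card A = Suc (n + 1). (\<Sum>p\<in>A. ln (real p)) * w A)"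
          proof (rule sum_mono2)
            fix A assume A: "A \<in> {A. A \<subseteq> P \<and> card A = Suc (n + 1)} - {A. A \<subseteq> P \<and> card A = k \<and> \<not> real (\<Prod>A) \<le> sqrt x}"
            have "0 \<le> ln (real p)" if "p \<in> A" for p using that A finP by (intro ln_prime_nonneg GP_prime) auto
            thus "0 \<le> (\<Sum>p\<in>A. ln (real p)) * w A" by (intro mult_nonneg_nonneg w0 sum_nonneg)
          qed (use finP n in auto)
          also have "\<dots> \<le> (\<Sum>p\<in>P. ln (real p) / real p) * (l ^ (n + 1) / fact (n + 1))"
            using esym_ln_weighted_le[OF finP, of "n+1"] sumP by (simp add: w_def)
          also have "\<dots> \<le> (ln z / 2 + 11) * (11/10 * M')"
          proof -
            have "(\<Sum>p\<in>P. ln (real p) / real p) \<le> ln z / 2 + 11"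
              using GP_mertens[of z] z unfolding P_def abs_le_iff by linarith
            thus ?thesis using fk1 l0 x lnz by (intro mult_mono) auto
          qed
          also have "\<dots> \<le> (ln x / 2 * (13/100)) * (11/10 * M')"
            using M'0 x lnz by (intro mult_right_mono) auto
          finally have "ln x / 2 * (\<Sum>A | A \<subseteq> P \<and> card A = k \<and> \<not> real (\<Prod>A) \<le> sqrt x. w A) \<le> ln x / 2 * (143/1000 * M')"
            by (simp add: algebra_simps)
          hence "(\<Sum>A | A \<subseteq> P \<and> card A = k \<and> \<not> real (\<Prod>A) \<le> sqrt x. w A) \<le> 143/1000 * M'"
            using x by (subst (asm) mult_le_cancel_left_pos) auto
          thus ?thesis using M'0 by linarith
        qed
        have "esym (\<lambda>p. 1 / real p) P k = (\<Sum>A | A \<subseteq> P \<and> card A = k \<and> real (\<Prod>A) \<le> sqrt x. w A)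
            + (\<Sum>A | A \<subseteq> P \<and> card A = k \<and> \<not> real (\<Prod>A) \<le> sqrt x. w A)"
          unfolding esym_def w_def[symmetric] using finP(1)
          by (subst sum.union_disjoint[symmetric]) (auto intro!: sum.cong)
        hence "(\<Sum>A | A \<subseteq> P \<and> card A = k \<and> real (\<Prod>A) \<le> sqrt x. w A) \<ge> M' / 2" using e1 e2 M'0 by linarith
        hence "x / (2 * exp 50 * ln x) * (M' / 2) \<le> x / (2 * exp 50 * ln x) * (\<Sum>A | A \<subseteq> P \<and> card A = k \<and> real (\<Prod>A) \<le> sqrt x. w A)"
          using x by (intro mult_left_mono) auto
        also have "\<dots> \<le> real (Phi (Suc k) x)" unfolding P_def w_def using elim by (intro Phi_ge_sum) (auto simp: z_def)
        finally have 1: "x / (2 * exp 50 * ln x) * (M' / 2) \<le> real (Phi (Suc k) x)" .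
        \<comment> \<open>Passing from \<open>Lam x\<close> to \<open>Lam z\<close> lowers the base
          by at most 45; as \<open>k / L\<close> is near 1, the \<open>k\<close>-th power loses at
          most the constant factor \<open>exp 200\<close>.\<close>
        have "exp (- 200) * main_term k x \<le> M'"
        proof -
          define u where "u = 45 / L"
          have u: "0 \<le> u" "u \<le> 1/2" using L by (auto simp: u_def field_simps)
          have "exp (- 2 * u) \<le> 1 - u"
          proof -
            have "exp (- 2 * u) = inverse (exp (2 * u))" by (simp add: exp_minus)
            also have "\<dots> \<le> inverse (1 + 2 * u)" using u exp_ge_add_one_self[of "2*u"] by (intro le_imp_inverse_le) auto
            also have "\<dots> \<le> 1 - u" using u mult_left_mono[of "2*u" 1 u] by (simp add: field_simps)
            finally show ?thesis .
          qed
          hence "exp (- 2 * u) ^ k \<le> (1 - u) ^ k" by (intro power_mono) auto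
          moreover have "exp (- 200) \<le> exp (- 2 * u) ^ k"
          proof -
            have "real k * (2 * u) = 90 * (real k / L)" by (simp add: u_def)
            also have "\<dots> \<le> 200" using kL by linarith
            finally show ?thesis by (simp add: exp_of_nat_mult[symmetric])
          qed
          ultimately have "exp (- 200) \<le> (1 - u) ^ k" by linarith
          hence "exp (- 200) * (L ^ k / fact k) \<le> (1 - u) ^ k * (L ^ k / fact k)" using L by (intro mult_right_mono) auto
          also have "\<dots> = ((1 - u) * L) ^ k / fact k" by (simp add: power_mult_distrib)
          also have "(1 - u) * L = L - 45" using L by (simp add: u_def field_simps)
          also have "(L - 45) ^ k / fact k \<le> M'" unfolding M'_def using lL L by (intro divide_right_mono power_mono) auto
          finally show ?thesis by (simp add: main_term_def L_def)
        qed
        hence "x / (2 * exp 50 * ln x) * (exp (- 200) * main_term k x / 2) \<le> x / (2 * exp 50 * ln x) * (M' / 2)"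
          using x by (intro mult_left_mono) auto
        moreover have "x / (2 * exp 50 * ln x) * (exp (- 200) * main_term k x / 2) = (1 / (4 * exp 50 * exp 200)) * (x / ln x) * main_term k x"
          by (simp add: exp_minus field_simps)
        ultimately show "(1 / (4 * exp 50 * exp 200)) * (x / ln x) * main_term k x \<le> real (Phi (Suc k) x)" using 1 by linarith
      qed
    qed
  qed auto
qed

section \<open>Prime factors in increasing order\<close>

lemma pfac_mem: "1 \<le> i \<Longrightarrow> i \<le> omega n \<Longrightarrow> pfac n i \<in> prime_factors n"
  unfolding pfac_def omega_def
  using nth_mem[of "i - 1" "sorted_list_of_set (prime_factors n)"] by simp

lemma pfac_less: "1 \<le> i \<Longrightarrow> i < j \<Longrightarrow> j \<le> omega n \<Longrightarrow> pfac n i < pfac n j"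
  unfolding pfac_def omega_def
  using sorted_wrt_nth_less[of "(<)" "sorted_list_of_set (prime_factors n)" "i - 1" "j - 1"] by simp

lemma pfac_surj: 
  assumes "p \<in> prime_factors n" obtains i where "1 \<le> i" "i \<le> omega n" "pfac n i = p"
proof -
  have "p \<in> set (sorted_list_of_set (prime_factors n))" using assms by simp
  then obtain j where "j < length (sorted_list_of_set (prime_factors n))" "sorted_list_of_set (prime_factors n) ! j = p"
    unfolding in_set_conv_nth by blast
  thus ?thesis using that[of "Suc j"] by (auto simp: pfac_def omega_def)
qed

lemma pfac_bij_betw:
  assumes "1 \<le> i" "i \<le> omega n"
  shows "bij_betw (pfac n) {1..<i} {p \<in> prime_factors n. p < pfac n i}"
  unfolding bij_betw_def
proof
  have "pfac n a \<noteq> pfac n b" if "1 \<le> a" "a < b" "b < i" for a b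
    using pfac_less[of a b n] that assms by simp
  thus "inj_on (pfac n) {1..<i}"
    by (auto simp: inj_on_def) (metis nat_neq_iff One_nat_def)
  show "pfac n ` {1..<i} = {p \<in> prime_factors n. p < pfac n i}"
  proof (intro equalityI subsetI)
    fix p assume p: "p \<in> {p \<in> prime_factors n. p < pfac n i}"
    then obtain j where j: "1 \<le> j" "j \<le> omega n" "pfac n j = p" using pfac_surj[of p n] by auto
    have "j < i"
    proof (rule ccontr)
      assume "\<not> j < i"
      hence "i < j \<or> i = j" by auto
      hence "pfac n i \<le> pfac n j" using pfac_less[of i j n] assms j by auto
      thus False using j p by auto
    qed
    thus "p \<in> pfac n ` {1..<i}" using j by auto
  next
    fix p assume "p \<in> pfac n ` {1..<i}"
    then obtain j where "1 \<le> j" "j < i" "p = pfac n j" by auto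
    thus "p \<in> {p \<in> prime_factors n. p < pfac n i}" using pfac_mem[of j n] pfac_less[of j i n] assms by auto
  qed
qed

lemma card_less_pfac: "1 \<le> i \<Longrightarrow> i \<le> omega n \<Longrightarrow> card {p \<in> prime_factors n. p < pfac n i} = i - 1"
  using bij_betw_same_card[OF pfac_bij_betw[of i n]] by simp

section \<open>Comfortable spacing\<close>

text \<open>On the block \<open>1 / p \<le> ln p / (y * ln y)\<close>, and by Chebyshev the sum of
  \<open>ln p\<close> is at most \<open>theta (2 * y) \<le> 8 * y\<close>.\<close>

lemma sum_inverse_dyadic_le:
  fixes y :: real assumes "y > 1" "\<And>p. p \<in> P \<Longrightarrow> prime p \<and> y < real p \<and> real p \<le> 2 * y"
  shows "(\<Sum>p\<in>P. 1 / real p) \<le> 8 / ln y"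
proof -
  have ly: "ln y > 0" using assms by simp
  have sub: "P \<subseteq> {p. prime p \<and> real p \<le> 2 * y}" using assms by auto
  have "(\<Sum>p\<in>P. 1 / real p) \<le> (\<Sum>p\<in>P. ln (real p) / (y * ln y))"
  proof (rule sum_mono)
    fix p assume "p \<in> P"
    hence p: "y < real p" using assms by auto
    hence "ln y \<le> ln (real p)" using assms by simp
    moreover have "1 / real p \<le> 1 / y" using p assms by (intro divide_left_mono) auto
    moreover have "1 / y = ln y / (y * ln y)" using ly by simp
    moreover have "ln y / (y * ln y) \<le> ln (real p) / (y * ln y)"
      using \<open>ln y \<le> ln (real p)\<close> ly assms(1) by (intro divide_right_mono) auto
    ultimately show "1 / real p \<le> ln (real p) / (y * ln y)" by linarith
  qed
  also have "\<dots> = (\<Sum>p\<in>P. ln (real p)) / (y * ln y)" by (simp add: sum_divide_distrib)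
  also have "(\<Sum>p\<in>P. ln (real p)) \<le> theta (2 * y)"
    unfolding theta_def using sub by (intro sum_mono2) (auto simp: ln_prime_nonneg)
  also have "\<dots> \<le> 4 * (2 * y)" using assms by (intro theta_le) auto
  finally show ?thesis using assms ly by (simp add: divide_right_mono)
qed

text \<open>Cut the range at \<open>y\<^sup>2\<close>. Mertens gives at most
  \<open>(K / 2) / ln y\<close> up to there, and the rest is at most
  \<open>K / ln (y\<^sup>2)\<close>, again \<open>(K / 2) / ln y\<close>; so the constant reproduces
  itself. The induction is on the number of squarings that reach \<open>x\<close>.\<close>

lemma sum_inverse_p_ln_le:
  "\<exists>K>0. \<forall>x y. y \<ge> 2 \<longrightarrow> (\<Sum>p | p \<in> GP \<and> y < real p \<and> real p \<le> x. 1 / (real p * ln (real p))) \<le> K / ln y"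
proof -
  define K where "K = ln 2 + 86 / ln (2::real)"
  have K0: "K > 0" by (simp add: K_def add_pos_pos)
  have "\<forall>y\<ge>2. x \<le> y ^ (2 ^ j) \<longrightarrow> (\<Sum>p | p \<in> GP \<and> y < real p \<and> real p \<le> x. 1 / (real p * ln (real p))) \<le> K / ln y" for x :: real and j
  proof (induction j)
    case 0
    show ?case
    proof (intro allI impI)
      fix y :: real assume "y \<ge> 2" "x \<le> y ^ 2 ^ 0"
      hence "{p. p \<in> GP \<and> y < real p \<and> real p \<le> x} = {}" by auto
      hence "(\<Sum>p | p \<in> GP \<and> y < real p \<and> real p \<le> x. 1 / (real p * ln (real p))) = 0" by (simp only: sum.empty)
      thus "(\<Sum>p | p \<in> GP \<and> y < real p \<and> real p \<le> x. 1 / (real p * ln (real p))) \<le> K / ln y" using K0 \<open>y \<ge> 2\<close> by simp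
    qed
  next
    case (Suc j)
    show ?case
    proof (intro allI impI)
      fix y :: real assume y: "y \<ge> 2" "x \<le> y ^ 2 ^ Suc j"
      have ly: "ln y > 0" "ln y \<ge> ln 2" using y by auto
      have y2: "y\<^sup>2 \<ge> 2" "y \<le> y\<^sup>2" using y mult_mono[of 2 y 1 y] mult_mono[of 1 y y y] by (auto simp: power2_eq_square)
      have fin: "finite {p. p \<in> GP \<and> a < real p \<and> real p \<le> b}" for a b
        by (rule finite_subset[OF _ finite_GP_le[of b]]) auto
      have l0: "0 \<le> 1 / (real p * ln (real p))" if "p \<in> GP" for p
        using ln_prime_nonneg[OF GP_prime[OF that]] by simp
      have "(\<Sum>p | p \<in> GP \<and> y < real p \<and> real p \<le> x. 1 / (real p * ln (real p))) \<le>
         (\<Sum>p\<in>{p. p \<in> GP \<and> y < real p \<and> real p \<le> y\<^sup>2} \<union> {p. p \<in> GP \<and> y\<^sup>2 < real p \<and> real p \<le> x}. 1 / (real p * ln (real p)))"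
        using fin l0 by (intro sum_mono2) auto
      also have "\<dots> = (\<Sum>p\<in>{p. p \<in> GP \<and> y < real p \<and> real p \<le> y\<^sup>2}. 1 / (real p * ln (real p))) 
         + (\<Sum>p\<in>{p. p \<in> GP \<and> y\<^sup>2 < real p \<and> real p \<le> x}. 1 / (real p * ln (real p)))"
        using fin by (intro sum.union_disjoint) auto
      also have "(\<Sum>p\<in>{p. p \<in> GP \<and> y\<^sup>2 < real p \<and> real p \<le> x}. 1 / (real p * ln (real p))) \<le> K / ln (y\<^sup>2)"
        using Suc.IH y2 y by (simp add: power_mult[symmetric])
      also have "(\<Sum>p\<in>{p. p \<in> GP \<and> y < real p \<and> real p \<le> y\<^sup>2}. 1 / (real p * ln (real p))) 
          \<le> (\<Sum>p\<in>{p. p \<in> GP \<and> y < real p \<and> real p \<le> y\<^sup>2}. (1 / real p) * (1 / ln y))"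
      proof (rule sum_mono)
        fix p assume "p \<in> {p. p \<in> GP \<and> y < real p \<and> real p \<le> y\<^sup>2}"
        hence p: "y < real p" by auto
        hence "ln y \<le> ln (real p)" using y by simp
        hence "1 / (real p * ln (real p)) \<le> 1 / (real p * ln y)"
          using ly p y by (intro divide_left_mono mult_left_mono mult_pos_pos) auto
        thus "1 / (real p * ln (real p)) \<le> (1 / real p) * (1 / ln y)" by simp
      qed
      also have "\<dots> = (\<Sum>p\<in>{p. p \<in> GP \<and> y < real p \<and> real p \<le> y\<^sup>2}. 1 / real p) * (1 / ln y)"
        by (rule sum_distrib_right[symmetric])
      also have "(\<Sum>p\<in>{p. p \<in> GP \<and> y < real p \<and> real p \<le> y\<^sup>2}. 1 / real p) \<le> K / 2"
      proof -
        have "ln (ln (y\<^sup>2)) - ln (ln y) = ln 2" using ly y by (simp add: ln_realpow ln_mult)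
        moreover have "43 / ln y \<le> 43 / ln 2" using ly by (intro divide_left_mono) auto
        ultimately show ?thesis using GP_mertens_inv[OF y(1) y2(2)] 
          unfolding K_def abs_le_iff diff_divide_distrib add_divide_distrib by simp
      qed
      also have "K / 2 * (1 / ln y) + K / ln (y\<^sup>2) = K / ln y" using ly y by (simp add: ln_realpow)
      finally show "(\<Sum>p | p \<in> GP \<and> y < real p \<and> real p \<le> x. 1 / (real p * ln (real p))) \<le> K / ln y"
        using ly by (simp add: divide_right_mono)
    qed
  qed note * = this
  show ?thesis
  proof (intro exI[of _ K] conjI K0 allI impI)
    fix x y :: real assume y: "y \<ge> 2"
    obtain N where N: "x < 2 ^ N" using real_arch_pow[of 2 x] by auto
    have "(2::real) ^ N \<le> 2 ^ (2 ^ N)" by (intro power_increasing) (auto intro: less_imp_le)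
    also have "\<dots> \<le> y ^ (2 ^ N)" using y by (intro power_mono) auto
    finally have "x \<le> y ^ (2 ^ N)" using N by linarith
    thus "(\<Sum>p | p \<in> GP \<and> y < real p \<and> real p \<le> x. 1 / (real p * ln (real p))) \<le> K / ln y"
      using * y by blast
  qed
qed

definition close_pairs :: "real \<Rightarrow> real \<Rightarrow> (nat \<times> nat) set" where
  "close_pairs y x = {(p,q). p \<in> GP \<and> q \<in> GP \<and> y < real p \<and> p < q \<and> real q \<le> 2 * real p \<and> real q \<le> x}"

text \<open>The witnesses for a failure of comfortable spacing: one prime just above
  \<open>y\<close>, or two primes above \<open>y\<close> within a factor 2. Encoding both kinds as
  sets \<open>F\<close> allows a single estimate with weight \<open>1 / \<Prod>F\<close>.\<close>

definition obstructions :: "real \<Rightarrow> real \<Rightarrow> nat set set" where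
  "obstructions y x = (\<lambda>p. {p}) ` {p. p \<in> GP \<and> y < real p \<and> real p \<le> 2 * y \<and> real p \<le> x} \<union>
     (\<lambda>(p,q). {p,q}) ` close_pairs y x"

lemma finite_close_pairs: "finite (close_pairs y x)"
  by (rule finite_subset[of _ "{p. p \<in> GP \<and> real p \<le> x} \<times> {p. p \<in> GP \<and> real p \<le> x}"])
     (auto simp: close_pairs_def)

lemma finite_obstructions: "finite (obstructions y x)"
  unfolding obstructions_def using finite_close_pairs
  by (intro finite_UnI finite_imageI finite_subset[OF _ finite_GP_le[of x]]) auto

lemma obstructionsD:
  "F \<in> obstructions y x \<Longrightarrow> finite F \<and> F \<subseteq> {p. p \<in> GP \<and> real p \<le> x} \<and> (card F = 1 \<or> card F = 2)"
  by (auto simp: obstructions_def close_pairs_def)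

lemma not_comfortably_spacedE:
  assumes n: "n \<in> S_r r x" and ns: "\<not> comfortably_spaced y n"
  shows "\<exists>F\<in>obstructions y x. F \<subseteq> prime_factors n"
proof -
  obtain i where i: "1 \<le> i" "i \<le> omega n" "real (pfac n i) > y"
    "\<not> (2 * y < real (pfac n i)) \<or> (i < omega n \<and> \<not> (real (pfac n i) < real (pfac n (i + 1)) / 2))"
    using ns by (auto simp: comfortably_spaced_def)
  note mem = prime_factors_le_S_r[OF n]
  show ?thesis
  proof (cases "2 * y < real (pfac n i)")
    case False
    thus ?thesis using i pfac_mem[OF i(1,2)] mem[OF pfac_mem[OF i(1,2)]]
      by (intro bexI[of _ "{pfac n i}"]) (auto simp: obstructions_def)
  next
    case True
    hence i': "i < omega n" "\<not> (real (pfac n i) < real (pfac n (i + 1)) / 2)" using i by auto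
    hence "i + 1 \<le> omega n" "1 \<le> i + 1" by auto
    note m2 = pfac_mem[OF this(2,1)]
    have "(pfac n i, pfac n (i + 1)) \<in> close_pairs y x"
      using mem[OF pfac_mem[OF i(1,2)]] mem[OF m2] i i' pfac_less[of i "i+1" n] by (auto simp: close_pairs_def)
    hence "{pfac n i, pfac n (i + 1)} \<in> obstructions y x" unfolding obstructions_def by force
    thus ?thesis using m2 pfac_mem[OF i(1,2)] by (intro bexI[of _ "{pfac n i, pfac n (i + 1)}"]) auto
  qed
qed

lemma sum_close_pairs_le:
  "\<exists>K>0. \<forall>x y. y \<ge> 2 \<longrightarrow> (\<Sum>(p,q)\<in>close_pairs y x. 1 / (real p * real q)) \<le> K / ln y"
proof -
  obtain K where K: "K > 0" "\<And>x y. y \<ge> 2 \<Longrightarrow> (\<Sum>p | p \<in> GP \<and> y < real p \<and> real p \<le> x. 1 / (real p * ln (real p))) \<le> K / ln y"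
    using sum_inverse_p_ln_le by blast
  show ?thesis
  proof (intro exI[of _ "8 * K"] conjI allI impI)
    fix x y :: real assume y: "y \<ge> 2"
    define P where "P = {p. p \<in> GP \<and> y < real p \<and> real p \<le> x}"
    have finP: "finite P" unfolding P_def by (rule finite_subset[OF _ finite_GP_le[of x]]) auto
    define R where "R = (\<lambda>p. {q. q \<in> GP \<and> real p < real q \<and> real q \<le> 2 * real p \<and> real q \<le> x})"
    have "close_pairs y x = (SIGMA p:P. R p)" by (auto simp: close_pairs_def P_def R_def)
    hence "(\<Sum>(p,q)\<in>close_pairs y x. 1 / (real p * real q)) = (\<Sum>p\<in>P. \<Sum>q\<in>R p. 1 / (real p * real q))"
      using finP by (subst sum.Sigma) (auto simp: R_def intro: finite_subset[OF _ finite_GP_le[of x]])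
    also have "\<dots> = (\<Sum>p\<in>P. 1 / real p * (\<Sum>q\<in>R p. 1 / real q))" by (simp add: sum_distrib_left)
    also have "\<dots> \<le> (\<Sum>p\<in>P. 1 / real p * (8 / ln (real p)))"
    proof (intro sum_mono mult_left_mono)
      fix p assume "p \<in> P"
      thus "(\<Sum>q\<in>R p. 1 / real q) \<le> 8 / ln (real p)"
        using y by (intro sum_inverse_dyadic_le) (auto simp: P_def R_def GP_prime)
    qed auto
    also have "\<dots> = 8 * (\<Sum>p\<in>P. 1 / (real p * ln (real p)))" by (simp add: sum_distrib_left)
    also have "\<dots> \<le> 8 * (K / ln y)" using K(2)[OF y, of x] by (simp add: P_def)
    finally show "(\<Sum>(p,q)\<in>close_pairs y x. 1 / (real p * real q)) \<le> 8 * K / ln y" by simp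
  qed (use K in auto)
qed

text \<open>The second bound does not depend on \<open>y\<close>. Put
  \<open>z = x powr (1/16)\<close>. For \<open>y \<ge> z\<close> the first bound suffices. For
  \<open>y < z\<close> a product above \<open>z ^ 4\<close> can only come from a pair, whose primes
  then exceed \<open>z\<close>, so the bound for pairs applies with \<open>z\<close> in place of
  \<open>y\<close>, and \<open>ln x = 16 * ln z\<close>.\<close>

lemma sum_obstructions_le:
  "\<exists>K>0. (\<forall>x y. y \<ge> 2 \<longrightarrow> (\<Sum>F\<in>obstructions y x. 1 / real (\<Prod>F)) \<le> K / ln y) \<and>
     (\<forall>x y. y \<ge> 2 \<longrightarrow> x > 0 \<longrightarrow> x powr (1/16) \<ge> 2 \<longrightarrow> (\<Sum>F | F \<in> obstructions y x \<and> x powr (1/4) < real (\<Prod>F). 1 / real (\<Prod>F)) \<le> K / ln x)"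
proof -
  obtain K where K: "K > 0" "\<And>x y. y \<ge> 2 \<Longrightarrow> (\<Sum>(p,q)\<in>close_pairs y x. 1 / (real p * real q)) \<le> K / ln y"
    using sum_close_pairs_le by blast
  have pairs: "(\<Sum>F\<in>(\<lambda>(p,q). {p,q}) ` close_pairs y x. 1 / real (\<Prod>F)) \<le> K / ln y" if "y \<ge> 2" for x y
  proof -
    have "(\<Sum>F\<in>(\<lambda>(p,q). {p,q}) ` close_pairs y x. 1 / real (\<Prod>F)) \<le> (\<Sum>a\<in>close_pairs y x. 1 / real (\<Prod>((\<lambda>(p,q). {p,q}) a)))"
      using finite_close_pairs by (intro sum_image_le[unfolded o_def]) (auto intro!: divide_nonneg_nonneg prod_nonneg)
    also have "\<dots> = (\<Sum>(p,q)\<in>close_pairs y x. 1 / (real p * real q))"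
      by (intro sum.cong) (auto simp: close_pairs_def)
    finally show ?thesis using K(2)[OF that, of x] by linarith
  qed
  have all: "(\<Sum>F\<in>obstructions y x. 1 / real (\<Prod>F)) \<le> (8 + K) / ln y" if "y \<ge> 2" for x y
  proof -
    define P where "P = {p. p \<in> GP \<and> y < real p \<and> real p \<le> 2 * y \<and> real p \<le> x}"
    have finP: "finite P" unfolding P_def by (rule finite_subset[OF _ finite_GP_le[of x]]) auto
    have "(\<Sum>F\<in>obstructions y x. 1 / real (\<Prod>F)) \<le> (\<Sum>F\<in>(\<lambda>p. {p}) ` P. 1 / real (\<Prod>F)) + (\<Sum>F\<in>(\<lambda>(p,q). {p,q}) ` close_pairs y x. 1 / real (\<Prod>F))"
    proof -
      have "disjnt ((\<lambda>p. {p}) ` P) ((\<lambda>(p,q). {p,q}) ` close_pairs y x)"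
        by (auto simp: disjnt_def close_pairs_def) 
      thus ?thesis unfolding obstructions_def P_def[symmetric] using finP finite_close_pairs
        by (subst sum.union_disjoint) (auto simp: disjnt_def)
    qed
    also have "(\<Sum>F\<in>(\<lambda>p. {p}) ` P. 1 / real (\<Prod>F)) = (\<Sum>p\<in>P. 1 / real p)"
      by (subst sum.reindex) (auto simp: inj_on_def)
    also have "\<dots> \<le> 8 / ln y" using that by (intro sum_inverse_dyadic_le) (auto simp: P_def GP_prime)
    finally show ?thesis using pairs[OF that, of x] by (simp add: add_divide_distrib)
  qed
  show ?thesis
  proof (intro exI[of _ "16 * (8 + K)"] conjI allI impI)
    fix x y :: real assume y: "y \<ge> 2"
    hence "(8 + K) / ln y \<le> 16 * (8 + K) / ln y" using K by (intro divide_right_mono) auto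
    thus "(\<Sum>F\<in>obstructions y x. 1 / real (\<Prod>F)) \<le> 16 * (8 + K) / ln y" using all[OF y, of x] by linarith
  next
    fix x y :: real assume y: "y \<ge> 2" and x0: "x > 0" and x: "x powr (1/16) \<ge> 2"
    define z where "z = x powr (1/16)"
    have lnx: "ln x = 16 * ln z" using x0 by (simp add: z_def ln_powr)
    have z: "z \<ge> 2" "z ^ 4 = x powr (1/4)" "ln z = ln x / 16"
      using x x0 by (auto simp: z_def powr_power ln_powr)
    have z4: "z ^ 4 \<ge> 2 * z\<^sup>2" "z ^ 4 \<ge> 2 * z"
    proof -
      have "z\<^sup>2 * z\<^sup>2 \<ge> 2 * z\<^sup>2" using z mult_mono[of 2 z 1 z] by (intro mult_right_mono) (auto simp: power2_eq_square)
      thus 1: "z ^ 4 \<ge> 2 * z\<^sup>2" by simp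
      have "z\<^sup>2 \<ge> z" using z mult_mono[of 1 z z z] by (simp add: power2_eq_square)
      thus "z ^ 4 \<ge> 2 * z" using 1 by linarith
    qed
    show "(\<Sum>F | F \<in> obstructions y x \<and> x powr (1/4) < real (\<Prod>F). 1 / real (\<Prod>F)) \<le> 16 * (8 + K) / ln x"
    proof (cases "y \<ge> z")
      case True
      have "(\<Sum>F | F \<in> obstructions y x \<and> x powr (1/4) < real (\<Prod>F). 1 / real (\<Prod>F)) \<le> (\<Sum>F\<in>obstructions y x. 1 / real (\<Prod>F))"
        using finite_obstructions by (intro sum_mono2) (auto intro!: divide_nonneg_nonneg prod_nonneg)
      also have "\<dots> \<le> (8 + K) / ln y" by (rule all[OF y])
      also have "\<dots> \<le> (8 + K) / ln z" using True z K y by (intro divide_left_mono) auto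
      also have "\<dots> = 16 * (8 + K) / ln x" unfolding lnx by (rule mult_divide_mult_cancel_left[symmetric]) simp
      finally show ?thesis .
    next
      case False
      have "(\<Sum>F | F \<in> obstructions y x \<and> x powr (1/4) < real (\<Prod>F). 1 / real (\<Prod>F)) 
         \<le> (\<Sum>F\<in>(\<lambda>(p,q). {p,q}) ` close_pairs z x. 1 / real (\<Prod>F))"
      proof (rule sum_mono2)
        show "{F \<in> obstructions y x. x powr (1/4) < real (\<Prod>F)} \<subseteq> (\<lambda>(p,q). {p,q}) ` close_pairs z x"
        proof
          fix F assume F: "F \<in> {F \<in> obstructions y x. x powr (1/4) < real (\<Prod>F)}"
          hence big: "z ^ 4 < real (\<Prod>F)" using z by simp
          from F consider (a) p where "F = {p}" "real p \<le> 2 * y" | (b) p q where "F = {p,q}" "(p,q) \<in> close_pairs y x"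
            by (auto simp: obstructions_def)
          thus "F \<in> (\<lambda>(p,q). {p,q}) ` close_pairs z x"
          proof cases
            case a
            thus ?thesis using big False z4 by auto
          next
            case b
            hence pq: "real q \<le> 2 * real p" "p \<noteq> q" by (auto simp: close_pairs_def)
            have "z < real p"
            proof (rule ccontr)
              assume "\<not> z < real p"
              hence "real p * real q \<le> z * (2 * z)" using pq z by (intro mult_mono) auto
              thus False using big b pq z4 by (simp add: power2_eq_square)
            qed
            hence "(p,q) \<in> close_pairs z x" using b by (auto simp: close_pairs_def)
            thus ?thesis using b by force
          qed
        qed
      qed (use finite_close_pairs in \<open>auto intro!: divide_nonneg_nonneg prod_nonneg\<close>)
      also have "\<dots> \<le> K / ln z" by (rule pairs[OF z(1)])
      also have "\<dots> = 16 * K / ln x" unfolding lnx by simp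
      also have "\<dots> \<le> 16 * (8 + K) / ln x"
      proof -
        have "ln z > 0" using z(1) by simp
        hence "ln x > 0" using z(3) by linarith
        thus ?thesis by (intro divide_right_mono) auto
      qed
      finally show ?thesis .
    qed
  qed (use K in auto)
qed

lemma sum_S_r_containing_le:
  assumes F: "finite F" "F \<subseteq> {p. p \<in> GP \<and> real p \<le> x}" "card F \<le> k"
  shows "(\<Sum>m | m \<in> S_r k x \<and> F \<subseteq> prime_factors m. 1 / real m) \<le> 1 / real (\<Prod>F) * (Lam x ^ (k - card F) / fact (k - card F))"
proof -
  define P where "P = {p. p \<in> GP \<and> real p \<le> x}"
  define w where "w = (\<lambda>p::nat. 1 / real p)"
  have "(\<Sum>m | m \<in> S_r k x \<and> F \<subseteq> prime_factors m. 1 / real m) = (\<Sum>m | m \<in> S_r k x \<and> F \<subseteq> prime_factors m. prod w (prime_factors m))"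
    by (intro sum.cong) (auto simp: inverse_S_r w_def)
  also have "\<dots> \<le> (\<Sum>A | A \<subseteq> P \<and> card A = k - card F. prod w F * prod w A)"
  proof (rule sum_le_included[where i = "\<lambda>A. \<Prod>(F \<union> A)"])
    show "\<forall>m\<in>{m \<in> S_r k x. F \<subseteq> prime_factors m}. \<exists>A\<in>{A. A \<subseteq> P \<and> card A = k - card F}. 
        \<Prod>(F \<union> A) = m \<and> prod w (prime_factors m) \<le> prod w F * prod w A"
    proof
      fix m assume m: "m \<in> {m \<in> S_r k x. F \<subseteq> prime_factors m}"
      define A where "A = prime_factors m - F"
      have eq: "F \<union> A = prime_factors m" using m by (auto simp: A_def)
      have "A \<subseteq> P" using prime_factors_le_S_r[of m k x] m by (auto simp: A_def P_def intro: less_imp_le)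
      moreover have "card A = k - card F" using m S_r_prod(2)[of m k x] F by (simp add: A_def card_Diff_subset)
      moreover have "\<Prod>(F \<union> A) = m" using S_r_prod(1)[of m k x] m eq by simp
      moreover have "prod w (prime_factors m) = prod w F * prod w A"
        unfolding eq[symmetric] using F by (intro prod.union_disjoint) (auto simp: A_def)
      ultimately show "\<exists>A\<in>{A. A \<subseteq> P \<and> card A = k - card F}. \<Prod>(F \<union> A) = m \<and> prod w (prime_factors m) \<le> prod w F * prod w A"
        by (intro bexI[of _ A]) auto
    qed
  qed (auto simp: P_def w_def intro!: mult_nonneg_nonneg prod_nonneg)
  also have "\<dots> = prod w F * esym w P (k - card F)" by (simp add: esym_def sum_distrib_left)
  also have "\<dots> \<le> prod w F * (sum w P ^ (k - card F) / fact (k - card F))"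
    by (intro mult_left_mono esym_le prod_nonneg) (auto simp: P_def w_def)
  finally show ?thesis by (simp add: w_def P_def Lam_def prod_dividef)
qed

lemma card_multiples_le:
  fixes x :: real assumes "d > 0" "x > 0"
  shows "real (card {n. 0 < n \<and> real n < x \<and> d dvd n}) \<le> x / real d"
proof -
  have "{n. 0 < n \<and> real n < x \<and> d dvd n} \<subseteq> (*) d ` {1..nat \<lfloor>x / real d\<rfloor>}"
  proof
    fix n assume n: "n \<in> {n. 0 < n \<and> real n < x \<and> d dvd n}"
    then obtain e where e: "n = d * e" by auto
    have "real e \<le> x / real d" using n e assms by (simp add: field_simps)
    moreover have "e \<ge> 1" using n e by (cases e) auto
    ultimately show "n \<in> (*) d ` {1..nat \<lfloor>x / real d\<rfloor>}" using e by (auto simp: le_nat_floor)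
  qed
  hence "card {n. 0 < n \<and> real n < x \<and> d dvd n} \<le> card ((*) d ` {1..nat \<lfloor>x / real d\<rfloor>})"
    by (intro card_mono) auto
  also have "\<dots> \<le> nat \<lfloor>x / real d\<rfloor>" using card_image_le[of "{1..nat \<lfloor>x / real d\<rfloor>}" "(*) d"] by simp
  finally have "real (card {n. 0 < n \<and> real n < x \<and> d dvd n}) \<le> real (nat \<lfloor>x / real d\<rfloor>)" by (rule of_nat_mono)
  also have "\<dots> \<le> x / real d" using assms by (intro of_nat_floor) simp
  finally show ?thesis .
qed

text \<open>If \<open>\<Prod>F \<le> x powr (1/4)\<close>, then for \<open>n \<ge> sqrt x\<close>
  the primes outside \<open>F\<close> carry at least half of \<open>ln n\<close>, and removing any
  of them keeps \<open>F\<close> in the cofactor. A larger \<open>F\<close> might use up all of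
  \<open>ln n\<close>; such \<open>n\<close> are counted as multiples of \<open>\<Prod>F\<close>,
  which gives the last term without the factor \<open>main_term k x / ln y\<close>.\<close>

lemma not_comfortable_card_le:
  "\<exists>K>0. \<forall>x y k. x > 1 \<and> x powr (1/16) \<ge> 2 \<and> y \<ge> 2 \<and> k \<ge> 2 \<and> real k \<le> 2 * Lam x \<longrightarrow>
     real (card {n \<in> S_r (Suc k) x. \<not> comfortably_spaced y n}) 
       \<le> sqrt x + K * (x / ln x) * (main_term k x / ln y) + K * (x / ln x)"
proof -
  obtain K where K: "K > 0" "\<And>x y. y \<ge> 2 \<Longrightarrow> (\<Sum>F\<in>obstructions y x. 1 / real (\<Prod>F)) \<le> K / ln y"
     "\<And>x y. y \<ge> 2 \<Longrightarrow> x > 0 \<Longrightarrow> x powr (1/16) \<ge> 2 \<Longrightarrow> (\<Sum>F | F \<in> obstructions y x \<and> x powr (1/4) < real (\<Prod>F). 1 / real (\<Prod>F)) \<le> K / ln x"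
    using sum_obstructions_le by blast
  show ?thesis
  proof (intro exI[of _ "128 * K"] conjI allI impI)
    fix x y :: real and k :: nat
    assume "x > 1 \<and> x powr (1/16) \<ge> 2 \<and> y \<ge> 2 \<and> k \<ge> 2 \<and> real k \<le> 2 * Lam x"
    hence x1: "x > 1" and x: "x powr (1/16) \<ge> 2" and y: "y \<ge> 2" and k: "k \<ge> 2" "real k \<le> 2 * Lam x" by auto
    have x0: "x > 0" using x1 by simp
    have lx: "ln x > 0" and ly: "ln y > 0" using x1 y by auto
    define w where "w = (\<lambda>F::nat set. 1 / real (\<Prod>F))"
    have w0: "w F \<ge> 0" for F by (auto simp: w_def intro!: prod_nonneg)
    define O1 O2 where "O1 = {F \<in> obstructions y x. real (\<Prod>F) \<le> x powr (1/4)}" and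
       "O2 = {F. F \<in> obstructions y x \<and> x powr (1/4) < real (\<Prod>F)}"
    have finO: "finite O1" "finite O2" using finite_obstructions by (auto simp: O1_def O2_def)
    define B1 B2 where "B1 = {n \<in> S_r (Suc k) x. \<exists>F\<in>O1. F \<subseteq> prime_factors n}" and
       "B2 = {n \<in> S_r (Suc k) x. \<exists>F\<in>O2. F \<subseteq> prime_factors n}"
    have "{n \<in> S_r (Suc k) x. \<not> comfortably_spaced y n} \<subseteq> B1 \<union> B2"
    proof
      fix n assume n: "n \<in> {n \<in> S_r (Suc k) x. \<not> comfortably_spaced y n}"
      then obtain F where "F \<in> obstructions y x" "F \<subseteq> prime_factors n" using not_comfortably_spacedE[of n "Suc k" x y] by auto
      moreover from this have "F \<in> O1 \<or> F \<in> O2" by (auto simp: O1_def O2_def)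
      ultimately show "n \<in> B1 \<union> B2" using n by (auto simp: B1_def B2_def)
    qed
    moreover have finB: "finite B1" "finite B2" unfolding B1_def B2_def by simp_all
    ultimately have "card {n \<in> S_r (Suc k) x. \<not> comfortably_spaced y n} \<le> card (B1 \<union> B2)" by (intro card_mono) auto
    also have "\<dots> \<le> card B1 + card B2" by (rule card_Un_le)
    finally have c: "real (card {n \<in> S_r (Suc k) x. \<not> comfortably_spaced y n}) \<le> real (card B1) + real (card B2)" by linarith
    define Q where "Q = (\<lambda>m. \<exists>F\<in>O1. F \<subseteq> prime_factors m)"
    have "real (card B1) \<le> sqrt x + 32 * (x / ln x) * (\<Sum>m | m \<in> S_r k x \<and> Q m. 1 / real m)"
    proof (rule card_le_cofactor_sum[OF x1])
      fix n assume n: "n \<in> B1" "sqrt x \<le> real n"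
      hence nS: "n \<in> S_r (Suc k) x" by (simp add: B1_def)
      obtain F where F: "F \<in> O1" "F \<subseteq> prime_factors n" using n by (auto simp: B1_def)
      have Fpos: "\<And>p. p \<in> F \<Longrightarrow> real p > 0" using F(2) by (auto simp: in_prime_factors_iff prime_gt_0_nat)
      have finF: "finite F" using F(2) finite_subset by blast
      have pos: "real (\<Prod>F) > 0" using Fpos by (simp add: prod_pos)
      have "(\<Sum>p\<in>F. ln (real p)) = ln (real (\<Prod>F))" using Fpos finF by (simp add: ln_prod)
      also have "\<dots> \<le> ln (x powr (1/4))" using F pos x0 by (subst ln_le_cancel_iff) (auto simp: O1_def)
      finally have 1: "(\<Sum>p\<in>F. ln (real p)) \<le> ln x / 4" using x0 by (simp add: ln_powr)
      have "ln (sqrt x) \<le> ln (real n)" using n x0 S_r_prod(4)[OF nS] by (subst ln_le_cancel_iff) auto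
      hence 2: "ln x / 2 \<le> (\<Sum>p\<in>prime_factors n. ln (real p))" using x0 ln_S_r[OF nS] by (simp add: ln_sqrt)
      have "(\<Sum>p\<in>prime_factors n - F. ln (real p)) = (\<Sum>p\<in>prime_factors n. ln (real p)) - (\<Sum>p\<in>F. ln (real p))"
        using F(2) by (intro sum_diff) auto
      hence "ln x / 8 \<le> (\<Sum>p\<in>prime_factors n - F. ln (real p))" using 1 2 lx by linarith
      also have "\<dots> \<le> (\<Sum>l | l \<in> prime_factors n \<and> Q (n div l). ln (real l))"
      proof (rule sum_mono2)
        show "prime_factors n - F \<subseteq> {l \<in> prime_factors n. Q (n div l)}"
        proof
          fix l assume l: "l \<in> prime_factors n - F"
          hence "F \<subseteq> prime_factors (n div l)" using div_prime_S_r(2)[OF nS, of l] F by auto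
          thus "l \<in> {l \<in> prime_factors n. Q (n div l)}" using l F by (auto simp: Q_def)
        qed
      qed (auto simp: in_prime_factors_iff ln_prime_nonneg)
      finally show "ln x / 8 \<le> (\<Sum>l | l \<in> prime_factors n \<and> Q (n div l). ln (real l))" .
    qed (auto simp: B1_def)
    moreover have Qle: "(\<Sum>m | m \<in> S_r k x \<and> Q m. 1 / real m) \<le> 4 * main_term k x * (K / ln y)"
    proof -
      have "(\<Sum>m | m \<in> S_r k x \<and> Q m. 1 / real m) \<le> (\<Sum>m\<in>(\<Union>F\<in>O1. {m \<in> S_r k x. F \<subseteq> prime_factors m}). 1 / real m)"
        using finO by (intro sum_mono2) (auto simp: Q_def)
      also have "\<dots> \<le> (\<Sum>F\<in>O1. \<Sum>m\<in>{m \<in> S_r k x. F \<subseteq> prime_factors m}. 1 / real m)"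
      proof -
        have "(\<Sum>m\<in>(\<Union>F\<in>O1. {m \<in> S_r k x. F \<subseteq> prime_factors m}). 1 / real m)
            \<le> (\<Sum>(F,m)\<in>(SIGMA F:O1. {m \<in> S_r k x. F \<subseteq> prime_factors m}). 1 / real m)"
          using finO by (intro sum_le_included[where i = snd]) (auto intro!: bexI)
        also have "\<dots> = (\<Sum>F\<in>O1. \<Sum>m\<in>{m \<in> S_r k x. F \<subseteq> prime_factors m}. 1 / real m)"
          using finO by (subst sum.Sigma) auto
        finally show ?thesis .
      qed
      also have "\<dots> \<le> (\<Sum>F\<in>O1. w F * (4 * main_term k x))"
      proof (rule sum_mono)
        fix F assume "F \<in> O1"
        hence F: "finite F" "F \<subseteq> {p. p \<in> GP \<and> real p \<le> x}" "card F = 1 \<or> card F = 2" 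
          using obstructionsD[of F y x] by (auto simp: O1_def)
        have "(\<Sum>m\<in>{m \<in> S_r k x. F \<subseteq> prime_factors m}. 1 / real m) \<le> w F * (Lam x ^ (k - card F) / fact (k - card F))"
          unfolding w_def using F k by (intro sum_S_r_containing_le) auto
        \<comment> \<open>Lowering the index by one costs the factor
          \<open>Suc j / Lam x \<le> 2\<close>, and \<open>F\<close> has at most two
          elements.\<close>
        also have "Lam x ^ (k - card F) / fact (k - card F) \<le> 4 * main_term k x"
        proof -
          have L: "Lam x > 0" using k by linarith
          have step: "Lam x ^ j / fact j \<le> 2 * (Lam x ^ Suc j / fact (Suc j))" if "Suc j \<le> k" for j
          proof -
            have "Lam x ^ j / fact j = (real (Suc j) / Lam x) * (Lam x ^ Suc j / fact (Suc j))"
              using L by (simp del: of_nat_Suc)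
            also have "\<dots> \<le> 2 * (Lam x ^ Suc j / fact (Suc j))"
            proof (rule mult_right_mono)
              show "real (Suc j) / Lam x \<le> 2" using that k L by (simp add: field_simps)
            qed (use L in auto)
            finally show ?thesis .
          qed
          have M0: "main_term k x > 0" using L by (simp add: main_term_def)
          have k1: "Lam x ^ (k - 1) / fact (k - 1) \<le> 2 * main_term k x" using step[of "k-1"] k by (simp add: main_term_def)
          have "Lam x ^ (k - 2) / fact (k - 2) \<le> 2 * (Lam x ^ (k - 1) / fact (k - 1))" using step[of "k-2"] k
            by (simp add: Suc_diff_Suc numeral_2_eq_2)
          hence k2: "Lam x ^ (k - 2) / fact (k - 2) \<le> 4 * main_term k x" using k1 by linarith
          show ?thesis using F(3) k1 k2 M0 by auto
        qed
        finally show "(\<Sum>m\<in>{m \<in> S_r k x. F \<subseteq> prime_factors m}. 1 / real m) \<le> w F * (4 * main_term k x)"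
          using w0 by (simp add: mult_left_mono)
      qed
      also have "\<dots> = 4 * main_term k x * (\<Sum>F\<in>O1. w F)" by (simp add: sum_distrib_right[symmetric])
      also have "\<dots> \<le> 4 * main_term k x * (K / ln y)"
      proof (rule mult_left_mono)
        have "(\<Sum>F\<in>O1. w F) \<le> (\<Sum>F\<in>obstructions y x. w F)"
          using finite_obstructions w0 by (intro sum_mono2) (auto simp: O1_def)
        also have "\<dots> \<le> K / ln y" unfolding w_def by (rule K(2)[OF y])
        finally show "(\<Sum>F\<in>O1. w F) \<le> K / ln y" .
      qed (use k in \<open>simp add: main_term_def\<close>)
      finally show ?thesis .
    qed
    moreover have "32 * (x / ln x) * (\<Sum>m | m \<in> S_r k x \<and> Q m. 1 / real m) \<le> 32 * (x / ln x) * (4 * main_term k x * (K / ln y))"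
      using x0 lx by (intro mult_left_mono Qle) auto
    ultimately have "real (card B1) \<le> sqrt x + 32 * (x / ln x) * (4 * main_term k x * (K / ln y))" by linarith
    hence b1: "real (card B1) \<le> sqrt x + 128 * K * (x / ln x) * (main_term k x / ln y)" by (simp add: mult_ac)
    have "real (card B2) \<le> x * (K / ln x)"
    proof -
      have "B2 \<subseteq> (\<Union>F\<in>O2. {n. 0 < n \<and> real n < x \<and> \<Prod>F dvd n})"
      proof
        fix n assume "n \<in> B2"
        then obtain F where F: "n \<in> S_r (Suc k) x" "F \<in> O2" "F \<subseteq> prime_factors n" by (auto simp: B2_def)
        have "\<Prod>F dvd \<Prod>(prime_factors n)" using F by (intro prod_dvd_prod_subset) auto
        thus "n \<in> (\<Union>F\<in>O2. {n. 0 < n \<and> real n < x \<and> \<Prod>F dvd n})" using S_r_prod[OF F(1)] F by auto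
      qed
      moreover have fin: "finite {n. 0 < n \<and> real n < x \<and> d dvd n}" for d
        by (rule finite_subset[of _ "{..nat \<lfloor>x\<rfloor>}"]) (auto simp: le_nat_floor)
      ultimately have "card B2 \<le> card (\<Union>F\<in>O2. {n. 0 < n \<and> real n < x \<and> \<Prod>F dvd n})"
        using finO by (intro card_mono) auto
      also have "\<dots> \<le> (\<Sum>F\<in>O2. card {n. 0 < n \<and> real n < x \<and> \<Prod>F dvd n})" using finO(2) by (rule card_UN_le)
      finally have "real (card B2) \<le> real (\<Sum>F\<in>O2. card {n. 0 < n \<and> real n < x \<and> \<Prod>F dvd n})" by (rule of_nat_mono)
      hence "real (card B2) \<le> (\<Sum>F\<in>O2. real (card {n. 0 < n \<and> real n < x \<and> \<Prod>F dvd n}))" by (simp only: of_nat_sum)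
      also have "\<dots> \<le> (\<Sum>F\<in>O2. x * w F)"
      proof (rule sum_mono)
        fix F assume F: "F \<in> O2"
        have "real (\<Prod>F) > 0" using F x0 by (auto simp: O2_def intro: less_trans[of 0 "x powr (1/4)"])
        thus "real (card {n. 0 < n \<and> real n < x \<and> \<Prod>F dvd n}) \<le> x * w F"
          using card_multiples_le[of "\<Prod>F" x] x0 unfolding w_def of_nat_0_less_iff by simp
      qed
      also have "\<dots> = x * (\<Sum>F\<in>O2. w F)" by (simp add: sum_distrib_left)
      also have "\<dots> \<le> x * (K / ln x)" unfolding w_def O2_def using K(3)[OF y x0 x] x0 by (intro mult_left_mono) auto
      finally show ?thesis .
    qed
    also have "x * (K / ln x) \<le> 128 * K * (x / ln x)" using K x0 lx by (simp add: divide_right_mono)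
    finally show "real (card {n \<in> S_r (Suc k) x. \<not> comfortably_spaced y n}) 
       \<le> sqrt x + 128 * K * (x / ln x) * (main_term k x / ln y) + 128 * K * (x / ln x)" using b1 c by linarith
  qed (use K in auto)
qed

section \<open>Regular spacing\<close>

text \<open>Rankin's trick with the weight \<open>y\<close> on the primes in \<open>Z\<close>.\<close>

lemma chernoff_S_r:
  assumes Z: "Z \<subseteq> {p. p \<in> GP \<and> real p \<le> x}" and y: "y > 0" and L: "Lam x > 0"
    and Q: "\<And>m. m \<in> S_r k x \<Longrightarrow> Q m \<Longrightarrow> y ^ j \<le> y ^ card (prime_factors m \<inter> Z)"
  shows "(\<Sum>m | m \<in> S_r k x \<and> Q m. 1 / real m) \<le>
     main_term k x * exp ((y - 1) * ((\<Sum>p\<in>Z. 1 / real p) * (real k / Lam x)) - real j * ln y)"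
proof -
  define P where "P = {p. p \<in> GP \<and> real p \<le> x}"
  define w where "w = (\<lambda>p. (if p \<in> Z then y else 1) / real p)"
  define A L where "A = (\<Sum>p\<in>Z. 1 / real p)" and "L = Lam x"
  have finP: "finite P" by (simp add: P_def)
  have w0: "w p \<ge> 0" for p using y by (simp add: w_def)
  have wprod: "(\<Prod>p\<in>prime_factors m. w p) = y ^ card (prime_factors m \<inter> Z) * (1 / real m)" if "m \<in> S_r k x" for m
  proof -
    have "(\<Prod>p\<in>prime_factors m. w p) = (\<Prod>p\<in>prime_factors m. (if p \<in> Z then y else 1)) * (\<Prod>p\<in>prime_factors m. 1 / real p)"
      by (simp add: w_def prod.distrib[symmetric])
    also have "(\<Prod>p\<in>prime_factors m. (if p \<in> Z then y else 1)) = (\<Prod>p\<in>prime_factors m \<inter> Z. y)"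
      by (rule prod.inter_restrict[symmetric]) simp
    finally show ?thesis using inverse_S_r[OF that] by simp
  qed
  \<comment> \<open>Both tails are covered: \<open>y > 1\<close> when \<open>Q\<close> asks for many
    primes in \<open>Z\<close>, \<open>y < 1\<close> when it asks for few.\<close>
  have "(\<Sum>m | m \<in> S_r k x \<and> Q m. 1 / real m) * y ^ j \<le> (\<Sum>m | m \<in> S_r k x \<and> Q m. \<Prod>p\<in>prime_factors m. w p)"
    unfolding sum_distrib_right
  proof (rule sum_mono)
    fix m assume m: "m \<in> {m. m \<in> S_r k x \<and> Q m}"
    hence "1 / real m * y ^ j \<le> 1 / real m * y ^ card (prime_factors m \<inter> Z)" using Q[of m] by (intro mult_left_mono) auto
    thus "1 / real m * y ^ j \<le> (\<Prod>p\<in>prime_factors m. w p)" using wprod m by (simp add: mult.commute)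
  qed
  also have "\<dots> \<le> (\<Sum>m\<in>S_r k x. \<Prod>p\<in>prime_factors m. w p)"
    using w0 by (intro sum_mono2) (auto intro: prod_nonneg)
  also have "\<dots> \<le> esym w P k" unfolding P_def by (intro sum_S_r_le_esym w0)
  also have "\<dots> \<le> sum w P ^ k / fact k" using finP w0 by (intro esym_le) auto
  also have "sum w P = L + (y - 1) * A"
  proof -
    have "sum w P = (\<Sum>p\<in>P. 1 / real p + (if p \<in> Z then (y - 1) / real p else 0))"
      by (intro sum.cong) (auto simp: w_def diff_divide_distrib)
    also have "\<dots> = L + (\<Sum>p\<in>P. if p \<in> Z then (y - 1) / real p else 0)" by (simp add: sum.distrib L_def Lam_def P_def)
    also have "(\<Sum>p\<in>P. if p \<in> Z then (y - 1) / real p else 0) = (\<Sum>p\<in>P \<inter> Z. (y - 1) / real p)"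
      using finP by (rule sum.inter_restrict[symmetric])
    also have "P \<inter> Z = Z" using Z by (auto simp: P_def)
    finally show ?thesis by (simp add: A_def sum_distrib_left)
  qed
  also have "L + (y - 1) * A = L * (1 + (y - 1) * A / L)" using L by (simp add: L_def field_simps)
  also have "(L * (1 + (y - 1) * A / L)) ^ k / fact k \<le> (L * exp ((y - 1) * A / L)) ^ k / fact k"
  proof (intro divide_right_mono power_mono mult_left_mono)
    have "0 \<le> sum w P" using w0 by (intro sum_nonneg)
    thus "0 \<le> L * (1 + (y - 1) * A / L)" using \<open>sum w P = L + (y - 1) * A\<close> \<open>L + (y - 1) * A = _\<close> by simp
  qed (use L in \<open>auto simp: L_def\<close>)
  also have "\<dots> = main_term k x * exp ((y - 1) * (A * (real k / L)))"
    by (simp add: power_mult_distrib main_term_def L_def exp_of_nat_mult[symmetric] mult_ac)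
  finally have "(\<Sum>m | m \<in> S_r k x \<and> Q m. 1 / real m) \<le> main_term k x * exp ((y - 1) * (A * (real k / L))) / y ^ j"
    using y by (simp add: field_simps)
  also have "\<dots> = main_term k x * exp ((y - 1) * (A * (real k / L)) - real j * ln y)"
    using y by (simp add: exp_diff exp_of_nat_mult)
  finally show ?thesis by (simp add: A_def L_def)
qed

text \<open>\<open>D\<close> is the allowed deviation and
  \<open>D\<^sup>2 / M = \<eta> powr (2/5) * M powr (3/5)\<close> the Chernoff exponent. The fourth
  bound splits this into a part in \<open>\<eta>\<close>, which is the saving in (ii), and a part in
  \<open>i\<close>, which makes the union bound over \<open>i\<close> converge.\<close>

lemma deviation_facts:
  fixes \<eta> i M D :: real
  assumes "\<eta> \<ge> 1" "i \<ge> 1" "M = max i \<eta>" "D = \<eta> powr (1/5) * M powr (4/5)"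
  shows "\<eta> \<le> D" "D \<le> M" "i powr (4/5) \<le> D" "(\<eta> + i powr (3/5)) / 2 \<le> D\<^sup>2 / M" "M > 0"
proof -
  have M: "M \<ge> \<eta>" "M \<ge> i" "M \<ge> 1" using assms by auto
  thus M0: "M > 0" by simp
  have "\<eta> powr (1/5) * \<eta> powr (4/5) \<le> \<eta> powr (1/5) * M powr (4/5)" using M assms by (intro mult_left_mono powr_mono2) auto
  thus "\<eta> \<le> D" using assms by (simp add: powr_add[symmetric])
  have "\<eta> powr (1/5) * M powr (4/5) \<le> M powr (1/5) * M powr (4/5)" using M assms by (intro mult_right_mono powr_mono2) auto
  thus "D \<le> M" using assms M by (simp add: powr_add[symmetric])
  have "1 * i powr (4/5) \<le> \<eta> powr (1/5) * M powr (4/5)" using M assms by (intro mult_mono powr_mono2 ge_one_powr_ge_zero) auto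
  thus "i powr (4/5) \<le> D" using assms by simp
  have "D\<^sup>2 = \<eta> powr (2/5) * M powr (8/5)"
  proof -
    have "(\<eta> powr (1/5))\<^sup>2 = \<eta> powr (2/5)" "(M powr (4/5))\<^sup>2 = M powr (8/5)"
      by (simp_all add: power2_eq_square powr_add[symmetric])
    thus ?thesis unfolding assms(4) power_mult_distrib by simp
  qed
  also have "M powr (8/5) = M * M powr (3/5)" using M0 powr_add[of M 1 "3/5"] by simp
  finally have DM: "D\<^sup>2 / M = \<eta> powr (2/5) * M powr (3/5)" using M0 by simp
  have "\<eta> powr (2/5) * \<eta> powr (3/5) \<le> D\<^sup>2 / M" unfolding DM using M assms by (intro mult_left_mono powr_mono2) auto
  hence 1: "\<eta> \<le> D\<^sup>2 / M" using assms by (simp add: powr_add[symmetric])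
  have "1 * i powr (3/5) \<le> D\<^sup>2 / M" unfolding DM using M assms by (intro mult_mono powr_mono2 ge_one_powr_ge_zero) auto
  moreover have "(a + b) / 2 \<le> v" if "1 * b \<le> v" "a \<le> v" for a b v :: real using that by simp
  ultimately show "(\<eta> + i powr (3/5)) / 2 \<le> D\<^sup>2 / M" using 1 by blast
qed

text \<open>The tilt \<open>s\<close> yields a linear gain \<open>s * D / 2\<close> against a
  quadratic loss of \<open>s\<^sup>2 * M\<close> in the first case and twice that in the second. The
  choice \<open>s = D / (8 * M)\<close> makes the gain at least double the loss.\<close>

lemma chernoff_exponents:
  fixes lam i M D s :: real
  assumes "M > 0" "0 \<le> D" "D \<le> M" "1 \<le> i" "i \<le> M" "s = D / (8 * M)"
  shows "lam \<le> i - 1 - D / 2 \<Longrightarrow> s * lam - (i - 1) * ln (1 + s) \<le> - (D\<^sup>2 / M) / 32"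
    "lam \<ge> i + D / 2 \<Longrightarrow> - s * lam - (i - 1) * ln (1 - s) \<le> - (D\<^sup>2 / M) / 32"
    "0 \<le> s" "s \<le> 1/8"
proof -
  show s: "0 \<le> s" "s \<le> 1/8" unfolding assms(6) using assms(1-3) by (auto intro!: divide_nonneg_nonneg simp: pos_divide_le_eq)
  have sM: "s * M = D / 8" using assms by simp
  have sD: "s * D = (D\<^sup>2 / M) / 8" using assms by (simp add: power2_eq_square)
  have s2: "s\<^sup>2 * M = (D\<^sup>2 / M) / 64" unfolding assms(6) using assms(1) by (simp add: power2_eq_square)
  show "s * lam - (i - 1) * ln (1 + s) \<le> - (D\<^sup>2 / M) / 32" if "lam \<le> i - 1 - D / 2"
  proof -
    have "(i - 1) * (s - s\<^sup>2) \<le> (i - 1) * ln (1 + s)"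
      using s assms by (intro mult_left_mono ln_one_plus_pos_lower_bound) auto
    moreover have "s * lam \<le> s * (i - 1 - D / 2)" using that s by (intro mult_left_mono) auto
    moreover have "(i - 1) * s\<^sup>2 \<le> M * s\<^sup>2" using assms by (intro mult_right_mono) auto
    ultimately have "s * lam - (i - 1) * ln (1 + s) \<le> - (s * D) / 2 + s\<^sup>2 * M" by (simp add: algebra_simps)
    also have "\<dots> \<le> - (D\<^sup>2 / M) / 32"
    proof -
      define v where "v = D\<^sup>2 / M"
      have "v \<ge> 0" using assms by (simp add: v_def)
      thus ?thesis unfolding sD s2 v_def[symmetric] by linarith
    qed
    finally show ?thesis .
  qed
  show "- s * lam - (i - 1) * ln (1 - s) \<le> - (D\<^sup>2 / M) / 32" if "lam \<ge> i + D / 2"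
  proof -
    have "(i - 1) * (- s - 2 * s\<^sup>2) \<le> (i - 1) * ln (1 - s)"
      using s assms by (intro mult_left_mono ln_one_minus_pos_lower_bound) auto
    moreover have "s * (i + D / 2) \<le> s * lam" using that s by (intro mult_left_mono) auto
    moreover have "(i - 1) * s\<^sup>2 \<le> M * s\<^sup>2" using assms by (intro mult_right_mono) auto
    ultimately have "- s * lam - (i - 1) * ln (1 - s) \<le> - s - (s * D) / 2 + 2 * (s\<^sup>2 * M)" by (simp add: algebra_simps)
    also have "\<dots> \<le> - (D\<^sup>2 / M) / 32"
    proof -
      define v where "v = D\<^sup>2 / M"
      have "v \<ge> 0" using assms by (simp add: v_def)
      thus ?thesis unfolding sD s2 v_def[symmetric] using s by linarith
    qed
    finally show ?thesis .
  qed
qed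

lemma lnln_le_iff: 
  assumes "p \<ge> (2::nat)" shows "ln (ln (real p)) / 2 \<le> c \<longleftrightarrow> real p \<le> exp (exp (2 * c))"
proof -
  have "ln (real p) > 0" using assms by simp
  have "ln (ln (real p)) / 2 \<le> c \<longleftrightarrow> ln (ln (real p)) \<le> 2 * c" by auto
  also have "\<dots> \<longleftrightarrow> ln (real p) \<le> exp (2 * c)" using \<open>ln (real p) > 0\<close> by (metis exp_le_cancel_iff exp_ln)
  also have "\<dots> \<longleftrightarrow> real p \<le> exp (exp (2 * c))" using assms by (metis exp_le_cancel_iff exp_ln of_nat_0_less_iff zero_less_numeral less_le_trans)
  finally show ?thesis .
qed

text \<open>The threshold on \<open>ln (ln p)\<close> becomes
  \<open>p \<le> exp (exp (2 * c))\<close>, where Mertens applies once this is at least 2. The lower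
  bound concerns the strict inequality: at most one prime sits on the threshold, and losing it costs
  at most 1.\<close>

lemma sum_below_bounds:
  "\<exists>C\<ge>1. \<forall>c x. (ln (ln 2) / 2 \<le> c \<longrightarrow> (\<Sum>p | p \<in> GP \<and> real p \<le> x \<and> ln (ln (real p)) / 2 \<le> c. 1 / real p) \<le> c + C) \<and>
     (ln (ln 2) / 2 \<le> c \<and> x \<ge> 2 \<and> c \<le> mu x \<longrightarrow> c - C \<le> (\<Sum>p | p \<in> GP \<and> real p \<le> x \<and> ln (ln (real p)) / 2 < c. 1 / real p))"
proof -
  obtain C where C: "C > 0" "\<And>x. x \<ge> 2 \<Longrightarrow> \<bar>Lam x - ln (ln x) / 2\<bar> \<le> C" using Lam_bounds by blast
  have t2: "exp (exp (2 * c)) \<ge> (2::real)" if "ln (ln 2) / 2 \<le> c" for c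
    using lnln_le_iff[of 2 c] that by simp
  show ?thesis
  proof (intro exI[of _ "C + 1"] conjI allI impI)
    fix c x :: real assume c: "ln (ln 2) / 2 \<le> c"
    have "(\<Sum>p | p \<in> GP \<and> real p \<le> x \<and> ln (ln (real p)) / 2 \<le> c. 1 / real p) \<le> Lam (exp (exp (2 * c)))"
      unfolding Lam_def using lnln_le_iff[OF GP_ge2] by (intro sum_mono2) auto
    thus "(\<Sum>p | p \<in> GP \<and> real p \<le> x \<and> ln (ln (real p)) / 2 \<le> c. 1 / real p) \<le> c + (C + 1)"
      using C(2)[OF t2[OF c]] by simp
  next
    fix c x :: real assume c: "ln (ln 2) / 2 \<le> c \<and> x \<ge> 2 \<and> c \<le> mu x"
    define t where "t = exp (exp (2 * c))"
    define Z where "Z = {p. p \<in> GP \<and> real p \<le> x \<and> ln (ln (real p)) / 2 < c}"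
    have finZ: "finite Z" unfolding Z_def by (rule finite_subset[OF _ finite_GP_le[of x]]) auto
    have "ln x > 0" using c by auto
    hence "exp (exp (2 * mu x)) = x" using c by (simp add: mu_def)
    moreover have "t \<le> exp (exp (2 * mu x))" using c by (simp add: t_def)
    ultimately have tx: "t \<le> x" by simp
    have "{p. p \<in> GP \<and> real p \<le> t} \<subseteq> Z \<union> {nat \<lfloor>t\<rfloor>}"
    proof
      fix p assume p: "p \<in> {p. p \<in> GP \<and> real p \<le> t}"
      hence p2: "p \<ge> 2" using GP_ge2 by auto
      show "p \<in> Z \<union> {nat \<lfloor>t\<rfloor>}"
      proof (cases "ln (ln (real p)) / 2 < c")
        case False
        have "ln (real p) > 0" using p2 by simp
        have "exp (exp (2 * c)) \<le> exp (exp (ln (ln (real p))))" using False by simp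
        hence "t \<le> real p" using \<open>ln (real p) > 0\<close> p2 by (simp add: t_def)
        hence "t = real p" using p by auto
        thus ?thesis by simp
      qed (use p tx in \<open>auto simp: Z_def\<close>)
    qed
    hence "Lam t \<le> (\<Sum>p\<in>Z \<union> {nat \<lfloor>t\<rfloor>}. 1 / real p)" unfolding Lam_def using finZ by (intro sum_mono2) auto
    also have "\<dots> \<le> (\<Sum>p\<in>Z. 1 / real p) + (\<Sum>p\<in>{nat \<lfloor>t\<rfloor>}. 1 / real p)"
      using finZ by (cases "nat \<lfloor>t\<rfloor> \<in> Z") (auto simp: insert_absorb)
    also have "(\<Sum>p\<in>{nat \<lfloor>t\<rfloor>}. 1 / real p) \<le> 1" by (cases "nat \<lfloor>t\<rfloor>") (auto simp del: nat_eq_iff)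
    finally have "Lam t - 1 \<le> (\<Sum>p\<in>Z. 1 / real p)" by simp
    thus "c - (C + 1) \<le> (\<Sum>p | p \<in> GP \<and> real p \<le> x \<and> ln (ln (real p)) / 2 < c. 1 / real p)"
      using C(2)[OF t2, of c] c unfolding Z_def[symmetric] t_def by simp
  qed (use C in auto)
qed

text \<open>If the \<open>i\<close>-th prime factor is too small, at least \<open>i\<close> of them
  lie at height at most \<open>i - D i\<close>; if it is too large, at most \<open>i - 1\<close> lie
  below \<open>i + D i\<close>. Both are large deviations of a prime count and survive, up to one,
  the removal of any prime factor.\<close>

lemma not_regular_card_le:
  "\<exists>K \<eta>0. K > 0 \<and> \<eta>0 > 0 \<and> eventually (\<lambda>x. \<forall>k \<eta>. in_range (Suc k) x \<and> \<eta>0 \<le> \<eta> \<and> 1 \<le> \<eta> \<longrightarrow> 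
     real (card {n \<in> S_r (Suc k) x. \<not> regularly_spaced \<eta> n}) \<le> sqrt x + K * (x / ln x) * main_term k x * exp (- \<eta> / 64)) at_top"
proof -
  obtain C where C: "C > 0" and "eventually (\<lambda>x. regime C x) at_top"
    using in_range_facts by blast
  note ev = this(2)[unfolded regime_def]
  obtain C1 where C1: "C1 \<ge> 1" 
    "\<And>c x. ln (ln 2) / 2 \<le> c \<Longrightarrow> (\<Sum>p | p \<in> GP \<and> real p \<le> x \<and> ln (ln (real p)) / 2 \<le> c. 1 / real p) \<le> c + C1"
    "\<And>c x. ln (ln 2) / 2 \<le> c \<Longrightarrow> x \<ge> 2 \<Longrightarrow> c \<le> mu x \<Longrightarrow> c - C1 \<le> (\<Sum>p | p \<in> GP \<and> real p \<le> x \<and> ln (ln (real p)) / 2 < c. 1 / real p)"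
    using sum_below_bounds by blast
  \<comment> \<open>This makes \<open>D i / 4\<close> at least \<open>2 * C1 + 1\<close>, which
    absorbs the Mertens error \<open>C1\<close>, its tilt \<open>\<delta> * C1\<close> and the one
    removed prime.\<close>
  define \<eta>0 where "\<eta>0 = 8 * C1 + 4"
  have summ: "summable (\<lambda>i::nat. exp (- (real i powr (3/5)) / 64))"
  proof (rule summable_comparison_test_bigo)
    show "summable (\<lambda>i::nat. norm (1 / real i ^ 2))" using summable_real_powr_iff[of "-2"] by (simp add: powr_minus divide_inverse)
    show "(\<lambda>i::nat. exp (- (real i powr (3/5)) / 64)) \<in> O(\<lambda>i. 1 / real i ^ 2)" by real_asymp
  qed
  define Kc where "Kc = (\<Sum>i::nat. exp (- (real i powr (3/5)) / 64))"
  have Kc: "(\<Sum>i\<in>I. exp (- (real i powr (3/5)) / 64)) \<le> Kc" if "finite I" for I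
    unfolding Kc_def using summ that by (intro sum_le_suminf) auto
  have Kc0: "Kc > 0" unfolding Kc_def using summ by (intro suminf_pos) auto
  have ev1: "eventually (\<lambda>m::real. C * m powr (-1/3) \<le> 1/8 \<and> (2 * m) powr (1/5) * (C * m powr (-1/3)) \<le> 1/4) at_top"
    using C by (intro eventually_conj; real_asymp)
  show ?thesis
  proof (rule exI[of _ "64 * Kc"], rule exI[of _ \<eta>0], intro conjI)
    show "eventually (\<lambda>x. \<forall>k \<eta>. in_range (Suc k) x \<and> \<eta>0 \<le> \<eta> \<and> 1 \<le> \<eta> \<longrightarrow> 
     real (card {n \<in> S_r (Suc k) x. \<not> regularly_spaced \<eta> n}) \<le> sqrt x + 64 * Kc * (x / ln x) * main_term k x * exp (- \<eta> / 64)) at_top"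
      using ev eventually_mu[OF ev1]
    proof eventually_elim
      case (elim x)
      show ?case
      proof (intro allI impI)
        fix k \<eta> assume a: "in_range (Suc k) x \<and> \<eta>0 \<le> \<eta> \<and> 1 \<le> \<eta>"
        define m L \<delta> where "m = mu x" and "L = Lam x" and "\<delta> = C * mu x powr (-1/3)"
        have x: "x > 1" "x \<ge> 2" "ln x > 0" using elim by auto
        have m: "m \<ge> 1" "L > 0" using elim by (auto simp: m_def L_def)
        have kk: "k \<ge> 2" "\<bar>real k / L - 1\<bar> \<le> \<delta>" "real (Suc k) \<le> 2 * m"
          using elim a by (force simp: m_def L_def \<delta>_def)+
        have \<delta>: "0 \<le> \<delta>" "\<delta> \<le> 1/8" "(2 * m) powr (1/5) * \<delta> \<le> 1/4" using elim C by (auto simp: m_def \<delta>_def)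
        have eta: "\<eta> \<ge> 8 * C1 + 4" "\<eta> \<ge> 1" using a by (auto simp: \<eta>0_def)
        define M D where "M = (\<lambda>i::nat. max (real i) \<eta>)" and "D = (\<lambda>i::nat. \<eta> powr (1/5) * M i powr (4/5))"
        define s where "s = (\<lambda>i. D i / (8 * M i))"
        define Z1 where "Z1 = (\<lambda>i. {p. p \<in> GP \<and> real p \<le> x \<and> ln (ln (real p)) / 2 \<le> real i - D i})"
        define Z2 where "Z2 = (\<lambda>i. {p. p \<in> GP \<and> real p \<le> x \<and> ln (ln (real p)) / 2 < real i + D i})"
        \<comment> \<open>\<open>Q1\<close> asks for \<open>i - 1\<close> primes since the cofactor
          may have lost one of the \<open>i\<close>; for \<open>Q2\<close> a removal only helps. The
          lower bound on \<open>i - D i\<close> puts the height at or above that of the prime 2, as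
          \<open>sum_below_bounds\<close> requires.\<close>
        define Q1 where "Q1 = (\<lambda>i n. ln (ln 2) / 2 \<le> real i - D i \<and> i - 1 \<le> card (prime_factors n \<inter> Z1 i))"
        define Q2 where "Q2 = (\<lambda>i n. real i + D i \<le> m \<and> card (prime_factors n \<inter> Z2 i) \<le> i - 1)"
        define I where "I = {1..k}"
        define Q where "Q = (\<lambda>n. \<exists>i\<in>I. Q1 i n \<or> Q2 i n)"
        have dev: "\<eta> \<le> D i" "D i \<le> M i" "real i powr (4/5) \<le> D i" "(\<eta> + real i powr (3/5)) / 2 \<le> (D i)\<^sup>2 / M i" "M i > 0"
          "\<delta> * real i \<le> D i / 4" if "i \<in> I" for i
        proof -
          have i: "real i \<ge> 1" "real i \<le> 2 * m" using that kk by (auto simp: I_def)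
          note df = deviation_facts[OF eta(2) i(1) refl refl, folded M_def, folded D_def]
          have "max (real i) \<eta> = M i" by (simp add: M_def)
          note df = df[unfolded this, folded D_def]
          show "\<eta> \<le> D i" "D i \<le> M i" "real i powr (4/5) \<le> D i" "(\<eta> + real i powr (3/5)) / 2 \<le> (D i)\<^sup>2 / M i" "M i > 0"
            using df by (simp_all add: D_def)
          \<comment> \<open>The tilt \<open>k / L\<close> shifts the expected count by up to
            \<open>\<delta> * i\<close>. This is absorbed because
            \<open>D i \<ge> i powr (4/5)\<close> and \<open>i powr (1/5) * \<delta>\<close> is at
            most 1/4 for \<open>i \<le> 2 * m\<close>.\<close>
          have "\<delta> * real i = real i powr (4/5) * (real i powr (1/5) * \<delta>)"
            using i by (simp add: mult.assoc[symmetric] powr_add[symmetric])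
          also have "\<dots> \<le> D i * ((2 * m) powr (1/5) * \<delta>)"
            using i \<delta> \<open>real i powr (4/5) \<le> D i\<close> by (intro mult_mono powr_mono2) (auto intro: order_trans[OF powr_ge_zero])
          also have "\<dots> \<le> D i * (1/4)" using \<delta> \<open>\<eta> \<le> D i\<close> eta by (intro mult_left_mono) auto
          finally show "\<delta> * real i \<le> D i / 4" by simp
        qed
        have aux: "e \<le> - (a / 64)" if "e \<le> - v / 32" "a / 2 \<le> v" for e a v :: real using that by simp
        have b1: "(\<Sum>n | n \<in> S_r k x \<and> Q1 i n. 1 / real n) \<le> main_term k x * exp (- ((\<eta> + real i powr (3/5)) / 64))" if i: "i \<in> I" for i
        proof (cases "ln (ln 2) / 2 \<le> real i - D i")
          case True
          have i1: "1 \<le> real i" "real i \<le> M i" using i by (auto simp: I_def M_def)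
          have s0: "0 \<le> s i" using dev[OF i] eta by (simp add: s_def)
          have "(\<Sum>n | n \<in> S_r k x \<and> Q1 i n. 1 / real n) \<le> main_term k x * exp (((1 + s i) - 1) * ((\<Sum>p\<in>Z1 i. 1 / real p) * (real k / Lam x)) - real (i - 1) * ln (1 + s i))"
            using m s0 by (intro chernoff_S_r) (auto simp: Z1_def Q1_def L_def intro!: power_increasing)
          also have "\<dots> \<le> main_term k x * exp (- ((\<eta> + real i powr (3/5)) / 64))"
          proof (intro mult_left_mono)
            define lam where "lam = (\<Sum>p\<in>Z1 i. 1 / real p) * (real k / L)"
            have "(\<Sum>p\<in>Z1 i. 1 / real p) \<le> real i - D i + C1" unfolding Z1_def by (rule C1(2)[OF True])
            hence "lam \<le> (real i - D i + C1) * (1 + \<delta>)"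
              unfolding lam_def
            proof (rule mult_mono)
              have "0 \<le> (\<Sum>p\<in>Z1 i. 1 / real p)" by (intro sum_nonneg) auto
              thus "0 \<le> real i - D i + C1" using \<open>(\<Sum>p\<in>Z1 i. 1 / real p) \<le> real i - D i + C1\<close> by linarith
            qed (use kk m \<open>(\<Sum>p\<in>Z1 i. 1 / real p) \<le> real i - D i + C1\<close> in \<open>auto simp: abs_le_iff\<close>)
            also have "\<dots> = real i - D i + C1 + \<delta> * real i - \<delta> * D i + \<delta> * C1" by (simp add: algebra_simps)
            also have "\<dots> \<le> real i - 1 - D i / 2"
            proof -
              have "\<delta> * C1 \<le> 1 * C1" using \<delta> C1 by (intro mult_right_mono) auto
              moreover have "\<delta> * D i \<ge> 0" using \<delta> dev[OF i] eta by auto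
              ultimately show ?thesis using dev(1,6)[OF i] eta by linarith
            qed
            finally have "s i * lam - (real i - 1) * ln (1 + s i) \<le> - ((D i)\<^sup>2 / M i) / 32"
              using chernoff_exponents(1)[of "M i" "D i" "real i" "s i" lam] dev[OF i] i1 eta by (simp add: s_def)
            moreover have "real (i - 1) = real i - 1" using i by (auto simp: I_def)
            ultimately show "exp (((1 + s i) - 1) * ((\<Sum>p\<in>Z1 i. 1 / real p) * (real k / Lam x)) - real (i - 1) * ln (1 + s i)) \<le> exp (- ((\<eta> + real i powr (3/5)) / 64))"
              using aux[OF _ dev(4)[OF i]] by (simp add: lam_def L_def)
          qed (use m in \<open>auto simp: main_term_def L_def\<close>)
          finally show ?thesis .
        next
          case False
          hence "{n. n \<in> S_r k x \<and> Q1 i n} = {}" by (auto simp: Q1_def)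
          hence "(\<Sum>n | n \<in> S_r k x \<and> Q1 i n. 1 / real n) = 0" by (simp only: sum.empty)
          thus ?thesis using m by (auto simp: main_term_def L_def)
        qed
        have b2: "(\<Sum>n | n \<in> S_r k x \<and> Q2 i n. 1 / real n) \<le> main_term k x * exp (- ((\<eta> + real i powr (3/5)) / 64))" if i: "i \<in> I" for i
        proof (cases "real i + D i \<le> m")
          case True
          have i1: "1 \<le> real i" "real i \<le> M i" using i by (auto simp: I_def M_def)
          have s0: "0 \<le> s i" "s i \<le> 1/8" using dev[OF i] eta by (auto simp: s_def field_simps)
          have "(\<Sum>n | n \<in> S_r k x \<and> Q2 i n. 1 / real n) \<le> main_term k x * exp (((1 - s i) - 1) * ((\<Sum>p\<in>Z2 i. 1 / real p) * (real k / Lam x)) - real (i - 1) * ln (1 - s i))"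
            using m s0 by (intro chernoff_S_r) (auto simp: Z2_def Q2_def L_def intro!: power_decreasing)
          also have "\<dots> \<le> main_term k x * exp (- ((\<eta> + real i powr (3/5)) / 64))"
          proof (intro mult_left_mono)
            define lam where "lam = (\<Sum>p\<in>Z2 i. 1 / real p) * (real k / L)"
            have "ln (ln (2::real)) \<le> 0" using ln_2_less_1 by (simp add: ln_le_zero_iff)
            hence "ln (ln 2) / 2 \<le> real i + D i" using dev[OF i] i1 eta by linarith
            hence 1: "real i + D i - C1 \<le> (\<Sum>p\<in>Z2 i. 1 / real p)" unfolding Z2_def using True x by (intro C1(3)) (auto simp: m_def)
            have pos: "0 \<le> real i + D i - C1" using dev[OF i] eta i1 C1 by linarith
            have "real i + D i / 2 \<le> real i + D i - C1 - \<delta> * real i - \<delta> * D i + \<delta> * C1"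
            proof -
              have "\<delta> * C1 \<ge> 0" using \<delta> C1 by auto
              moreover have "\<delta> * D i \<le> 1/8 * D i" using \<delta> dev[OF i] eta by (intro mult_right_mono) auto
              ultimately show ?thesis using dev(1,6)[OF i] eta C1(1) by linarith
            qed
            also have "\<dots> = (real i + D i - C1) * (1 - \<delta>)" by (simp add: algebra_simps)
            also have "\<dots> \<le> lam" unfolding lam_def using kk m 1 pos \<delta> by (intro mult_mono) (auto intro!: sum_nonneg)
            finally have "- s i * lam - (real i - 1) * ln (1 - s i) \<le> - ((D i)\<^sup>2 / M i) / 32"
              using chernoff_exponents(2)[of "M i" "D i" "real i" "s i" lam] dev[OF i] i1 eta by (simp add: s_def)
            moreover have "real (i - 1) = real i - 1" using i by (auto simp: I_def)
            ultimately show "exp (((1 - s i) - 1) * ((\<Sum>p\<in>Z2 i. 1 / real p) * (real k / Lam x)) - real (i - 1) * ln (1 - s i)) \<le> exp (- ((\<eta> + real i powr (3/5)) / 64))"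
              using aux[OF _ dev(4)[OF i]] by (simp add: lam_def L_def)
          qed (use m in \<open>auto simp: main_term_def L_def\<close>)
          finally show ?thesis .
        next
          case False
          hence "{n. n \<in> S_r k x \<and> Q2 i n} = {}" by (auto simp: Q2_def)
          hence "(\<Sum>n | n \<in> S_r k x \<and> Q2 i n. 1 / real n) = 0" by (simp only: sum.empty)
          thus ?thesis using m by (auto simp: main_term_def L_def)
        qed
        have "real (card {n \<in> S_r (Suc k) x. \<not> regularly_spaced \<eta> n}) \<le> sqrt x + 32 * (x / ln x) * (\<Sum>n | n \<in> S_r k x \<and> Q n. 1 / real n)"
        proof (rule card_le_cofactor_sum[OF x(1)])
          fix n assume n: "n \<in> {n \<in> S_r (Suc k) x. \<not> regularly_spaced \<eta> n}" "sqrt x \<le> real n"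
          hence nS: "n \<in> S_r (Suc k) x" by simp
          have om: "omega n = Suc k" using nS by (simp add: S_r_def)
          obtain i where i: "i \<ge> 1" "real i < real (omega n) / 3" "\<not> \<bar>ln (ln (real (pfac n i))) / 2 - real i\<bar> < D i"
            using n by (auto simp: regularly_spaced_def D_def M_def)
          have iI: "i \<in> I" using i om kk by (auto simp: I_def)
          have io: "i \<le> omega n" using iI om by (auto simp: I_def)
          note pm = pfac_mem[OF i(1) io]
          note pS = prime_factors_le_S_r[OF nS pm]
          have p2: "pfac n i \<ge> 2" using pS GP_ge2 by auto
          have lp: "ln (real (pfac n i)) > 0" using p2 by simp
          have QQ: "Q (n div l)" if l: "l \<in> prime_factors n" for l
          proof -
            have pf: "prime_factors (n div l) = prime_factors n - {l}" by (rule div_prime_S_r(2)[OF nS l])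
            consider "ln (ln (real (pfac n i))) / 2 \<le> real i - D i" | "real i + D i \<le> ln (ln (real (pfac n i))) / 2"
              using i(3) by linarith
            thus ?thesis
            proof cases
              case 1
              have "ln (ln (real 2)) \<le> ln (ln (real (pfac n i)))" using p2 by (subst ln_le_cancel_iff) auto
              hence c: "ln (ln 2) / 2 \<le> real i - D i" using 1 by simp
              have sub: "insert (pfac n i) {p \<in> prime_factors n. p < pfac n i} \<subseteq> prime_factors n \<inter> Z1 i"
              proof
                fix p assume p: "p \<in> insert (pfac n i) {p \<in> prime_factors n. p < pfac n i}"
                hence pn: "p \<in> prime_factors n" "p \<le> pfac n i" using pm by auto
                note pS' = prime_factors_le_S_r[OF nS pn(1)]
                have "p \<ge> 2" using pS' GP_ge2 by auto
                hence "ln (ln (real p)) \<le> ln (ln (real (pfac n i)))" using pn p2 lp by simp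
                thus "p \<in> prime_factors n \<inter> Z1 i" using pS' pn 1 by (auto simp: Z1_def)
              qed
              have "i = card (insert (pfac n i) {p \<in> prime_factors n. p < pfac n i})"
                using card_less_pfac[OF i(1) io] i(1) by (subst card_insert_disjoint) auto
              also have "\<dots> \<le> card (prime_factors n \<inter> Z1 i)" using sub by (intro card_mono) auto
              also have "\<dots> \<le> Suc (card ((prime_factors n - {l}) \<inter> Z1 i))"
              proof -
                have "prime_factors n \<inter> Z1 i \<subseteq> insert l ((prime_factors n - {l}) \<inter> Z1 i)" by auto
                hence "card (prime_factors n \<inter> Z1 i) \<le> card (insert l ((prime_factors n - {l}) \<inter> Z1 i))" by (intro card_mono) auto
                also have "\<dots> \<le> Suc (card ((prime_factors n - {l}) \<inter> Z1 i))" by (rule card_insert_le_m1[of "Suc _", simplified]) simp_all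
                finally show ?thesis .
              qed
              finally have "Q1 i (n div l)" using c by (simp add: Q1_def pf)
              thus ?thesis using iI by (auto simp: Q_def)
            next
              case 2
              have "ln (ln (real (pfac n i))) \<le> ln (ln x)" using pS p2 lp x by (subst ln_le_cancel_iff) auto
              hence c: "real i + D i \<le> m" using 2 by (simp add: m_def mu_def)
              have "prime_factors n \<inter> Z2 i \<subseteq> {p \<in> prime_factors n. p < pfac n i}"
              proof
                fix p assume p: "p \<in> prime_factors n \<inter> Z2 i"
                hence "ln (ln (real p)) < ln (ln (real (pfac n i)))" using 2 by (auto simp: Z2_def)
                moreover have "ln (real p) > 0" using p GP_ge2[of p] by (auto simp: Z2_def)
                ultimately have "real p < real (pfac n i)" using lp p2 p
                  by (metis IntE in_prime_factors_iff ln_less_cancel_iff of_nat_0_less_iff pm prime_gt_0_nat)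
                thus "p \<in> {p \<in> prime_factors n. p < pfac n i}" using p by auto
              qed
              hence "card (prime_factors n \<inter> Z2 i) \<le> i - 1"
                unfolding card_less_pfac[OF i(1) io, symmetric] by (intro card_mono) auto
              moreover have "card ((prime_factors n - {l}) \<inter> Z2 i) \<le> card (prime_factors n \<inter> Z2 i)" by (intro card_mono) auto
              ultimately have "Q2 i (n div l)" using c by (simp add: Q2_def pf)
              thus ?thesis using iI by (auto simp: Q_def)
            qed
          qed
          have "ln (sqrt x) \<le> ln (real n)" using n x S_r_prod(4)[OF nS] by (subst ln_le_cancel_iff) auto
          moreover have "ln (sqrt x) = ln x / 2" using x by (simp add: ln_sqrt)
          ultimately have "ln x / 8 \<le> ln (real n)" using x(3) by linarith
          also have "\<dots> = (\<Sum>l\<in>prime_factors n. ln (real l))" by (rule ln_S_r[OF nS])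
          also have "\<dots> = (\<Sum>l | l \<in> prime_factors n \<and> Q (n div l). ln (real l))"
            using QQ by (intro sum.cong) auto
          finally show "ln x / 8 \<le> (\<Sum>l | l \<in> prime_factors n \<and> Q (n div l). ln (real l))" .
        qed auto
        moreover have "(\<Sum>n | n \<in> S_r k x \<and> Q n. 1 / real n) \<le> 2 * Kc * main_term k x * exp (- \<eta> / 64)"
        proof -
          have "(\<Sum>n | n \<in> S_r k x \<and> Q n. 1 / real n) \<le> (\<Sum>(i,n)\<in>(SIGMA i:I. {n. n \<in> S_r k x \<and> (Q1 i n \<or> Q2 i n)}). 1 / real n)"
            by (rule sum_le_included[where i = snd]) (auto simp: Q_def I_def intro!: bexI)
          also have "\<dots> = (\<Sum>i\<in>I. \<Sum>n | n \<in> S_r k x \<and> (Q1 i n \<or> Q2 i n). 1 / real n)"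
            by (subst sum.Sigma) (auto simp: I_def)
          also have "\<dots> \<le> (\<Sum>i\<in>I. 2 * main_term k x * exp (- \<eta> / 64) * exp (- (real i powr (3/5)) / 64))"
          proof (rule sum_mono)
            fix i assume i: "i \<in> I"
            have "{n. n \<in> S_r k x \<and> (Q1 i n \<or> Q2 i n)} = {n. n \<in> S_r k x \<and> Q1 i n} \<union> {n. n \<in> S_r k x \<and> Q2 i n}" by auto
            moreover have "sum f (A \<union> B) \<le> sum f A + sum f B" if "finite A" "finite B" "\<And>a. f a \<ge> 0" for f :: "nat \<Rightarrow> real" and A B
              using sum.union_inter[OF that(1,2), of f] sum_nonneg[of "A \<inter> B" f] that(3) by auto
            ultimately have "(\<Sum>n | n \<in> S_r k x \<and> (Q1 i n \<or> Q2 i n). 1 / real n) \<le> (\<Sum>n | n \<in> S_r k x \<and> Q1 i n. 1 / real n) + (\<Sum>n | n \<in> S_r k x \<and> Q2 i n. 1 / real n)"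
              by simp
            also have "\<dots> \<le> 2 * (main_term k x * exp (- ((\<eta> + real i powr (3/5)) / 64)))" using b1[OF i] b2[OF i] by simp
            also have "\<dots> = 2 * main_term k x * exp (- \<eta> / 64) * exp (- (real i powr (3/5)) / 64)"
              by (simp add: exp_add[symmetric] add_divide_distrib)
            finally show "(\<Sum>n | n \<in> S_r k x \<and> (Q1 i n \<or> Q2 i n). 1 / real n) \<le> 2 * main_term k x * exp (- \<eta> / 64) * exp (- (real i powr (3/5)) / 64)" .
          qed
          also have "\<dots> = 2 * main_term k x * exp (- \<eta> / 64) * (\<Sum>i\<in>I. exp (- (real i powr (3/5)) / 64))" by (simp add: sum_distrib_left)
          also have "\<dots> \<le> 2 * main_term k x * exp (- \<eta> / 64) * Kc"
            using m by (intro mult_left_mono Kc) (auto simp: I_def main_term_def L_def)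
          finally show ?thesis by (simp add: mult_ac)
        qed
        hence "32 * (x / ln x) * (\<Sum>n | n \<in> S_r k x \<and> Q n. 1 / real n) \<le> 32 * (x / ln x) * (2 * Kc * main_term k x * exp (- \<eta> / 64))"
          using x by (intro mult_left_mono) auto
        moreover have "32 * (x / ln x) * (2 * Kc * main_term k x * exp (- \<eta> / 64)) = 64 * Kc * (x / ln x) * main_term k x * exp (- \<eta> / 64)"
          by simp
        ultimately show "real (card {n \<in> S_r (Suc k) x. \<not> regularly_spaced \<eta> n}) \<le> sqrt x + 64 * Kc * (x / ln x) * main_term k x * exp (- \<eta> / 64)"
          by linarith
      qed
    qed
  qed (use Kc0 C1 in \<open>auto simp: \<eta>0_def\<close>)
qed

section \<open>Independent random sets of primes\<close>

text \<open>\<open>EB w P f\<close> is the expectation of \<open>f\<close> at a random subset of \<open>P\<close> that contains each \<open>p\<close>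
  independently with probability \<open>w p / (1 + w p)\<close>.\<close>

definition EB :: "('a \<Rightarrow> real) \<Rightarrow> 'a set \<Rightarrow> ('a set \<Rightarrow> real) \<Rightarrow> real" where
  "EB w P f = (\<Sum>a\<in>Pow P. prod w a * f a) / (\<Prod>p\<in>P. 1 + w p)"

definition PB :: "('a \<Rightarrow> real) \<Rightarrow> 'a set \<Rightarrow> ('a set \<Rightarrow> bool) \<Rightarrow> real" where
  "PB w P \<phi> = EB w P (\<lambda>a. of_bool (\<phi> a))"

lemma sum_Pow_prod:
  fixes w :: "'a \<Rightarrow> real"
  assumes "finite P" shows "(\<Sum>a\<in>Pow P. prod w a) = (\<Prod>p\<in>P. 1 + w p)"
  using assms
proof (induction P rule: finite_induct)
  case (insert x P)
  have "(\<Sum>a\<in>Pow (insert x P). prod w a) = (\<Sum>a\<in>Pow P. prod w a) + (\<Sum>a\<in>insert x ` Pow P. prod w a)"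
    unfolding Pow_insert using insert by (intro sum.union_disjoint) auto
  also have "(\<Sum>a\<in>insert x ` Pow P. prod w a) = (\<Sum>a\<in>Pow P. prod w (insert x a))"
  proof (rule sum.reindex[unfolded o_def], rule inj_onI)
    fix a b assume "a \<in> Pow P" "b \<in> Pow P" "insert x a = insert x b"
    thus "a = b" using insert insert_ident[of x a b] by auto
  qed
  also have "\<dots> = (\<Sum>a\<in>Pow P. w x * prod w a)"
  proof (rule sum.cong)
    fix a assume "a \<in> Pow P"
    hence "finite a" "x \<notin> a" using insert finite_subset by auto
    thus "prod w (insert x a) = w x * prod w a" by simp
  qed simp
  finally show ?case using insert by (simp add: sum_distrib_left[symmetric] algebra_simps)
qed simp

locale random_set =
  fixes w :: "'a \<Rightarrow> real" and P :: "'a set"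
  assumes fin: "finite P" and w_nonneg: "\<And>p. w p \<ge> 0"
begin

lemma prod_pos: "(\<Prod>p\<in>R. 1 + w p) > 0"
proof (rule prod_pos)
  fix p show "0 < 1 + w p" using w_nonneg[of p] by linarith
qed

lemma prod_w_nonneg: "prod w a \<ge> 0"
  by (intro prod_nonneg w_nonneg)

lemma EB_mono: 
  assumes "\<And>a. a \<subseteq> P \<Longrightarrow> f a \<le> g a" shows "EB w P f \<le> EB w P g"
  unfolding EB_def using assms prod_pos[of P]
  by (intro divide_right_mono sum_mono mult_left_mono prod_w_nonneg) auto

lemma EB_add: "EB w P (\<lambda>a. f a + g a) = EB w P f + EB w P g"
  by (simp add: EB_def distrib_left sum.distrib add_divide_distrib)

lemma EB_diff: "EB w P (\<lambda>a. f a - g a) = EB w P f - EB w P g"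
  by (simp add: EB_def right_diff_distrib sum_subtractf diff_divide_distrib)

lemma EB_cmult: "EB w P (\<lambda>a. c * f a) = c * EB w P f"
  by (simp add: EB_def sum_distrib_left mult.left_commute)

lemma EB_one: "EB w P (\<lambda>a. 1) = 1"
  using prod_pos[of P] by (simp add: EB_def sum_Pow_prod[OF fin])

text \<open>The weight \<open>prod w\<close> is multiplicative over the parts of \<open>a\<close>
  inside and outside \<open>R\<close>, so numerator and denominator both factor.\<close>

lemma EB_split:
  assumes "R \<subseteq> P"
  shows "EB w P (\<lambda>a. f (a \<inter> R) * g (a - R)) = EB w R f * EB w (P - R) g"
proof -
  have finR: "finite R" using assms fin finite_subset by auto
  have "(\<Sum>a\<in>Pow P. prod w a * (f (a \<inter> R) * g (a - R))) = (\<Sum>(b,c)\<in>Pow R \<times> Pow (P - R). (prod w b * f b) * (prod w c * g c))"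
  proof (rule sum.reindex_bij_witness[where i = "\<lambda>(b,c). b \<union> c" and j = "\<lambda>a. (a \<inter> R, a - R)"], goal_cases)
    case (5 a)
    have fa: "finite a" using 5 fin finite_subset by auto
    have "prod w a = prod w (a \<inter> R) * prod w (a - R)"
      using fa prod.union_disjoint[of "a \<inter> R" "a - R" w] by (simp add: Int_Diff_Un Int_Diff_disjoint)
    thus ?case by simp
  qed (use assms in auto)
  also have "\<dots> = (\<Sum>b\<in>Pow R. prod w b * f b) * (\<Sum>c\<in>Pow (P - R). prod w c * g c)"
    by (simp add: sum_product sum.cartesian_product)
  finally have 1: "(\<Sum>a\<in>Pow P. prod w a * (f (a \<inter> R) * g (a - R))) = (\<Sum>b\<in>Pow R. prod w b * f b) * (\<Sum>c\<in>Pow (P - R). prod w c * g c)" .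
  have "P = R \<union> (P - R)" using assms by auto
  hence 2: "(\<Prod>p\<in>P. 1 + w p) = (\<Prod>p\<in>R. 1 + w p) * (\<Prod>p\<in>P - R. 1 + w p)"
    using fin finR by (metis Diff_disjoint finite_Diff prod.union_disjoint)
  show ?thesis unfolding EB_def 1 2 by simp
qed

lemma EB_marginal:
  assumes "R \<subseteq> P" shows "EB w P (\<lambda>a. f (a \<inter> R)) = EB w R f"
proof -
  interpret Q: random_set w "P - R" by unfold_locales (use fin w_nonneg in auto)
  show ?thesis using EB_split[OF assms, of f "\<lambda>_. 1"] Q.EB_one by simp
qed

lemma EB_indep:
  assumes R: "R1 \<subseteq> P" "R2 \<subseteq> P" "R1 \<inter> R2 = {}"
  shows "EB w P (\<lambda>a. f (a \<inter> R1) * g (a \<inter> R2)) = EB w P (\<lambda>a. f (a \<inter> R1)) * EB w P (\<lambda>a. g (a \<inter> R2))"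
proof -
  have eq: "(a - R1) \<inter> R2 = a \<inter> R2" for a using R by auto
  interpret Q: random_set w R1 by unfold_locales (use fin R finite_subset w_nonneg in auto)
  have "EB w P (\<lambda>a. f (a \<inter> R1) * g ((a - R1) \<inter> R2)) = EB w R1 f * EB w (P - R1) (\<lambda>c. g (c \<inter> R2))"
    using EB_split[OF R(1), of f "\<lambda>c. g (c \<inter> R2)"] by simp
  moreover have "EB w P (\<lambda>a. 1 * g ((a - R1) \<inter> R2)) = 1 * EB w (P - R1) (\<lambda>c. g (c \<inter> R2))"
    using EB_split[OF R(1), of "\<lambda>_. 1" "\<lambda>c. g (c \<inter> R2)"] Q.EB_one by simp
  ultimately show ?thesis using EB_marginal[OF R(1), of f] by (simp add: eq)
qed

lemma EB_prod:
  assumes "R \<subseteq> P"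
  shows "EB w P (\<lambda>a. \<Prod>p\<in>a \<inter> R. c p) = (\<Prod>p\<in>R. (1 + w p * c p) / (1 + w p))"
proof -
  have finR: "finite R" using assms fin finite_subset by auto
  have "EB w P (\<lambda>a. \<Prod>p\<in>a \<inter> R. c p) = EB w R (\<lambda>a. prod c a)"
    by (rule EB_marginal[OF assms])
  also have "\<dots> = (\<Sum>a\<in>Pow R. prod (\<lambda>p. w p * c p) a) / (\<Prod>p\<in>R. 1 + w p)"
    by (simp add: EB_def prod.distrib)
  also have "\<dots> = (\<Prod>p\<in>R. (1 + w p * c p) / (1 + w p))"
    by (simp add: sum_Pow_prod[OF finR] prod_dividef)
  finally show ?thesis .
qed

lemma PB_mono: "(\<And>a. a \<subseteq> P \<Longrightarrow> \<phi> a \<Longrightarrow> \<psi> a) \<Longrightarrow> PB w P \<phi> \<le> PB w P \<psi>"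
  unfolding PB_def by (rule EB_mono) auto

lemma PB_disj_le: "PB w P (\<lambda>a. \<phi> a \<or> \<psi> a) \<le> PB w P \<phi> + PB w P \<psi>"
  unfolding PB_def EB_add[symmetric] by (rule EB_mono) auto

lemma PB_nonneg: "PB w P \<phi> \<ge> 0"
  unfolding PB_def EB_def using prod_pos[of P]
  by (intro divide_nonneg_nonneg sum_nonneg mult_nonneg_nonneg prod_w_nonneg) auto

lemma PB_indep:
  assumes "R1 \<subseteq> P" "R2 \<subseteq> P" "R1 \<inter> R2 = {}" "\<And>a. \<phi> a = \<phi> (a \<inter> R1)" "\<And>a. \<psi> a = \<psi> (a \<inter> R2)"
  shows "PB w P (\<lambda>a. \<phi> a \<and> \<psi> a) = PB w P \<phi> * PB w P \<psi>"
proof -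
  have "PB w P (\<lambda>a. \<phi> a \<and> \<psi> a) = EB w P (\<lambda>a. of_bool (\<phi> (a \<inter> R1)) * of_bool (\<psi> (a \<inter> R2)))"
    unfolding PB_def using assms(4,5) by (simp add: of_bool_conj)
  also have "\<dots> = EB w P (\<lambda>a. of_bool (\<phi> (a \<inter> R1))) * EB w P (\<lambda>a. of_bool (\<psi> (a \<inter> R2)))"
    using EB_indep[OF assms(1-3), of "\<lambda>a. of_bool (\<phi> a)" "\<lambda>a. of_bool (\<psi> a)"] by simp
  finally show ?thesis unfolding PB_def using assms(4,5) by simp
qed

lemma PB_not: "PB w P (\<lambda>a. \<not> \<phi> a) = 1 - PB w P \<phi>"
proof -
  have "(\<lambda>a. of_bool (\<not> \<phi> a)) = (\<lambda>a. 1 - of_bool (\<phi> a) :: real)" by auto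
  thus ?thesis unfolding PB_def by (simp only: EB_diff EB_one)
qed

lemma PB_empty:
  assumes "R \<subseteq> P"
  shows "PB w P (\<lambda>a. a \<inter> R = {}) = 1 / (\<Prod>p\<in>R. 1 + w p)"
proof -
  have finR: "finite R" using assms fin finite_subset by auto
  have "PB w P (\<lambda>a. a \<inter> R = {}) = EB w R (\<lambda>a. of_bool (a = {}))"
    unfolding PB_def using EB_marginal[OF assms, of "\<lambda>b. of_bool (b = {})"] by simp
  also have "\<dots> = 1 / (\<Prod>p\<in>R. 1 + w p)"
  proof -
    have "(\<Sum>a\<in>Pow R. prod w a * of_bool (a = {})) = (\<Sum>a\<in>{{}}. prod w a * of_bool (a = {}))"
      using finR by (intro sum.mono_neutral_right) auto
    thus ?thesis by (simp add: EB_def)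
  qed
  finally show ?thesis .
qed

lemma prod_le_exp: "(\<Prod>p\<in>R. 1 + w p) \<le> exp (sum w R)"
proof (cases "finite R")
  case True
  have "(\<Prod>p\<in>R. 1 + w p) \<le> (\<Prod>p\<in>R. exp (w p))"
  proof (rule prod_mono)
    fix p show "0 \<le> 1 + w p \<and> 1 + w p \<le> exp (w p)" using w_nonneg[of p] exp_ge_add_one_self[of "w p"] by auto
  qed
  thus ?thesis using True by (simp add: exp_sum)
qed simp

lemma PB_empty_ge: "R \<subseteq> P \<Longrightarrow> exp (- sum w R) \<le> PB w P (\<lambda>a. a \<inter> R = {})"
  using PB_empty[of R] le_imp_inverse_le[OF prod_le_exp[of R] prod_pos[of R]] by (simp add: exp_minus divide_inverse)

text \<open>The normalising product is at least \<open>1 + sum w R \<ge> 5/4\<close>, so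
  \<open>R\<close> is missed with probability at most 4/5.\<close>

lemma PB_nonempty_ge:
  assumes "R \<subseteq> P" "sum w R \<ge> 1/4"
  shows "1/5 \<le> PB w P (\<lambda>a. a \<inter> R \<noteq> {})"
proof -
  have finR: "finite R" using assms fin finite_subset by auto
  have "1 + sum w R \<le> (\<Prod>p\<in>R. 1 + w p)" using finR
  proof (induction R rule: finite_induct)
    case (insert p R)
    have "1 + sum w (insert p R) \<le> (1 + w p) * (1 + sum w R)"
      using insert w_nonneg sum_nonneg[of R w] by (simp add: algebra_simps)
    also have "\<dots> \<le> (1 + w p) * (\<Prod>p\<in>R. 1 + w p)" using insert w_nonneg[of p] by (intro mult_left_mono) auto
    finally show ?case using insert by simp
  qed simp
  hence "5/4 \<le> (\<Prod>p\<in>R. 1 + w p)" using assms by linarith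
  hence "1 / (\<Prod>p\<in>R. 1 + w p) \<le> 1 / (5/4)" by (intro divide_left_mono) auto
  thus ?thesis using PB_not[of "\<lambda>a. a \<inter> R = {}"] PB_empty[OF assms(1)] by simp
qed

text \<open>Markov's inequality for \<open>(1/2) ^ card\<close>: each factor is
  \<open>(1 + w/2) / (1 + w) \<le> 1 - w/4\<close>, and this is where \<open>w p \<le> 1\<close>
  enters.\<close>

lemma PB_card_le:
  assumes "R \<subseteq> P" "\<And>p. p \<in> R \<Longrightarrow> w p \<le> 1"
  shows "PB w P (\<lambda>a. real (card (a \<inter> R)) \<le> c) \<le> 2 powr c * exp (- sum w R / 4)"
proof -
  have finR: "finite R" using assms fin finite_subset by auto
  have "PB w P (\<lambda>a. real (card (a \<inter> R)) \<le> c) \<le> EB w P (\<lambda>a. 2 powr c * (\<Prod>p\<in>a \<inter> R. 1/2))"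
    unfolding PB_def
  proof (rule EB_mono)
    fix a assume "a \<subseteq> P"
    have "2 powr c * (\<Prod>p\<in>a \<inter> R. 1/2) = 2 powr c * (1/2) ^ card (a \<inter> R)" by simp
    also have "(1/2::real) ^ card (a \<inter> R) = 2 powr (- real (card (a \<inter> R)))" by (simp add: powr_minus powr_realpow power_one_over inverse_eq_divide)
    also have "2 powr c * \<dots> = 2 powr (c - real (card (a \<inter> R)))" by (simp add: powr_add[symmetric])
    finally show "of_bool (real (card (a \<inter> R)) \<le> c) \<le> 2 powr c * (\<Prod>p\<in>a \<inter> R. 1/2)"
      by (auto intro: ge_one_powr_ge_zero)
  qed
  also have "\<dots> = 2 powr c * (\<Prod>p\<in>R. (1 + w p * (1/2)) / (1 + w p))"
    unfolding EB_cmult EB_prod[OF assms(1)] ..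
  also have "(\<Prod>p\<in>R. (1 + w p * (1/2)) / (1 + w p)) \<le> (\<Prod>p\<in>R. exp (- w p / 4))"
  proof (rule prod_mono)
    fix p assume p: "p \<in> R"
    have w: "0 \<le> w p" "w p \<le> 1" using w_nonneg assms(2)[OF p] by auto
    have "w p * w p \<le> w p * 1" using w by (intro mult_left_mono) auto
    hence "(1 + w p * (1/2)) / (1 + w p) \<le> 1 + - w p / 4" using w by (simp add: field_simps)
    also have "\<dots> \<le> exp (- w p / 4)" by (rule exp_ge_add_one_self)
    finally show "0 \<le> (1 + w p * (1/2)) / (1 + w p) \<and> (1 + w p * (1/2)) / (1 + w p) \<le> exp (- w p / 4)"
      using w by simp
  qed
  also have "\<dots> = exp (- sum w R / 4)" using finR by (simp add: exp_sum[symmetric] sum_negf sum_divide_distrib[symmetric])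
  finally show ?thesis by (simp add: mult_left_mono)
qed

lemma PB_card_ge:
  assumes "R \<subseteq> P"
  shows "PB w P (\<lambda>a. real (card (a \<inter> R)) \<ge> c) \<le> 2 powr (- c) * exp (sum w R)"
proof -
  have finR: "finite R" using assms fin finite_subset by auto
  have "PB w P (\<lambda>a. real (card (a \<inter> R)) \<ge> c) \<le> EB w P (\<lambda>a. 2 powr (- c) * (\<Prod>p\<in>a \<inter> R. 2))"
    unfolding PB_def
  proof (rule EB_mono)
    fix a assume "a \<subseteq> P"
    have "2 powr (-c) * (\<Prod>p\<in>a \<inter> R. 2) = 2 powr (- c) * 2 powr real (card (a \<inter> R))" by (simp add: powr_realpow)
    also have "\<dots> = 2 powr (real (card (a \<inter> R)) - c)" by (simp add: powr_add[symmetric])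
    finally show "of_bool (real (card (a \<inter> R)) \<ge> c) \<le> 2 powr (- c) * (\<Prod>p\<in>a \<inter> R. 2)"
      by (auto intro: ge_one_powr_ge_zero)
  qed
  also have "\<dots> = 2 powr (- c) * (\<Prod>p\<in>R. (1 + w p * 2) / (1 + w p))"
    unfolding EB_cmult EB_prod[OF assms(1)] ..
  also have "(\<Prod>p\<in>R. (1 + w p * 2) / (1 + w p)) \<le> (\<Prod>p\<in>R. exp (w p))"
  proof (rule prod_mono)
    fix p assume p: "p \<in> R"
    have w: "0 \<le> w p" using w_nonneg by auto
    have "(1 + w p * 2) / (1 + w p) \<le> 1 + w p" using w by (simp add: field_simps)
    also have "\<dots> \<le> exp (w p)" by (rule exp_ge_add_one_self)
    finally show "0 \<le> (1 + w p * 2) / (1 + w p) \<and> (1 + w p * 2) / (1 + w p) \<le> exp (w p)"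
      using w by simp
  qed
  also have "\<dots> = exp (sum w R)" using finR by (simp add: exp_sum[symmetric])
  finally show ?thesis by (simp add: mult_left_mono)
qed

text \<open>Exponential Markov inequality; \<open>exp s \<le> 1 + 2 * s\<close> on the unit interval
  bounds the factor of \<open>p\<close> by \<open>exp (2 * w p * s p)\<close>.\<close>

lemma PB_sum_gt:
  assumes "R \<subseteq> P" "\<And>p. p \<in> R \<Longrightarrow> 0 \<le> s p \<and> s p \<le> 1"
  shows "PB w P (\<lambda>a. sum s (a \<inter> R) > c) \<le> exp (- c) * exp (2 * (\<Sum>p\<in>R. w p * s p))"
proof -
  have finR: "finite R" using assms fin finite_subset by auto
  have "PB w P (\<lambda>a. sum s (a \<inter> R) > c) \<le> EB w P (\<lambda>a. exp (- c) * (\<Prod>p\<in>a \<inter> R. exp (s p)))"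
    unfolding PB_def
  proof (rule EB_mono)
    fix a assume "a \<subseteq> P"
    have "exp (-c) * (\<Prod>p\<in>a \<inter> R. exp (s p)) = exp (sum s (a \<inter> R) - c)"
      using finR by (simp add: exp_sum[symmetric] exp_add[symmetric])
    thus "of_bool (sum s (a \<inter> R) > c) \<le> exp (- c) * (\<Prod>p\<in>a \<inter> R. exp (s p))" by auto
  qed
  also have "\<dots> = exp (- c) * (\<Prod>p\<in>R. (1 + w p * exp (s p)) / (1 + w p))"
    unfolding EB_cmult EB_prod[OF assms(1)] ..
  also have "(\<Prod>p\<in>R. (1 + w p * exp (s p)) / (1 + w p)) \<le> (\<Prod>p\<in>R. exp (2 * (w p * s p)))"
  proof (rule prod_mono)
    fix p assume p: "p \<in> R"
    have w: "0 \<le> w p" using w_nonneg by auto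
    have s: "0 \<le> s p" "s p \<le> 1" using assms(2)[OF p] by auto
    have "exp (s p) \<le> 1 + s p + (s p)\<^sup>2" by (rule exp_bound[OF s])
    also have "(s p)\<^sup>2 \<le> s p * 1" unfolding power2_eq_square using s by (intro mult_left_mono) auto
    finally have "w p * exp (s p) \<le> w p * (1 + 2 * s p)" using w by (intro mult_left_mono) auto
    hence "(1 + w p * exp (s p)) / (1 + w p) \<le> (1 + w p + 2 * (w p * s p)) / (1 + w p)"
      using w by (intro divide_right_mono) (auto simp: algebra_simps)
    also have "\<dots> = 1 + 2 * (w p * s p) / (1 + w p)" using w by (simp add: add_divide_distrib)
    also have "2 * (w p * s p) / (1 + w p) \<le> 2 * (w p * s p) / 1" using w s by (intro divide_left_mono) auto
    also have "1 + 2 * (w p * s p) / 1 \<le> exp (2 * (w p * s p))" using exp_ge_add_one_self[of "2 * (w p * s p)"] by simp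
    finally show "0 \<le> (1 + w p * exp (s p)) / (1 + w p) \<and> (1 + w p * exp (s p)) / (1 + w p) \<le> exp (2 * (w p * s p))"
      using w by simp
  qed
  also have "\<dots> = exp (2 * (\<Sum>p\<in>R. w p * s p))" using finR by (simp add: exp_sum[symmetric] sum_distrib_left)
  finally show ?thesis by (simp add: mult_left_mono)
qed

text \<open>The event \<open>E v\<close> asks that \<open>G v\<close> holds below level \<open>v\<close> and that the levels from \<open>v\<close> to
  \<open>v + g v\<close> are empty. If no earlier attempt that ended before level \<open>v - 1\<close> succeeded and level
  \<open>v - 1\<close> is occupied, then no earlier attempt succeeded at all, and success at \<open>v\<close> is
  independent of this up to the failure probability \<open>\<delta>\<close> of \<open>G v\<close>.\<close>

lemma no_gap_step:
  fixes U :: "nat \<Rightarrow> 'a set" and g :: "nat \<Rightarrow> nat" and G :: "nat \<Rightarrow> 'a set \<Rightarrow> bool"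
  assumes U: "\<And>i j. i \<le> j \<Longrightarrow> U i \<subseteq> U j" "U (v + g v) \<subseteq> P"
    and GU: "\<And>i a. G i a = G i (a \<inter> U i)"
    and E_def: "\<And>i a. E i a \<longleftrightarrow> G i a \<and> a \<inter> (U (i + g i) - U i) = {}"
    and v: "V0 \<le> v" "1 \<le> v" and \<rho>: "1/5 \<le> PB w P (\<lambda>a. a \<inter> (U v - U (v - 1)) \<noteq> {})"
    and \<delta>: "PB w P (\<lambda>a. \<not> G v a) \<le> \<delta>"
    and q: "0 \<le> q" "q \<le> PB w P (\<lambda>a. a \<inter> (U (v + g v) - U v) = {})"
  shows "PB w P (\<lambda>a. \<forall>i. V0 \<le> i \<and> i < Suc v \<longrightarrow> \<not> E i a) \<le> 
     PB w P (\<lambda>a. \<forall>i. V0 \<le> i \<and> i < v \<longrightarrow> \<not> E i a) 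
       - q * (PB w P (\<lambda>a. \<forall>i. V0 \<le> i \<and> i < v \<longrightarrow> \<not> E i a) / 5 - \<delta>)"
proof -
  define D where "D = (\<lambda>v a. \<forall>i. V0 \<le> i \<and> i < v \<longrightarrow> \<not> E i a)"
  define A where "A = (\<lambda>a. \<forall>i. V0 \<le> i \<and> i + g i \<le> v - 1 \<longrightarrow> \<not> E i a)"
  define NE where "NE = (\<lambda>a. a \<inter> (U v - U (v - 1)) \<noteq> {})"
  define EM where "EM = (\<lambda>a. a \<inter> (U (v + g v) - U v) = {})"
  have UP: "U i \<subseteq> P" if "i \<le> v" for i using U(1)[of i "v + g v"] U(2) that by auto
  have EU: "E i a = E i (a \<inter> U j)" if "i + g i \<le> j" for i j a
  proof -
    have "U i \<subseteq> U j" "U (i + g i) \<subseteq> U j" using U(1) that by auto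
    hence "a \<inter> U j \<inter> U i = a \<inter> U i" "a \<inter> U j \<inter> (U (i + g i) - U i) = a \<inter> (U (i + g i) - U i)" by auto
    thus ?thesis unfolding E_def using GU[of i a] GU[of i "a \<inter> U j"] by simp
  qed
  \<comment> \<open>The attempts counted in \<open>A\<close> have ended by level
    \<open>v - 1\<close>, so \<open>A\<close> sees only that part of the set.\<close>
  have AU: "A a = A (a \<inter> U (v - 1))" for a unfolding A_def using EU by metis
  have NEU: "NE a = NE (a \<inter> (U v - U (v - 1)))" for a by (auto simp: NE_def)
  have EMU: "EM a = EM (a \<inter> (U (v + g v) - U v))" for a by (auto simp: EM_def)
  have Uv: "U (v - 1) \<subseteq> U v" using U(1) by simp
  have AGU: "(A a \<and> NE a \<and> G v a) = (A (a \<inter> U v) \<and> NE (a \<inter> U v) \<and> G v (a \<inter> U v))" for a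
  proof -
    have "a \<inter> U v \<inter> U (v - 1) = a \<inter> U (v - 1)" using Uv by auto
    hence "A a = A (a \<inter> U v)" using AU[of a] AU[of "a \<inter> U v"] by simp
    moreover have "NE a = NE (a \<inter> U v)" by (auto simp: NE_def)
    ultimately show ?thesis using GU[of v a] by simp
  qed
  have dA: "PB w P (D v) \<le> PB w P A"
    by (rule PB_mono) (use v in \<open>auto simp: D_def A_def\<close>)
  have "PB w P (\<lambda>a. A a \<and> NE a) = PB w P A * PB w P NE"
  proof (rule PB_indep[where ?R1.0 = "U (v - 1)" and ?R2.0 = "U v - U (v - 1)" and \<phi> = A and \<psi> = NE], goal_cases)
    case 4 show ?case by (rule AU)
  next
    case 5 show ?case by (rule NEU)
  qed (use UP[of v] UP[of "v-1"] in auto)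
  also have "\<dots> \<ge> PB w P (D v) * (1/5)"
    using dA \<rho> by (intro mult_mono PB_nonneg) (auto simp: NE_def)
  finally have 1: "PB w P (D v) / 5 \<le> PB w P (\<lambda>a. A a \<and> NE a)" by simp
  have "PB w P (\<lambda>a. A a \<and> NE a) \<le> PB w P (\<lambda>a. (A a \<and> NE a \<and> G v a) \<or> \<not> G v a)"
    by (rule PB_mono) auto
  also have "\<dots> \<le> PB w P (\<lambda>a. A a \<and> NE a \<and> G v a) + \<delta>"
    using PB_disj_le[of "\<lambda>a. A a \<and> NE a \<and> G v a" "\<lambda>a. \<not> G v a"] \<delta> by linarith
  finally have 2: "PB w P (D v) / 5 - \<delta> \<le> PB w P (\<lambda>a. A a \<and> NE a \<and> G v a)" using 1 by linarith
  have "q * (PB w P (D v) / 5 - \<delta>) \<le> q * PB w P (\<lambda>a. A a \<and> NE a \<and> G v a)"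
    using 2 q by (intro mult_left_mono) auto
  also have "\<dots> \<le> PB w P EM * PB w P (\<lambda>a. A a \<and> NE a \<and> G v a)"
    using q unfolding EM_def by (intro mult_right_mono PB_nonneg) auto
  also have "\<dots> = PB w P (\<lambda>a. (A a \<and> NE a \<and> G v a) \<and> EM a)"
  proof -
    have "PB w P (\<lambda>a. (A a \<and> NE a \<and> G v a) \<and> EM a) = PB w P (\<lambda>a. A a \<and> NE a \<and> G v a) * PB w P EM"
    proof (rule PB_indep[where ?R1.0 = "U v" and ?R2.0 = "U (v + g v) - U v"
          and \<phi> = "\<lambda>a. A a \<and> NE a \<and> G v a" and \<psi> = EM], goal_cases)
      case 4 show ?case by (rule AGU)
    next
      case 5 show ?case by (rule EMU)
    qed (use UP[of v] U(2) in auto)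
    thus ?thesis by simp
  qed
  also have "\<dots> \<le> PB w P (\<lambda>a. D v a \<and> E v a)"
  proof (rule PB_mono)
    fix a assume "a \<subseteq> P" and a: "(A a \<and> NE a \<and> G v a) \<and> EM a"
    have "\<not> E i a" if "V0 \<le> i" "i < v" for i
    proof (cases "i + g i \<le> v - 1")
      case True thus ?thesis using a that by (auto simp: A_def)
    next
      case False
      \<comment> \<open>An attempt at \<open>i\<close> still running at level \<open>v - 1\<close>
        would need the layer between \<open>U (v - 1)\<close> and \<open>U v\<close> to be empty,
        which \<open>NE\<close> excludes.\<close>
      hence "v \<le> i + g i" "i \<le> v - 1" using that v by auto
      hence "U v - U (v - 1) \<subseteq> U (i + g i) - U i" using U(1)[of v "i + g i"] U(1)[of i "v - 1"] by auto
      thus ?thesis using a by (auto simp: NE_def E_def)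
    qed
    thus "D v a \<and> E v a" using a by (auto simp: D_def E_def EM_def)
  qed
  finally have 3: "q * (PB w P (D v) / 5 - \<delta>) \<le> PB w P (\<lambda>a. D v a \<and> E v a)" .
  have "(\<lambda>a. of_bool (D (Suc v) a)) = (\<lambda>a. of_bool (D v a) - of_bool (D v a \<and> E v a) :: real)"
    using v by (auto simp: D_def less_Suc_eq fun_eq_iff)
  hence "PB w P (D (Suc v)) = PB w P (D v) - PB w P (\<lambda>a. D v a \<and> E v a)"
    unfolding PB_def by (simp only: EB_diff)
  thus ?thesis using 3 by (simp add: D_def)
qed

text \<open>The probability \<open>d v\<close> of no success before \<open>v\<close> decreases.
  Either its final value is at most \<open>10 * \<delta>\<close>, or
  \<open>\<delta> < d v / 10\<close> throughout, and then \<open>no_gap_step\<close> contracts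
  \<open>d\<close> by the factor \<open>1 - q v / 10\<close>.\<close>

lemma no_gap_bound:
  fixes U :: "nat \<Rightarrow> 'a set" and g :: "nat \<Rightarrow> nat" and G :: "nat \<Rightarrow> 'a set \<Rightarrow> bool"
  assumes U: "\<And>i j. i \<le> j \<Longrightarrow> U i \<subseteq> U j" 
    and GU: "\<And>i a. G i a = G i (a \<inter> U i)"
    and E_def: "\<And>i a. E i a \<longleftrightarrow> G i a \<and> a \<inter> (U (i + g i) - U i) = {}"
    and V: "V0 \<le> V1" "1 \<le> V0" and \<delta>0: "\<delta> \<ge> 0"
    and UP: "\<And>v. V0 \<le> v \<Longrightarrow> v < V1 \<Longrightarrow> U (v + g v) \<subseteq> P"
    and \<rho>: "\<And>v. V0 \<le> v \<Longrightarrow> v < V1 \<Longrightarrow> 1/5 \<le> PB w P (\<lambda>a. a \<inter> (U v - U (v - 1)) \<noteq> {})"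
    and \<delta>: "\<And>v. V0 \<le> v \<Longrightarrow> v < V1 \<Longrightarrow> PB w P (\<lambda>a. \<not> G v a) \<le> \<delta>"
    and q: "\<And>v. V0 \<le> v \<Longrightarrow> v < V1 \<Longrightarrow> 0 \<le> q v \<and> q v \<le> PB w P (\<lambda>a. a \<inter> (U (v + g v) - U v) = {})"
  shows "PB w P (\<lambda>a. \<forall>i. V0 \<le> i \<and> i < V1 \<longrightarrow> \<not> E i a) \<le> 10 * \<delta> + exp (- (\<Sum>v\<in>{V0..<V1}. q v) / 10)"
proof -
  define d where "d = (\<lambda>v. PB w P (\<lambda>a. \<forall>i. V0 \<le> i \<and> i < v \<longrightarrow> \<not> E i a))"
  have rec: "d (Suc v) \<le> d v - q v * (d v / 5 - \<delta>)" if "V0 \<le> v" "v < V1" for v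
    unfolding d_def using that V(2) by (intro no_gap_step[where U = U and g = g and G = G, OF U UP GU E_def]) (use \<rho> \<delta> q in auto)
  have mono: "d V1 \<le> d v" if "v \<le> V1" for v
    unfolding d_def using that by (intro PB_mono) auto
  have d0: "d v \<ge> 0" for v unfolding d_def by (rule PB_nonneg)
  show ?thesis
  proof (cases "d V1 \<le> 10 * \<delta>")
    case True
    moreover have "exp (- (\<Sum>v\<in>{V0..<V1}. q v) / 10) > 0" by simp
    ultimately show ?thesis unfolding d_def by linarith
  next
    case False
    have "d v \<le> exp (- (\<Sum>v\<in>{V0..<v}. q v) / 10)" if "V0 \<le> v" "v \<le> V1" for v
      using that
    proof (induction v rule: dec_induct)
      case base
      have "d V0 \<le> EB w P (\<lambda>_. 1)" unfolding d_def PB_def by (rule EB_mono) auto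
      thus ?case by (simp add: EB_one)
    next
      case (step v)
      have "10 * \<delta> < d v" using mono[of v] False step by simp
      hence "d v / 10 \<le> d v / 5 - \<delta>" by simp
      hence "q v * (d v / 10) \<le> q v * (d v / 5 - \<delta>)" using q[of v] step by (intro mult_left_mono) auto
      hence "d (Suc v) \<le> d v * (1 + - q v / 10)" using rec[OF step.hyps(1)] step.prems by (simp add: algebra_simps)
      also have "\<dots> \<le> d v * exp (- q v / 10)" using d0 by (intro mult_left_mono exp_ge_add_one_self) auto
      also have "\<dots> \<le> exp (- (\<Sum>v\<in>{V0..<v}. q v) / 10) * exp (- q v / 10)" using step by (intro mult_right_mono) auto
      also have "\<dots> = exp (- (\<Sum>v\<in>{V0..<Suc v}. q v) / 10)" using step by (simp add: exp_add[symmetric] add_divide_distrib[symmetric] diff_divide_distrib)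
      finally show ?case .
    qed
    from this[of V1] V \<delta>0 show ?thesis unfolding d_def by simp
  qed
qed

end

section \<open>Extravagant spacing\<close>

text \<open>Split \<open>m\<close> into its part \<open>a\<close> inside \<open>U\<close> and the
  rest. By \<open>binomial_poisson_le\<close> the sum over the rest is at most a constant times
  \<open>main_term k x * (k / L) ^ card a * exp (- a0 * k / L)\<close>. The power turns the weights
  \<open>1 / p\<close> into \<open>k / (L * p)\<close>, and the exponential is at most the
  normalising factor \<open>1 / (\<Prod>p\<in>U. 1 + w p)\<close>.\<close>

lemma cofactor_sum_le_PB:
  fixes x :: real and k :: nat
  defines "L \<equiv> Lam x"
  assumes U: "U \<subseteq> {p. p \<in> GP \<and> real p \<le> x}" and k: "k \<ge> 1" and L: "L > 0"
    and A: "(\<Sum>p\<in>U. 1 / real p) \<le> 3/4 * L" "(L - (\<Sum>p\<in>U. 1 / real p)) * real k / L \<ge> 1"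
  shows "(\<Sum>m | m \<in> S_r k x \<and> \<phi> (prime_factors m \<inter> U). 1 / real m) \<le>
     2 * exp 2 * main_term k x * PB (\<lambda>p. real k / L / real p) U \<phi>"
proof -
  define P where "P = {p. p \<in> GP \<and> real p \<le> x}"
  define v where "v = (\<lambda>p::nat. 1 / real p)"
  define w where "w = (\<lambda>p::nat. real k / L / real p)"
  define a0 where "a0 = (\<Sum>p\<in>U. v p)"
  have finP: "finite P" by (simp add: P_def)
  have finU: "finite U" using U finP finite_subset unfolding P_def by blast
  have v0: "v p \<ge> 0" for p by (simp add: v_def)
  interpret random_set w U by unfold_locales (use finU L in \<open>auto simp: w_def\<close>)
  define I where "I = {a. a \<subseteq> U \<and> \<phi> a \<and> card a \<le> k}"
  have finI: "finite I" unfolding I_def using finU by auto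
  define J where "J = (\<lambda>a::nat set. {b. b \<subseteq> P - U \<and> card b = k - card a})"
  have finJ: "finite (J a)" for a unfolding J_def using finP by auto
  have "(\<Sum>m | m \<in> S_r k x \<and> \<phi> (prime_factors m \<inter> U). 1 / real m) \<le> (\<Sum>(a,b)\<in>(SIGMA a:I. J a). prod v a * prod v b)"
  proof (rule sum_le_included[where i = "\<lambda>(a,b). \<Prod>(a \<union> b)"])
    show "\<forall>m\<in>{m. m \<in> S_r k x \<and> \<phi> (prime_factors m \<inter> U)}. \<exists>y\<in>(SIGMA a:I. J a). (case y of (a, b) \<Rightarrow> \<Prod>(a \<union> b)) = m \<and>
        1 / real m \<le> (case y of (a, b) \<Rightarrow> prod v a * prod v b)"
    proof
      fix m assume m: "m \<in> {m. m \<in> S_r k x \<and> \<phi> (prime_factors m \<inter> U)}"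
      hence mS: "m \<in> S_r k x" by simp
      define a b where "a = prime_factors m \<inter> U" and "b = prime_factors m - U"
      have ab: "a \<union> b = prime_factors m" "a \<inter> b = {}" "finite a" "finite b" by (auto simp: a_def b_def)
      have card: "card a + card b = k" using S_r_prod(2)[OF mS] ab by (metis card_Un_disjoint)
      have "a \<in> I" using m card by (auto simp: I_def a_def)
      moreover have "b \<in> J a" using card prime_factors_le_S_r[OF mS] by (auto simp: J_def b_def P_def intro: less_imp_le)
      moreover have "\<Prod>(a \<union> b) = m" using S_r_prod(1)[OF mS] ab by simp
      moreover have "1 / real m = prod v a * prod v b"
        using inverse_S_r[OF mS] prod.union_disjoint[OF ab(3,4,2), of v] ab(1) by (simp add: v_def)
      ultimately show "\<exists>y\<in>(SIGMA a:I. J a). (case y of (a, b) \<Rightarrow> \<Prod>(a \<union> b)) = m \<and>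
        1 / real m \<le> (case y of (a, b) \<Rightarrow> prod v a * prod v b)" by (intro bexI[of _ "(a,b)"]) auto
    qed
    show "finite (SIGMA a:I. J a)" using finI finJ by auto
  qed (auto intro!: mult_nonneg_nonneg prod_nonneg v0)
  also have "\<dots> = (\<Sum>a\<in>I. \<Sum>b\<in>J a. prod v a * prod v b)"
    using finI finJ by (subst sum.Sigma) auto
  also have "\<dots> = (\<Sum>a\<in>I. prod v a * esym v (P - U) (k - card a))"
    by (simp add: esym_def J_def sum_distrib_left)
  also have "\<dots> \<le> (\<Sum>a\<in>I. 2 * exp 2 * main_term k x * exp (- (a0 * (real k / L))) * prod w a)"
  proof (rule sum_mono)
    fix a assume a: "a \<in> I"
    have "esym v (P - U) (k - card a) \<le> (\<Sum>p\<in>P - U. v p) ^ (k - card a) / fact (k - card a)"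
      using finP v0 by (intro esym_le) auto
    also have "(\<Sum>p\<in>P - U. v p) = L - a0"
      using U finP by (simp add: sum_diff P_def L_def Lam_def v_def a0_def)
    also have "(L - a0) ^ (k - card a) / fact (k - card a) \<le> 
       2 * exp 2 * (L ^ k / fact k) * (real k / L) ^ (k - (k - card a)) * exp (- ((L - (L - a0)) * (real k / L)))"
      using k L A by (intro binomial_poisson_le) (auto simp: a0_def v_def)
    also have "k - (k - card a) = card a" using a by (auto simp: I_def)
    finally have "prod v a * esym v (P - U) (k - card a) \<le> prod v a * (2 * exp 2 * (L ^ k / fact k) * (real k / L) ^ card a * exp (- (a0 * (real k / L))))"
      using v0 by (intro mult_left_mono prod_nonneg) auto
    also have "\<dots> = 2 * exp 2 * main_term k x * exp (- (a0 * (real k / L))) * ((real k / L) ^ card a * prod v a)"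
      by (simp add: main_term_def L_def)
    also have "(real k / L) ^ card a * prod v a = prod w a"
    proof -
      have "prod w a = (\<Prod>p\<in>a. real k / L) * prod v a" unfolding prod.distrib[symmetric] by (simp add: w_def v_def)
      thus ?thesis by simp
    qed
    finally show "prod v a * esym v (P - U) (k - card a) \<le> 2 * exp 2 * main_term k x * exp (- (a0 * (real k / L))) * prod w a" .
  qed
  also have "\<dots> = 2 * exp 2 * main_term k x * (exp (- (a0 * (real k / L))) * (\<Sum>a\<in>I. prod w a))"
    unfolding sum_distrib_left[symmetric] by (simp add: mult_ac)
  also have "\<dots> \<le> 2 * exp 2 * main_term k x * PB w U \<phi>"
  proof (intro mult_left_mono)
    have "sum w U = a0 * (real k / L)" by (simp add: w_def a0_def v_def sum_distrib_left mult.commute)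
    hence "exp (- (a0 * (real k / L))) \<le> 1 / (\<Prod>p\<in>U. 1 + w p)"
      using le_imp_inverse_le[OF prod_le_exp[of U] prod_pos[of U]] by (simp add: exp_minus divide_inverse)
    moreover have "(\<Sum>a\<in>I. prod w a) \<le> (\<Sum>a\<in>Pow U. prod w a * of_bool (\<phi> a))"
    proof -
      have "(\<Sum>a\<in>I. prod w a) = (\<Sum>a\<in>I. prod w a * of_bool (\<phi> a))" by (intro sum.cong) (auto simp: I_def)
      also have "\<dots> \<le> (\<Sum>a\<in>Pow U. prod w a * of_bool (\<phi> a))"
        using finU prod_w_nonneg by (intro sum_mono2) (auto simp: I_def)
      finally show ?thesis .
    qed
    ultimately have "exp (- (a0 * (real k / L))) * (\<Sum>a\<in>I. prod w a) \<le> 1 / (\<Prod>p\<in>U. 1 + w p) * (\<Sum>a\<in>Pow U. prod w a * of_bool (\<phi> a))"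
      using prod_pos[of U] prod_w_nonneg by (intro mult_mono sum_nonneg) (auto intro: less_imp_le)
    thus "exp (- (a0 * (real k / L))) * (\<Sum>a\<in>I. prod w a) \<le> PB w U \<phi>" by (simp add: PB_def EB_def)
  qed (use L in \<open>simp add: main_term_def L_def\<close>)
  finally show ?thesis by (simp add: w_def)
qed

text \<open>Integer steps on the scale \<open>ln (ln p)\<close>; between consecutive levels
  \<open>1 / p\<close> sums to about 1/2.\<close>

definition level :: "nat \<Rightarrow> nat set" where
  "level i = {p. p \<in> GP \<and> real p \<le> exp (exp (real i))}"

lemma level_mono: "i \<le> j \<Longrightarrow> level i \<subseteq> level j"
  by (auto simp: level_def intro: order_trans)

lemma finite_level: "finite (level i)"
  by (simp add: level_def)

text \<open>\<open>exp u / u\<^sup>2\<close> increases for \<open>u \<ge> 2\<close>. Hence the size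
  condition, once secured at the upper end of a gap, also holds at the next prime factor, which may
  lie far beyond it.\<close>

lemma exp_div_square_mono:
  fixes y u :: real assumes "2 \<le> y" "y \<le> u" shows "u\<^sup>2 * exp y \<le> y\<^sup>2 * exp u"
proof -
  have "u / y = 1 + (u - y) / y" using assms by (simp add: field_simps)
  also have "(u - y) / y \<le> (u - y) / 2" using assms by (intro divide_left_mono) auto
  also have "1 + (u - y) / 2 \<le> exp ((u - y) / 2)" by (rule exp_ge_add_one_self)
  finally have "(u / y)\<^sup>2 \<le> (exp ((u - y) / 2))\<^sup>2" using assms by (intro power_mono) auto
  also have "\<dots> = exp (u - y)" by (simp add: power2_eq_square exp_add[symmetric])
  finally show ?thesis using assms by (simp add: exp_diff power_divide field_simps)
qed

text \<open>The index found is that of the first prime factor beyond level \<open>v\<close>. The gap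
  pushes this prime above level \<open>v + g\<close>, while the logarithms of its predecessors sum
  to at most \<open>K * exp v\<close>. The two cardinality bounds keep the index in the required
  range.\<close>

lemma extravagantly_spacedI:
  fixes x K :: real and n v g N V0 :: nat
  defines "a \<equiv> prime_factors n \<inter> level N" and "l \<equiv> ln (ln (ln x))"
  assumes n: "n \<in> S_r r x" and card: "real (card a) + 1 < real r / 2" "sqrt (real r) / 2 < real (card (a \<inter> level V0))"
    and v: "V0 \<le> v" "v + g \<le> N" "2 \<le> v" and l: "l \<ge> 0" and K: "K \<ge> 0"
    and sum: "(\<Sum>p\<in>a \<inter> level v. ln (real p)) \<le> K * exp (real v)"
    and gap: "a \<inter> (level (v + g) - level v) = {}"
    and g: "(real (v + g))\<^sup>2 * (l * K) \<le> exp (real g)"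
  shows "extravagantly_spaced x n"
proof -
  have om: "omega n = r" using n by (simp add: S_r_def)
  define b where "b = prime_factors n \<inter> level v"
  have ab: "a \<inter> level v = b" using level_mono[of v N] v by (auto simp: a_def b_def)
  have finb: "finite b" "finite a" by (auto simp: a_def b_def)
  define i where "i = card b + 1"
  have cb: "card b \<le> card a" using ab finb by (intro card_mono) auto
  have i: "1 \<le> i" "real i < real r / 2" using cb card(1) by (auto simp: i_def)
  hence io: "i \<le> omega n" using om by linarith
  define q where "q = pfac n i"
  have qn: "q \<in> prime_factors n" unfolding q_def by (rule pfac_mem[OF i(1) io])
  have qS: "q \<in> GP" using prime_factors_le_S_r[OF n qn] by auto
  define B where "B = {p \<in> prime_factors n. p < q}"
  have cB: "card B = card b" using card_less_pfac[OF i(1) io] by (simp add: B_def q_def i_def)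
  \<comment> \<open>Otherwise \<open>q\<close> and the \<open>card b\<close> prime factors below it
    would all lie in \<open>b\<close>.\<close>
  have "q \<notin> level v"
  proof
    assume "q \<in> level v"
    hence "insert q B \<subseteq> b" using qn prime_factors_le_S_r[OF n] by (auto simp: B_def b_def level_def)
    hence "card (insert q B) \<le> card b" using finb by (intro card_mono) auto
    moreover have "card (insert q B) = Suc (card B)" by (auto simp: B_def)
    ultimately show False using cB by simp
  qed
  hence qv: "real q > exp (exp (real v))" using qS by (simp add: level_def)
  have "b \<subseteq> B" using qv by (auto simp: b_def B_def level_def)
  hence Bb: "B = b" using cB by (metis B_def card_subset_eq finite_Collect_conjI finite_set_mset Collect_mem_eq)
  have "q \<notin> level (v + g)"
  proof
    assume q: "q \<in> level (v + g)"
    hence "q \<in> a" using level_mono[OF v(2)] qn by (auto simp: a_def)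
    thus False using gap q \<open>q \<notin> level v\<close> by auto
  qed
  hence qg: "real q > exp (exp (real (v + g)))" using qS by (simp add: level_def)
  define y u where "y = real (v + g)" and "u = ln (ln (real q))"
  have q0: "real q > 0" using qg by (rule less_trans[rotated]) simp
  have lq: "ln (real q) > exp y" using qg q0 by (metis exp_less_cancel_iff exp_ln y_def)
  hence lq0: "ln (real q) > 0" by (rule less_trans[rotated]) simp
  have u: "u > y" using lq lq0 by (metis exp_less_cancel_iff exp_ln u_def)
  have eu: "exp u = ln (real q)" using lq0 by (simp add: u_def)
  have y2: "y \<ge> 2" using v by (simp add: y_def)
  have "(\<Sum>j=1..i-1. ln (real (pfac n j))) = (\<Sum>p\<in>B. ln (real p))"
  proof -
    have "{1..i-1} = {1..<i}" by auto
    thus ?thesis using sum.reindex_bij_betw[OF pfac_bij_betw[OF i(1) io], of "\<lambda>p. ln (real p)"] by (simp add: B_def q_def)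
  qed
  also have "\<dots> \<le> K * exp (real v)" using sum ab Bb by simp
  finally have s: "(\<Sum>j=1..i-1. ln (real (pfac n j))) \<le> K * exp (real v)" .
  have "u\<^sup>2 * l * (\<Sum>j=1..i-1. ln (real (pfac n j))) \<le> u\<^sup>2 * l * (K * exp (real v))"
    using s l by (intro mult_left_mono) auto
  also have "\<dots> \<le> exp u"
  proof -
    have "y\<^sup>2 * (l * K) * exp (real v) \<le> exp (real g) * exp (real v)" using g by (intro mult_right_mono) (auto simp: y_def)
    hence 1: "y\<^sup>2 * (l * K * exp (real v)) \<le> exp y" by (simp add: y_def exp_add[symmetric] add.commute mult_ac)
    have "u\<^sup>2 * (y\<^sup>2 * (l * K * exp (real v))) \<le> u\<^sup>2 * exp y" using 1 by (intro mult_left_mono) auto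
    also have "\<dots> \<le> y\<^sup>2 * exp u" using y2 u by (intro exp_div_square_mono) auto
    finally have "y\<^sup>2 * (u\<^sup>2 * l * (K * exp (real v))) \<le> y\<^sup>2 * exp u" by (simp add: mult_ac)
    thus ?thesis using y2 by (subst (asm) mult_le_cancel_left_pos) auto
  qed
  finally have main: "ln (real (pfac n i)) \<ge> (ln (ln (real (pfac n i))))\<^sup>2 * ln (ln (ln x)) * (\<Sum>j=1..i-1. ln (real (pfac n j)))"
    using eu by (simp add: u_def q_def l_def)
  have "a \<inter> level V0 \<subseteq> b" using level_mono[OF v(1)] ab by auto
  hence "card (a \<inter> level V0) \<le> card b" using finb by (intro card_mono) auto
  hence "sqrt (real r) / 2 < real i" using card(2) by (simp add: i_def)
  thus ?thesis unfolding extravagantly_spaced_def om using main i(2) by blast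
qed

lemma sum_level_bounds:
  "\<exists>C>0. \<forall>i. \<bar>(\<Sum>p\<in>level i. 1 / real p) - real i / 2\<bar> \<le> C"
proof -
  obtain C where C: "C > 0" "\<And>x. x \<ge> 2 \<Longrightarrow> \<bar>Lam x - ln (ln x) / 2\<bar> \<le> C" using Lam_bounds by blast
  have "exp (exp (real i)) \<ge> 2" for i
    using exp_ge_add_one_self[of "exp (real i)"] exp_ge_add_one_self[of "real i"] by linarith
  hence "\<bar>(\<Sum>p\<in>level i. 1 / real p) - real i / 2\<bar> \<le> C" for i
    using C(2)[of "exp (exp (real i))"] by (simp add: level_def Lam_def)
  thus ?thesis using C(1) by blast
qed

lemma sum_level_diff:
  assumes "i \<le> j"
  shows "\<bar>(\<Sum>p\<in>level j - level i. 1 / real p) - real (j - i) / 2\<bar> \<le> 43 / exp (real i)"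
proof -
  have t: "exp (exp (real i)) \<ge> 2" for i
    using exp_ge_add_one_self[of "exp (real i)"] exp_ge_add_one_self[of "real i"] by linarith
  have "level j - level i = {p. p \<in> GP \<and> exp (exp (real i)) < real p \<and> real p \<le> exp (exp (real j))}"
    by (auto simp: level_def)
  moreover have "real (j - i) = real j - real i" using assms by simp
  ultimately show ?thesis using GP_mertens_inv[OF t[of i], of "exp (exp (real j))"] assms by simp
qed

lemma sum_level_ln: "(\<Sum>p\<in>level i. ln (real p) / real p) \<le> exp (real i) / 2 + 11"
proof -
  define T where "T = (\<Sum>p\<in>level i. ln (real p) / real p)"
  have "\<bar>T - exp (real i) / 2\<bar> \<le> 11"
    using GP_mertens[of "exp (exp (real i))"] by (simp add: level_def T_def)
  thus ?thesis unfolding T_def[symmetric] by linarith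
qed

lemma sum_inverse_ge_ln:
  assumes "1 \<le> a" "a \<le> b"
  shows "ln (real b) - ln (real a) \<le> (\<Sum>v\<in>{a..<b}. 1 / real v)"
  using assms(2)
proof (induction b rule: dec_induct)
  case (step n)
  have n: "real n > 0" using step assms by auto
  have "ln (real (Suc n) / real n) \<le> real (Suc n) / real n - 1" using n by (intro ln_le_minus_one) auto
  also have "\<dots> = 1 / real n" using n by (simp add: field_simps)
  finally have "ln (real (Suc n)) - ln (real n) \<le> 1 / real n" using n by (simp add: ln_div del: of_nat_Suc)
  thus ?case using step by simp
qed simp

text \<open>The three alternatives are the ways in which \<open>extravagantly_spacedI\<close> can
  fail: too many primes below level \<open>N\<close>, too few below \<open>V0\<close>, or no
  successful gap. Here \<open>m\<close> stands for \<open>mu x\<close> and \<open>z\<close> for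
  \<open>k / Lam x\<close>; with \<open>x\<close> eliminated, the asymptotics can be done in
  \<open>m\<close> and transferred by \<open>eventually_mu\<close>.\<close>

definition gap_bound :: "real \<Rightarrow> real \<Rightarrow> real \<Rightarrow> real \<Rightarrow> nat \<Rightarrow> bool" where
  "gap_bound C0 c m z r \<longleftrightarrow> (\<exists>V0 V1 N K g. 2 \<le> V0 \<and> real N \<le> m / 2 \<and> K \<ge> 0 \<and>
        (\<forall>v. V0 \<le> v \<and> v < V1 \<longrightarrow> v + g v \<le> N \<and> (real (v + g v))\<^sup>2 * (ln (2 * m) * K) \<le> exp (real (g v))) \<and>
        PB (\<lambda>p. z / real p) (level N) (\<lambda>a. real r / 2 - 1 \<le> real (card (a \<inter> level N)) \<or> real (card (a \<inter> level V0)) \<le> sqrt (real r) / 2 \<or>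
           (\<forall>v. V0 \<le> v \<and> v < V1 \<longrightarrow> \<not> ((\<Sum>p\<in>a \<inter> level v. ln (real p)) \<le> K * exp (real v) \<and> a \<inter> (level (v + g v) - level v) = {})))
         \<le> C0 * exp (- c * ln (2 * m) powr (1/3)))"

text \<open>With \<open>m = mu x\<close> one has \<open>ln (ln (ln x)) = ln (2 * m)\<close>. The parameter \<open>K = ln (2 * m) powr (1/3)\<close>
  balances the probability \<open>exp (- K)\<close> that the primes below level \<open>v\<close> are too large against the
  expected number of sufficiently long gaps.\<close>

lemma gap_probability:
  fixes C :: real assumes C: "C > 0"
  shows "\<exists>C0 c. C0 > 0 \<and> c > 0 \<and> eventually (\<lambda>m. \<forall>z r. \<bar>z - 1\<bar> \<le> C * m powr (-1/3) \<and> \<bar>real r - m\<bar> < m powr (2/3) \<and> real r \<le> 2 * m \<longrightarrow> gap_bound C0 c m z r) at_top"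
proof -
  obtain C1 where C1: "C1 > 0" "\<And>i. \<bar>(\<Sum>p\<in>level i. 1 / real p) - real i / 2\<bar> \<le> C1" using sum_level_bounds by blast
  \<comment> \<open>The harmonic sum is at least \<open>l / 4\<close>, \<open>q\<close> carries the
    factor \<open>exp (- 50) / 2\<close>, and \<open>no_gap_bound\<close> divides by 10. In
    \<open>C0\<close> the part \<open>10 * exp 26\<close> is \<open>10 * \<delta>\<close> from that
    lemma, and 3 covers the other three error terms.\<close>
  define c :: real where "c = exp (- 50) / 80"
  define C0 :: real where "C0 = 10 * exp 26 + 3"
  have c: "c > 0" "c \<le> 1"
  proof -
    show "c > 0" by (simp add: c_def)
    have "exp (- 50) \<le> (1::real)" by simp
    thus "c \<le> 1" unfolding c_def by linarith
  qed
  have ev: "eventually (\<lambda>m::real. m \<ge> 200 \<and> ln (2 * m) \<ge> 1 \<and> C * m powr (-1/3) \<le> 1/10 \<and>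
     ln (4 * m\<^sup>2 * ln (2 * m) powr (4/3)) + 1 \<le> 20 * sqrt m \<and>
     C * m powr (-1/3) * (ln (4 * m\<^sup>2 * ln (2 * m) powr (4/3)) + 1) \<le> 1 \<and>
     20 * sqrt m + 1 \<le> m / 4 - 1 \<and>
     ln (m / 4 - 1) - ln (20 * sqrt m + 1) \<ge> ln (2 * m) / 4 \<and>
     1 - (m - m powr (2/3)) / 3 + 11/10 * (m / 4 + C1) \<le> - (ln (2 * m) powr (1/3)) \<and>
     sqrt m - 9/10 * (10 * sqrt m - C1) / 4 \<le> - (ln (2 * m) powr (1/3))) at_top"
  proof (intro eventually_conj)
    show "eventually (\<lambda>m::real. m \<ge> 200) at_top" by real_asymp
    show "eventually (\<lambda>m::real. ln (2 * m) \<ge> 1) at_top" by real_asymp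
    show "eventually (\<lambda>m::real. C * m powr (-1/3) \<le> 1/10) at_top" using C by real_asymp
    show "eventually (\<lambda>m::real. ln (4 * m\<^sup>2 * ln (2 * m) powr (4/3)) + 1 \<le> 20 * sqrt m) at_top" by real_asymp
    show "eventually (\<lambda>m::real. C * m powr (-1/3) * (ln (4 * m\<^sup>2 * ln (2 * m) powr (4/3)) + 1) \<le> 1) at_top" using C by real_asymp
    show "eventually (\<lambda>m::real. 20 * sqrt m + 1 \<le> m / 4 - 1) at_top" by real_asymp
    show "eventually (\<lambda>m::real. ln (m / 4 - 1) - ln (20 * sqrt m + 1) \<ge> ln (2 * m) / 4) at_top" by real_asymp
    show "eventually (\<lambda>m::real. 1 - (m - m powr (2/3)) / 3 + 11/10 * (m / 4 + C1) \<le> - (ln (2 * m) powr (1/3))) at_top"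
      using C1(1) by real_asymp
    show "eventually (\<lambda>m::real. sqrt m - 9/10 * (10 * sqrt m - C1) / 4 \<le> - (ln (2 * m) powr (1/3))) at_top"
      using C1(1) by real_asymp
  qed
  show ?thesis
  proof (rule exI[of _ C0], rule exI[of _ c], intro conjI)
    show "eventually (\<lambda>m. \<forall>z r. \<bar>z - 1\<bar> \<le> C * m powr (-1/3) \<and> \<bar>real r - m\<bar> < m powr (2/3) \<and> real r \<le> 2 * m \<longrightarrow> gap_bound C0 c m z r) at_top"
      using ev
    proof eventually_elim
      case (elim m)
      show ?case
      proof (intro allI impI)
        fix z :: real and r :: nat
        assume zr: "\<bar>z - 1\<bar> \<le> C * m powr (-1/3) \<and> \<bar>real r - m\<bar> < m powr (2/3) \<and> real r \<le> 2 * m"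
        define l K \<delta> where "l = ln (2 * m)" and "K = l powr (1/3)" and "\<delta> = C * m powr (-1/3)"
        have m: "m \<ge> 200" "l \<ge> 1" "\<delta> \<le> 1/10" "ln (4 * m\<^sup>2 * l powr (4/3)) + 1 \<le> 20 * sqrt m"
          "\<delta> * (ln (4 * m\<^sup>2 * l powr (4/3)) + 1) \<le> 1" "20 * sqrt m + 1 \<le> m / 4 - 1"
          "ln (m / 4 - 1) - ln (20 * sqrt m + 1) \<ge> l / 4"
          "1 - (m - m powr (2/3)) / 3 + 11/10 * (m / 4 + C1) \<le> - K"
          "sqrt m - 9/10 * (10 * sqrt m - C1) / 4 \<le> - K"
          using elim by (auto simp: l_def K_def \<delta>_def)
        have z: "9/10 \<le> z" "z \<le> 11/10" "z \<le> 1 + \<delta>" using zr m(3) unfolding \<delta>_def[symmetric] by linarith+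
        \<comment> \<open>About \<open>10 * sqrt m\<close> primes are expected below level
          \<open>V0\<close>, far more than \<open>sqrt r / 2\<close>, and about \<open>m / 4\<close>
          below \<open>N\<close>, against \<open>r / 2\<close> close to \<open>m / 2\<close>. Gaps
          are no longer than \<open>v \<le> m / 4\<close>, so they end by level \<open>N\<close>;
          and \<open>ln V1 - ln V0\<close> is still about half of \<open>ln m\<close>.\<close>
        define V0 V1 N where "V0 = nat \<lceil>20 * sqrt m\<rceil>" and "V1 = nat \<lfloor>m / 4\<rfloor>" and "N = nat \<lfloor>m / 2\<rfloor>"
        have sm: "sqrt m \<ge> 14" using m(1) real_le_rsqrt[of 14 m] by simp
        have V0: "20 * sqrt m \<le> real V0" "real V0 \<le> 20 * sqrt m + 1" using sm unfolding V0_def by linarith+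
        have V1: "real V1 \<le> m / 4" "m / 4 - 1 \<le> real V1" using m unfolding V1_def by linarith+
        have N: "real N \<le> m / 2" "m / 2 - 1 < real N" using m unfolding N_def by linarith+
        have V0ge: "V0 \<ge> 280" using V0 sm by linarith
        have V01: "V0 \<le> V1" using V0 V1 m(6) by linarith
        have K: "K \<ge> 1" unfolding K_def using m(2) by (intro ge_one_powr_ge_zero) auto
        have lK: "l * K = l powr (4/3)" using m(2) powr_add[of l 1 "1/3"] by (simp add: K_def)
        \<comment> \<open>Because \<open>g v \<le> v\<close>, the size condition on the gap follows
          from \<open>exp (g v) \<ge> (2 * v)\<^sup>2 * (l * K)\<close>; so \<open>g v\<close> is
          \<open>ln (B v)\<close> rounded up.\<close>
        define B where "B = (\<lambda>v::nat. 4 * (real v)\<^sup>2 * (l * K))"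
        define g where "g = (\<lambda>v. nat \<lceil>ln (B v)\<rceil>)"
        have Bfacts: "B v \<ge> 1" "ln (B v) \<le> ln (4 * m\<^sup>2 * l powr (4/3))" "real (g v) \<le> ln (B v) + 1" "B v \<le> exp (real (g v))"
          if "V0 \<le> v" "v < V1" for v
        proof -
          have v: "real v \<ge> 1" "real v \<le> m" using that V0ge V1 m(1) by linarith+
          have "1 * 1 \<le> (4 * (real v)\<^sup>2) * (l * K)" using v m(2) K mult_mono[of 1 "real v" 1 "real v"] mult_mono[of 1 l 1 K]
            by (intro mult_mono) (auto simp: power2_eq_square)
          thus 1: "B v \<ge> 1" by (simp add: B_def)
          have "B v \<le> 4 * m\<^sup>2 * (l * K)" unfolding B_def using v m(2) K by (intro mult_right_mono mult_left_mono power_mono) auto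
          thus "ln (B v) \<le> ln (4 * m\<^sup>2 * l powr (4/3))" using 1 unfolding lK by (subst ln_le_cancel_iff) auto
          have "ln (B v) \<ge> 0" using 1 by simp
          thus "real (g v) \<le> ln (B v) + 1" unfolding g_def by linarith
          have "ln (B v) \<le> real (g v)" unfolding g_def by linarith
          hence "exp (ln (B v)) \<le> exp (real (g v))" by simp
          thus "B v \<le> exp (real (g v))" using 1 by simp
        qed
        have gv: "g v \<le> v" "v + g v \<le> N" "(real (v + g v))\<^sup>2 * (l * K) \<le> exp (real (g v))" if "V0 \<le> v" "v < V1" for v
        proof -
          have "real (g v) \<le> real V0" using Bfacts[OF that] m(4) V0 by linarith
          thus 1: "g v \<le> v" using that by linarith
          have "real (2 * V1) \<le> m / 2" using V1 by simp
          hence "2 * V1 \<le> N" unfolding N_def by linarith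
          thus "v + g v \<le> N" using 1 that by linarith
          have "(real (v + g v))\<^sup>2 \<le> (2 * real v)\<^sup>2" using 1 by (intro power_mono) auto
          hence "(real (v + g v))\<^sup>2 * (l * K) \<le> (2 * real v)\<^sup>2 * (l * K)" using m(2) K by (intro mult_right_mono) auto
          also have "\<dots> = B v" by (simp add: B_def power_mult_distrib)
          also have "\<dots> \<le> exp (real (g v))" by (rule Bfacts(4)[OF that])
          finally show "(real (v + g v))\<^sup>2 * (l * K) \<le> exp (real (g v))" .
        qed
        define w where "w = (\<lambda>p::nat. z / real p)"
        interpret random_set w "level N" by unfold_locales (use z in \<open>auto simp: finite_level w_def\<close>)
        have sumw: "sum w R = z * (\<Sum>p\<in>R. 1 / real p)" for R by (simp add: w_def sum_distrib_left)
        have lev: "level i \<subseteq> level N" if "i \<le> N" for i using level_mono[OF that] .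
        have VN: "V0 \<le> N" "V1 \<le> N" using V0 V1 N m(6) sm by linarith+
        define X1 where "X1 = (\<lambda>a::nat set. real r / 2 - 1 \<le> real (card (a \<inter> level N)))"
        define X2 where "X2 = (\<lambda>a::nat set. real (card (a \<inter> level V0)) \<le> sqrt (real r) / 2)"
        define G where "G = (\<lambda>v (a::nat set). (\<Sum>p\<in>a \<inter> level v. ln (real p)) \<le> K * exp (real v))"
        define EV where "EV = (\<lambda>v a. G v a \<and> a \<inter> (level (v + g v) - level v) = {})"
        define X3 where "X3 = (\<lambda>a. \<forall>v. V0 \<le> v \<and> v < V1 \<longrightarrow> \<not> EV v a)"
        have p1: "PB w (level N) X1 \<le> exp (- K)"
        proof -
          have "PB w (level N) X1 \<le> 2 powr (- (real r / 2 - 1)) * exp (sum w (level N))"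
            unfolding X1_def by (rule PB_card_ge) simp
          also have "2 powr (- (real r / 2 - 1)) \<le> exp (1 - real r / 3)"
          proof -
            have "ln 2 * (real r / 2) \<ge> 2/3 * (real r / 2)" using ln2_ge_two_thirds by (intro mult_right_mono) auto
            hence "- (real r / 2 - 1) * ln 2 \<le> 1 - real r / 3" using ln_2_less_1 by (simp add: algebra_simps)
            thus ?thesis by (simp add: powr_def)
          qed
          also have "sum w (level N) \<le> 11/10 * (m / 4 + C1)"
          proof -
            have "(\<Sum>p\<in>level N. 1 / real p) \<le> m / 4 + C1" using C1(2)[of N] N unfolding abs_le_iff by linarith
            thus ?thesis unfolding sumw using z m C1 by (intro mult_mono) (auto intro: sum_nonneg)
          qed
          also have "exp (1 - real r / 3) * exp (11/10 * (m / 4 + C1)) = exp (1 - real r / 3 + 11/10 * (m / 4 + C1))"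
            by (simp add: exp_add)
          also have "\<dots> \<le> exp (- K)"
          proof -
            have "real r \<ge> m - m powr (2/3)" using zr by linarith
            moreover have "1 - a / 3 + s \<le> - K" if "b \<le> a" "1 - b / 3 + s \<le> - K" for a b s
              using that by simp
            ultimately have "1 - real r / 3 + 11/10 * (m / 4 + C1) \<le> - K" using m(8) by blast
            thus ?thesis by simp
          qed
          finally show ?thesis by (simp add: mult_right_mono mult_left_mono)
        qed
        have p2: "PB w (level N) X2 \<le> exp (- K)"
        proof -
          have "PB w (level N) X2 \<le> 2 powr (sqrt (real r) / 2) * exp (- sum w (level V0) / 4)"
            unfolding X2_def
          proof (rule PB_card_le)
            show "level V0 \<subseteq> level N" using VN lev by simp
            fix p assume "p \<in> level V0"
            hence "real p \<ge> 2" using GP_ge2[of p] by (auto simp: level_def)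
            thus "w p \<le> 1" using z by (simp add: w_def)
          qed
          also have "\<dots> \<le> exp (sqrt m) * exp (- (9/10 * (10 * sqrt m - C1)) / 4)"
          proof (intro mult_mono)
            have "sqrt (real r) \<le> sqrt (2\<^sup>2 * m)" using zr m(1) by simp
            hence "sqrt (real r) \<le> 2 * sqrt m" by (simp add: real_sqrt_mult)
            hence "sqrt (real r) / 2 * ln 2 \<le> sqrt m * 1" using ln_2_less_1 m(1) by (intro mult_mono) auto
            thus "2 powr (sqrt (real r) / 2) \<le> exp (sqrt m)" by (simp add: powr_def)
            have a: "10 * sqrt m - C1 \<le> (\<Sum>p\<in>level V0. 1 / real p)" using C1(2)[of V0] V0 unfolding abs_le_iff by linarith
            have b: "0 \<le> (\<Sum>p\<in>level V0. 1 / real p)" by (intro sum_nonneg) auto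
            have "9/10 * (10 * sqrt m - C1) \<le> 9/10 * (\<Sum>p\<in>level V0. 1 / real p)" using a by (rule mult_left_mono) simp
            also have "\<dots> \<le> z * (\<Sum>p\<in>level V0. 1 / real p)" using z b by (intro mult_right_mono) auto
            finally show "exp (- sum w (level V0) / 4) \<le> exp (- (9/10 * (10 * sqrt m - C1)) / 4)" unfolding sumw by simp
          qed auto
          also have "\<dots> \<le> exp (- K)"
          proof -
            have "sqrt m + - (9/10 * (10 * sqrt m - C1)) / 4 \<le> - K" using m(9) by linarith
            thus ?thesis by (simp only: exp_add[symmetric] exp_le_cancel_iff)
          qed
          finally show ?thesis .
        qed
        \<comment> \<open>A gap of length \<open>ln (B v)\<close> has half that mass, so it is empty
          with probability about \<open>1 / sqrt (B v)\<close>, where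
          \<open>sqrt (l * K) = l powr (2/3)\<close>. The sum over \<open>v\<close> is thus of order
          \<open>l * l powr (- 2/3) = K\<close>. The 50 absorbs the Mertens error 43, tilted by
          \<open>z\<close>, and the rounding and tilt of \<open>g v\<close>.\<close>
        define q where "q = (\<lambda>v::nat. exp (- 50) / (2 * real v * l powr (2/3)))"
        have p3: "PB w (level N) X3 \<le> 10 * (exp 26 * exp (- K)) + exp (- (\<Sum>v\<in>{V0..<V1}. q v) / 10)"
          unfolding X3_def
        proof (rule no_gap_bound[where U = level and g = g and G = G])
          show "level i \<subseteq> level j" if "i \<le> j" for i j using level_mono[OF that] .
          show "G i a = G i (a \<inter> level i)" for i a by (simp add: G_def Int_assoc)
          show "EV i a \<longleftrightarrow> G i a \<and> a \<inter> (level (i + g i) - level i) = {}" for i a by (simp add: EV_def)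
          show "V0 \<le> V1" "1 \<le> V0" using V01 V0ge by auto
          show "0 \<le> exp 26 * exp (- K)" by simp
          fix v assume v: "V0 \<le> v" "v < V1"
          note gv = gv[OF v]
          show "level (v + g v) \<subseteq> level N" using lev[OF gv(2)] .
          have vN: "v \<le> N" using gv by simp
          show "1/5 \<le> PB w (level N) (\<lambda>a. a \<inter> (level v - level (v - 1)) \<noteq> {})"
          proof (rule PB_nonempty_ge)
            show "level v - level (v - 1) \<subseteq> level N" using lev[OF vN] by auto
            have "real (v - (v - 1)) = 1" using v V0ge by simp
            hence 1: "1/2 - 43 / exp (real (v - 1)) \<le> (\<Sum>p\<in>level v - level (v - 1). 1 / real p)"
              using sum_level_diff[of "v - 1" v] unfolding abs_le_iff by simp
            \<comment> \<open>\<open>V0 \<ge> 280\<close> makes the Mertens error at most 43/280, so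
              the layer keeps mass 1/3, and still more than 1/4 after the tilt
              \<open>z \<ge> 9/10\<close>.\<close>
            have "exp (real (v - 1)) \<ge> 1 + real (v - 1)" by (rule exp_ge_add_one_self)
            hence "exp (real (v - 1)) \<ge> 280" using v V0ge by simp
            hence "43 / exp (real (v - 1)) \<le> 43 / 280" by (intro divide_left_mono) auto
            hence "9/10 * (1/3) \<le> z * (\<Sum>p\<in>level v - level (v - 1). 1 / real p)" using 1 z by (intro mult_mono) auto
            thus "1/4 \<le> sum w (level v - level (v - 1))" unfolding sumw by simp
          qed
          show "PB w (level N) (\<lambda>a. \<not> G v a) \<le> exp 26 * exp (- K)"
          proof -
            define s where "s = (\<lambda>p::nat. ln (real p) / exp (real v))"
            have "(\<lambda>a. \<not> G v a) = (\<lambda>a. sum s (a \<inter> level v) > K)"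
              by (auto simp: G_def s_def sum_divide_distrib[symmetric] fun_eq_iff not_le field_simps)
            hence "PB w (level N) (\<lambda>a. \<not> G v a) = PB w (level N) (\<lambda>a. sum s (a \<inter> level v) > K)" by simp
            also have "\<dots> \<le> exp (- K) * exp (2 * (\<Sum>p\<in>level v. w p * s p))"
            proof (rule PB_sum_gt)
              show "level v \<subseteq> level N" using lev[OF vN] .
              fix p assume p: "p \<in> level v"
              have "p \<ge> 2" using p GP_ge2 by (auto simp: level_def)
              hence "ln (real p) \<le> ln (exp (exp (real v)))" using p by (subst ln_le_cancel_iff) (auto simp: level_def)
              thus "0 \<le> s p \<and> s p \<le> 1" using \<open>p \<ge> 2\<close> by (simp add: s_def)
            qed
            \<comment> \<open>After division by \<open>exp v\<close> the sum is at most
              \<open>11/10 * (1/2 + 11)\<close> by \<open>sum_level_ln\<close>; twice this is below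
              26.\<close>
            also have "2 * (\<Sum>p\<in>level v. w p * s p) \<le> 26"
            proof -
              have "(\<Sum>p\<in>level v. w p * s p) = (z / exp (real v)) * (\<Sum>p\<in>level v. ln (real p) / real p)"
                by (simp add: w_def s_def sum_distrib_left field_simps)
              also have "\<dots> \<le> (z / exp (real v)) * (exp (real v) / 2 + 11)"
                using z by (intro mult_left_mono sum_level_ln) auto
              also have "\<dots> = z * (1/2 + 11 / exp (real v))" by (simp add: field_simps)
              also have "\<dots> \<le> 11/10 * (1/2 + 11)"
              proof -
                have "11 / exp (real v) \<le> 11 / 1" by (intro divide_left_mono) auto
                thus ?thesis using z by (intro mult_mono) auto
              qed
              finally show ?thesis by simp
            qed
            finally show ?thesis by (simp add: mult.commute)
          qed
          have "q v \<le> exp (- sum w (level (v + g v) - level v))"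
          proof -
            have v1: "real v \<ge> 1" using v V0ge by simp
            have "(\<Sum>p\<in>level (v + g v) - level v. 1 / real p) \<le> real (g v) / 2 + 43 / exp (real v)"
              using sum_level_diff[of v "v + g v"] unfolding abs_le_iff by simp
            moreover have "43 / exp (real v) \<le> 43 / 1" by (intro divide_left_mono) auto
            ultimately have "sum w (level (v + g v) - level v) \<le> z * (real (g v) / 2 + 43)"
              unfolding sumw using z by (intro mult_left_mono) auto
            also have "\<dots> = z * (real (g v) / 2) + z * 43" by (simp add: algebra_simps)
            also have "z * (real (g v) / 2) \<le> (1 + \<delta>) * (real (g v) / 2)" using z by (intro mult_right_mono) auto
            also have "\<dots> = real (g v) / 2 + \<delta> * real (g v) / 2" by (simp add: algebra_simps)
            also have "\<delta> * real (g v) \<le> 1"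
            proof -
              have "\<delta> \<ge> 0" using C by (simp add: \<delta>_def)
              hence "\<delta> * real (g v) \<le> \<delta> * (ln (4 * m\<^sup>2 * l powr (4/3)) + 1)" using Bfacts[OF v] by (intro mult_left_mono) auto
              thus ?thesis using m(5) by linarith
            qed
            finally have "sum w (level (v + g v) - level v) \<le> ln (B v) / 2 + 50" using Bfacts(3)[OF v] z by simp
            hence "exp (- (ln (B v) / 2 + 50)) \<le> exp (- sum w (level (v + g v) - level v))" by simp
            also have "exp (- (ln (B v) / 2 + 50)) = exp (- 50) / sqrt (B v)"
            proof -
              have "exp (ln (B v) / 2) = sqrt (B v)" using Bfacts(1)[OF v] by (simp add: powr_half_sqrt[symmetric] powr_def)
              moreover have "- (ln (B v) / 2 + 50) = - 50 - ln (B v) / 2" by simp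
              ultimately show ?thesis by (simp only: exp_diff)
            qed
            also have "sqrt (B v) = 2 * real v * l powr (2/3)"
            proof -
              have "(2 * real v * l powr (2/3))\<^sup>2 = B v"
                by (simp add: B_def lK power2_eq_square powr_add[symmetric])
              thus ?thesis using m(2) by (intro real_sqrt_unique) auto
            qed
            finally show ?thesis by (simp add: q_def)
          qed
          moreover have "exp (- sum w (level (v + g v) - level v)) \<le> PB w (level N) (\<lambda>a. a \<inter> (level (v + g v) - level v) = {})"
            using lev[OF gv(2)] by (intro PB_empty_ge) auto
          moreover have "0 \<le> q v" by (simp add: q_def)
          ultimately show "0 \<le> q v \<and> q v \<le> PB w (level N) (\<lambda>a. a \<inter> (level (v + g v) - level v) = {})" by linarith
        qed
        have sq: "c * K \<le> (\<Sum>v\<in>{V0..<V1}. q v) / 10"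
        proof -
          have "l / 4 \<le> ln (real V1) - ln (real V0)"
          proof -
            have "ln (real V0) \<le> ln (20 * sqrt m + 1)" using V0 V0ge by (subst ln_le_cancel_iff) auto
            moreover have "ln (m / 4 - 1) \<le> ln (real V1)" using V1 m(1) by (subst ln_le_cancel_iff) auto
            ultimately show ?thesis using m(7) by linarith
          qed
          also have "\<dots> \<le> (\<Sum>v\<in>{V0..<V1}. 1 / real v)" using V01 V0ge by (intro sum_inverse_ge_ln) auto
          finally have "exp (- 50) / (2 * l powr (2/3)) * (l / 4) \<le> exp (- 50) / (2 * l powr (2/3)) * (\<Sum>v\<in>{V0..<V1}. 1 / real v)"
            by (intro mult_left_mono) auto
          also have "\<dots> = (\<Sum>v\<in>{V0..<V1}. q v)" unfolding q_def sum_distrib_left by (intro sum.cong) (auto simp: field_simps)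
          also have "exp (- 50) / (2 * l powr (2/3)) * (l / 4) = 10 * (c * K)"
          proof -
            have "l = l powr (2/3) * K" using m(2) by (simp add: K_def powr_add[symmetric])
            hence "l / l powr (2/3) = K" using m(2) by (simp add: field_simps)
            moreover have "exp (- 50) / (2 * l powr (2/3)) * (l / 4) = exp (- 50) / 8 * (l / l powr (2/3))" by simp
            ultimately show ?thesis by (simp add: c_def)
          qed
          finally show ?thesis by simp
        qed
        have eK: "exp (- K) \<le> exp (- (c * K))" using c K mult_right_mono[of c 1 K] by simp
        have "PB w (level N) (\<lambda>a. X1 a \<or> X2 a \<or> X3 a) \<le> PB w (level N) X1 + (PB w (level N) X2 + PB w (level N) X3)"
          using PB_disj_le[of X1 "\<lambda>a. X2 a \<or> X3 a"] PB_disj_le[of X2 X3] by linarith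
        also have "\<dots> \<le> exp (- K) + (exp (- K) + (10 * (exp 26 * exp (- K)) + exp (- (c * K))))"
        proof -
          have "exp (- (\<Sum>v\<in>{V0..<V1}. q v) / 10) \<le> exp (- (c * K))" using sq by simp
          thus ?thesis using p1 p2 p3 by linarith
        qed
        also have "\<dots> = (10 * exp 26 + 2) * exp (- K) + exp (- (c * K))" by (simp add: algebra_simps)
        also have "\<dots> \<le> (10 * exp 26 + 2) * exp (- (c * K)) + exp (- (c * K))"
          using eK by (intro add_right_mono mult_left_mono) (auto intro: add_nonneg_nonneg)
        also have "\<dots> = C0 * exp (- c * K)" by (simp add: C0_def algebra_simps)
        finally have main: "PB w (level N) (\<lambda>a. X1 a \<or> X2 a \<or> X3 a) \<le> C0 * exp (- c * K)" .
        show "gap_bound C0 c m z r" unfolding gap_bound_def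
        proof (rule exI[of _ V0], rule exI[of _ V1], rule exI[of _ N], rule exI[of _ K], rule exI[of _ g], intro conjI)
          show "2 \<le> V0" "real N \<le> m / 2" "K \<ge> 0" using V0ge N K by auto
          show "\<forall>v. V0 \<le> v \<and> v < V1 \<longrightarrow> v + g v \<le> N \<and> (real (v + g v))\<^sup>2 * (ln (2 * m) * K) \<le> exp (real (g v))"
            using gv(2,3) by (simp add: l_def)
        qed (use main in \<open>simp only: w_def X1_def X2_def X3_def EV_def G_def K_def l_def\<close>)
      qed
    qed
  qed (use c in \<open>auto simp: C0_def add_pos_pos\<close>)
qed

text \<open>Only primes outside \<open>level N\<close> are removed, so the event
  \<open>\<phi>\<close> is inherited exactly. They carry enough weight: the at most
  \<open>2 * m\<close> prime factors inside have \<open>ln p \<le> exp (m / 2)\<close>, together at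
  most \<open>ln x / 4\<close>, because \<open>ln x = exp (2 * m)\<close>.\<close>

lemma not_extravagant_card_le:
  "\<exists>C c. C > 0 \<and> c > 0 \<and> eventually (\<lambda>x. \<forall>k. in_range (Suc k) x \<longrightarrow> 
     real (card {n \<in> S_r (Suc k) x. \<not> extravagantly_spaced x n}) \<le> 
       sqrt x + C * (x / ln x) * main_term k x * exp (- c * ln (ln (ln x)) powr (1/3))) at_top"
proof -
  obtain C where C: "C > 0" and "eventually (\<lambda>x. regime C x) at_top"
    using in_range_facts by blast
  note ev = this(2)[unfolded regime_def]
  obtain C1 where C1: "C1 > 0" "\<And>i. \<bar>(\<Sum>p\<in>level i. 1 / real p) - real i / 2\<bar> \<le> C1" using sum_level_bounds by blast
  obtain C0 c where C0: "C0 > 0" "c > 0" and "eventually (\<lambda>m. \<forall>z r. \<bar>z - 1\<bar> \<le> C * m powr (-1/3) \<and> \<bar>real r - m\<bar> < m powr (2/3) \<and> real r \<le> 2 * m \<longrightarrow> gap_bound C0 c m z r) at_top"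
    using gap_probability[OF C] by blast
  note evg = this(3)[unfolded gap_bound_def]
  have ev1: "eventually (\<lambda>m::real. m \<ge> 80 \<and> m \<ge> 8 * C1 \<and> C * m powr (-1/3) \<le> 1/10 \<and> 2 * m * exp (m / 2) \<le> exp (2 * m) / 4) at_top"
    using C by (intro eventually_conj eventually_ge_at_top; real_asymp)
  show ?thesis
  proof (rule exI[of _ "64 * exp 2 * C0"], rule exI[of _ c], intro conjI)
    show "eventually (\<lambda>x. \<forall>k. in_range (Suc k) x \<longrightarrow> 
     real (card {n \<in> S_r (Suc k) x. \<not> extravagantly_spaced x n}) \<le> 
       sqrt x + 64 * exp 2 * C0 * (x / ln x) * main_term k x * exp (- c * ln (ln (ln x)) powr (1/3))) at_top"
      using ev eventually_mu[OF evg] eventually_mu[OF ev1]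
    proof eventually_elim
      case (elim x)
      show ?case
      proof (intro allI impI)
        fix k assume k: "in_range (Suc k) x"
        define m L l where "m = mu x" and "L = Lam x" and "l = ln (ln (ln x))"
        have x: "x > 1" "ln x > 0" using elim by auto
        have l: "ln (2 * m) = l" by (simp add: m_def l_def mu_def)
        have m: "m \<ge> 80" "m \<ge> 8 * C1" "C * m powr (-1/3) \<le> 1/10" "2 * m * exp (m / 2) \<le> exp (2 * m) / 4"
          using elim by (auto simp: m_def)
        have L: "m / 2 \<le> L" "L > 0" using elim m by (auto simp: L_def m_def)
        have l0: "l \<ge> 0" unfolding l[symmetric] using m by simp
        have lx: "exp (2 * m) = ln x" using x by (simp add: m_def mu_def)
        have kk: "k \<ge> 2" "\<bar>real k / L - 1\<bar> \<le> C * m powr (-1/3)" "real (Suc k) \<le> 2 * m" "\<bar>real (Suc k) - m\<bar> < m powr (2/3)"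
        proof -
          have "Suc k \<ge> 3 \<and> \<bar>real (Suc k - 1) / Lam x - 1\<bar> \<le> C * mu x powr (-1/3) \<and> real (Suc k) \<le> 2 * mu x"
            using elim(1) k by blast
          thus "k \<ge> 2" "\<bar>real k / L - 1\<bar> \<le> C * m powr (-1/3)" "real (Suc k) \<le> 2 * m" by (auto simp: L_def m_def)
          show "\<bar>real (Suc k) - m\<bar> < m powr (2/3)" using k by (simp add: in_range_def m_def)
        qed
        obtain V0 V1 N K g where V: "2 \<le> V0" "real N \<le> m / 2" "K \<ge> 0"
          and g: "\<And>v. V0 \<le> v \<and> v < V1 \<Longrightarrow> v + g v \<le> N \<and> (real (v + g v))\<^sup>2 * (l * K) \<le> exp (real (g v))"
          and PBle: "PB (\<lambda>p. real k / L / real p) (level N) (\<lambda>a. real (Suc k) / 2 - 1 \<le> real (card (a \<inter> level N)) \<or> real (card (a \<inter> level V0)) \<le> sqrt (real (Suc k)) / 2 \<or>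
           (\<forall>v. V0 \<le> v \<and> v < V1 \<longrightarrow> \<not> ((\<Sum>p\<in>a \<inter> level v. ln (real p)) \<le> K * exp (real v) \<and> a \<inter> (level (v + g v) - level v) = {})))
           \<le> C0 * exp (- c * l powr (1/3))"
          using elim(2)[unfolded m_def[symmetric] l, rule_format, of "real k / L" "Suc k"] kk by blast
        define \<phi> where "\<phi> = (\<lambda>a. real (Suc k) / 2 - 1 \<le> real (card (a \<inter> level N)) \<or> real (card (a \<inter> level V0)) \<le> sqrt (real (Suc k)) / 2 \<or>
           (\<forall>v. V0 \<le> v \<and> v < V1 \<longrightarrow> \<not> ((\<Sum>p\<in>a \<inter> level v. ln (real p)) \<le> K * exp (real v) \<and> a \<inter> (level (v + g v) - level v) = {})))"
        define Q where "Q = (\<lambda>n. \<phi> (prime_factors n \<inter> level N))"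
        have eN: "exp (real N) \<le> exp (m / 2)" using V by simp
        have U: "level N \<subseteq> {p. p \<in> GP \<and> real p \<le> x}"
        proof -
          have "exp (real N) \<le> exp (2 * m)" using V m by simp
          hence "exp (exp (real N)) \<le> exp (ln x)" unfolding lx by simp
          thus ?thesis using x by (auto simp: level_def)
        qed
        have "real (card {n \<in> S_r (Suc k) x. \<not> extravagantly_spaced x n}) \<le> sqrt x + 32 * (x / ln x) * (\<Sum>n | n \<in> S_r k x \<and> Q n. 1 / real n)"
        proof (rule card_le_cofactor_sum[OF x(1)])
          fix n assume n: "n \<in> {n \<in> S_r (Suc k) x. \<not> extravagantly_spaced x n}" "sqrt x \<le> real n"
          hence nS: "n \<in> S_r (Suc k) x" by simp
          define a where "a = prime_factors n \<inter> level N"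
          have "\<phi> a"
          proof (rule ccontr)
            assume "\<not> \<phi> a"
            then obtain v where v: "V0 \<le> v" "v < V1" "(\<Sum>p\<in>a \<inter> level v. ln (real p)) \<le> K * exp (real v)" "a \<inter> (level (v + g v) - level v) = {}"
              and c: "\<not> real (Suc k) / 2 - 1 \<le> real (card (a \<inter> level N))" "\<not> real (card (a \<inter> level V0)) \<le> sqrt (real (Suc k)) / 2"
              unfolding \<phi>_def by blast
            have aN: "a \<inter> level N = a" by (auto simp: a_def)
            have "extravagantly_spaced x n"
            proof (rule extravagantly_spacedI[OF nS, of N V0 v "g v" K])
              show "real (card (prime_factors n \<inter> level N)) + 1 < real (Suc k) / 2" using c(1) aN by (simp add: a_def)
              show "sqrt (real (Suc k)) / 2 < real (card (prime_factors n \<inter> level N \<inter> level V0))" using c(2) by (simp add: a_def)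
              show "V0 \<le> v" "2 \<le> v" using v V by auto
              show "v + g v \<le> N" "(real (v + g v))\<^sup>2 * (ln (ln (ln x)) * K) \<le> exp (real (g v))" using g[of v] v by (auto simp: l_def)
              show "0 \<le> ln (ln (ln x))" using l0 by (simp add: l_def)
            qed (use v V in \<open>auto simp: a_def\<close>)
            thus False using n by simp
          qed
          have QQ: "Q (n div p)" if p: "p \<in> prime_factors n - level N" for p
          proof -
            have "prime_factors (n div p) = prime_factors n - {p}" by (rule div_prime_S_r(2)[OF nS]) (use p in auto)
            hence "prime_factors (n div p) \<inter> level N = a" using p by (auto simp: a_def)
            thus ?thesis using \<open>\<phi> a\<close> by (simp add: Q_def)
          qed
          have "(\<Sum>p\<in>a. ln (real p)) \<le> (\<Sum>p\<in>a. exp (m / 2))"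
          proof (rule sum_mono)
            fix p assume p: "p \<in> a"
            hence "p \<ge> 2" "real p \<le> exp (exp (real N))" using GP_ge2 by (auto simp: a_def level_def)
            hence "ln (real p) \<le> ln (exp (exp (real N)))" by (subst ln_le_cancel_iff) auto
            thus "ln (real p) \<le> exp (m / 2)" using eN unfolding ln_exp by linarith
          qed
          also have "\<dots> = real (card a) * exp (m / 2)" by simp
          also have "\<dots> \<le> 2 * m * exp (m / 2)"
          proof (rule mult_right_mono)
            have "card a \<le> card (prime_factors n)" unfolding a_def by (intro card_mono) auto
            thus "real (card a) \<le> 2 * m" using S_r_prod(2)[OF nS] kk(3) by simp
          qed simp
          finally have 1: "(\<Sum>p\<in>a. ln (real p)) \<le> ln x / 4" using m(4) lx by linarith
          have "ln (sqrt x) \<le> ln (real n)" using n x S_r_prod(4)[OF nS] by (subst ln_le_cancel_iff) auto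
          moreover have "ln (sqrt x) = ln x / 2" using x by (simp add: ln_sqrt)
          moreover have "ln (real n) = (\<Sum>p\<in>a. ln (real p)) + (\<Sum>p\<in>prime_factors n - level N. ln (real p))"
          proof -
            have "prime_factors n - level N = prime_factors n - a" "a \<subseteq> prime_factors n" by (auto simp: a_def)
            thus ?thesis using ln_S_r[OF nS] sum.subset_diff[of a "prime_factors n" "\<lambda>p. ln (real p)"] by simp
          qed
          ultimately have "ln x / 8 \<le> (\<Sum>p\<in>prime_factors n - level N. ln (real p))" using 1 x(2) by linarith
          also have "\<dots> \<le> (\<Sum>p | p \<in> prime_factors n \<and> Q (n div p). ln (real p))"
            using QQ by (intro sum_mono2) (auto simp: in_prime_factors_iff ln_prime_nonneg)
          finally show "ln x / 8 \<le> (\<Sum>p | p \<in> prime_factors n \<and> Q (n div p). ln (real p))" .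
        qed auto
        moreover have "(\<Sum>n | n \<in> S_r k x \<and> Q n. 1 / real n) \<le> 2 * exp 2 * main_term k x * (C0 * exp (- c * l powr (1/3)))"
        proof -
          have A: "(\<Sum>p\<in>level N. 1 / real p) \<le> m / 4 + C1" using C1(2)[of N] V unfolding abs_le_iff by linarith
          hence A1: "(\<Sum>p\<in>level N. 1 / real p) \<le> 3/4 * L" using m(2) L by linarith
          have "1 \<le> (L - (\<Sum>p\<in>level N. 1 / real p)) * (real k / L)"
          proof -
            have "10 \<le> L - (\<Sum>p\<in>level N. 1 / real p)" using A1 L m by linarith
            moreover have "real k / L \<ge> 9/10" using kk(2) m(3) by linarith
            ultimately have "10 * (9/10) \<le> (L - (\<Sum>p\<in>level N. 1 / real p)) * (real k / L)" by (intro mult_mono) auto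
            thus ?thesis by simp
          qed
          hence "(\<Sum>n | n \<in> S_r k x \<and> Q n. 1 / real n) \<le> 2 * exp 2 * main_term k x * PB (\<lambda>p. real k / L / real p) (level N) \<phi>"
            unfolding Q_def L_def using U kk L A1 by (intro cofactor_sum_le_PB) (auto simp: L_def)
          also have "\<dots> \<le> 2 * exp 2 * main_term k x * (C0 * exp (- c * l powr (1/3)))"
            using PBle L unfolding \<phi>_def by (intro mult_left_mono) (auto simp: main_term_def L_def)
          finally show ?thesis .
        qed
        hence "32 * (x / ln x) * (\<Sum>n | n \<in> S_r k x \<and> Q n. 1 / real n) \<le> 32 * (x / ln x) * (2 * exp 2 * main_term k x * (C0 * exp (- c * l powr (1/3))))"
          using x by (intro mult_left_mono) auto
        moreover have "32 * (x / ln x) * (2 * exp 2 * main_term k x * (C0 * exp (- c * l powr (1/3)))) = 64 * exp 2 * C0 * (x / ln x) * main_term k x * exp (- c * l powr (1/3))"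
          by simp
        ultimately show "real (card {n \<in> S_r (Suc k) x. \<not> extravagantly_spaced x n}) \<le> 
           sqrt x + 64 * exp 2 * C0 * (x / ln x) * main_term k x * exp (- c * ln (ln (ln x)) powr (1/3))"
          unfolding l_def by linarith
      qed
    qed
  qed (use C0 in auto)
qed

section \<open>The main theorem\<close>

text \<open>The tolerance is at least \<open>\<eta>\<close>, and no deviation is that large. This
  disposes of the range of \<open>\<eta>\<close> in which the term \<open>sqrt x\<close> might not
  be absorbed by the claimed saving.\<close>

lemma regularly_spaced_of_large:
  assumes n: "n \<in> S_r r x" and x: "x \<ge> 2" "mu x \<ge> 1" and r: "real r \<le> 2 * mu x" and eta: "\<eta> > 2 * mu x"
  shows "regularly_spaced \<eta> n"
  unfolding regularly_spaced_def
proof (intro allI impI)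
  fix i assume i: "1 \<le> i" "real i < real (omega n) / 3"
  have om: "omega n = r" using n by (simp add: S_r_def)
  define p where "p = pfac n i"
  have "p \<in> prime_factors n" unfolding p_def using i by (intro pfac_mem) auto
  hence p: "p \<in> GP" "real p < x" using prime_factors_le_S_r[OF n] by auto
  have p2: "p \<ge> 2" using GP_ge2[OF p(1)] .
  hence lp: "ln (real p) > 0" by simp
  have "ln (ln (real p)) \<le> ln (ln x)" using lp p p2 x by (subst ln_le_cancel_iff) auto
  hence up: "ln (ln (real p)) / 2 \<le> mu x" by (simp add: mu_def)
  have "2/3 \<le> ln (real p)" using ln2_ge_two_thirds p2 order_trans[of "2/3" "ln 2" "ln (real p)"] by simp
  hence "ln (2/3) \<le> ln (ln (real p))" using lp by (subst ln_le_cancel_iff) auto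
  moreover have "ln (2/3) \<ge> (-1::real)"
    using ln_le_minus_one[of "3/2"] by (simp add: ln_div)
  ultimately have low: "-1 \<le> ln (ln (real p)) / 2" by linarith
  have "\<bar>ln (ln (real p)) / 2 - real i\<bar> < \<eta>" using low up i om r eta x unfolding abs_less_iff by linarith
  also have "\<eta> \<le> \<eta> powr (1/5) * max (real i) \<eta> powr (4/5)"
    using deviation_facts(1)[OF _ _ refl refl, of \<eta> "real i"] i eta x by simp
  finally show "\<bar>ln (ln (real (pfac n i))) / 2 - real i\<bar> < \<eta> powr (1/5) * max (real i) \<eta> powr (4/5)" by (simp add: p_def)
qed

theorem theorem4p1:
  "\<exists>k::real. k > 0 \<and>
    (\<forall>\<epsilon>::real. \<epsilon> > 0 \<longrightarrow>
      (\<exists>C x0 :: real. C > 0 \<and>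
        (\<forall>(x::real) (y1::real) (\<eta>::real) (r::nat).
          x \<ge> x0 \<and> y1 > 3 \<and> \<eta> > 1 \<and>
          \<bar>real r - ln (ln x) / 2\<bar> < (ln (ln x) / 2) powr (2/3) \<longrightarrow>
            real (card {n \<in> S_r r x. \<not> comfortably_spaced y1 n})
              \<le> C * (real (Phi r x) * (1 / ln y1 + ln x powr (- 1/2 + \<epsilon>))) \<and>
            real (card {n \<in> S_r r x. \<not> regularly_spaced \<eta> n})
              \<le> C * (real (Phi r x) * exp (- k * \<eta>)) \<and>
            real (card {n \<in> S_r r x. \<not> extravagantly_spaced x n})
              \<le> C * (real (Phi r x) * exp (- (ln (ln (ln x)) powr (1/3 - \<epsilon>)))))))"
proof (rule exI[of _ "1/64"], intro conjI allI impI)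
  fix \<epsilon> :: real assume eps: "\<epsilon> > 0"
  obtain C where C: "C > 0" and "eventually (\<lambda>x. regime C x) at_top"
    using in_range_facts by blast
  note ev = this(2)[unfolded regime_def]
  obtain c0 where c0: "c0 > 0" and evP: "eventually (\<lambda>x. \<forall>k. in_range (Suc k) x \<longrightarrow> real (Phi (Suc k) x) \<ge> c0 * (x / ln x) * main_term k x) at_top"
    using Phi_lower by blast
  have evM: "eventually (\<lambda>x. \<forall>k. in_range (Suc k) x \<longrightarrow> main_term k x \<ge> ln x powr (1/2 - \<epsilon>)) at_top"
    "eventually (\<lambda>x. \<forall>k. in_range (Suc k) x \<longrightarrow> main_term k x \<ge> ln x powr (1/2 - 1/4)) at_top"
    using main_term_lower[OF eps] main_term_lower[of "1/4"] by auto
  obtain K1 where K1: "K1 > 0" "\<And>x y k. x > 1 \<and> x powr (1/16) \<ge> 2 \<and> y \<ge> 2 \<and> k \<ge> 2 \<and> real k \<le> 2 * Lam x \<Longrightarrow>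
     real (card {n \<in> S_r (Suc k) x. \<not> comfortably_spaced y n}) \<le> sqrt x + K1 * (x / ln x) * (main_term k x / ln y) + K1 * (x / ln x)"
    using not_comfortable_card_le by blast
  obtain K2 \<eta>0 where K2: "K2 > 0" "\<eta>0 > 0" and ev2: "eventually (\<lambda>x. \<forall>k \<eta>. in_range (Suc k) x \<and> \<eta>0 \<le> \<eta> \<and> 1 \<le> \<eta> \<longrightarrow> 
     real (card {n \<in> S_r (Suc k) x. \<not> regularly_spaced \<eta> n}) \<le> sqrt x + K2 * (x / ln x) * main_term k x * exp (- \<eta> / 64)) at_top"
    using not_regular_card_le by blast
  obtain K3 c where K3: "K3 > 0" "c > 0" and ev3: "eventually (\<lambda>x. \<forall>k. in_range (Suc k) x \<longrightarrow> 
     real (card {n \<in> S_r (Suc k) x. \<not> extravagantly_spaced x n}) \<le> 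
       sqrt x + K3 * (x / ln x) * main_term k x * exp (- c * ln (ln (ln x)) powr (1/3))) at_top"
    using not_extravagant_card_le by blast
  \<comment> \<open>In (ii) \<open>sqrt x\<close> has to be absorbed for all
    \<open>\<eta> \<le> 2 * mu x = ln (ln x)\<close>, hence the factor
    \<open>exp (- ln (ln x) / 64)\<close>. In the last condition the \<open>\<epsilon>\<close> of
    (iii) is spent on hiding the constant \<open>c\<close>.\<close>
  have evA: "eventually (\<lambda>x::real. x powr (1/16) \<ge> 2 \<and> ln x \<ge> 1 \<and> sqrt x \<le> x / ln x \<and> sqrt x \<le> x / ln x * exp (- ln (ln x) / 64) \<and>
     sqrt x \<le> x / ln x * exp (- c * ln (ln (ln x)) powr (1/3)) \<and> ln (ln (ln x)) powr (1/3 - \<epsilon>) \<le> c * ln (ln (ln x)) powr (1/3)) at_top"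
    using K3(2) eps by (intro eventually_conj; real_asymp)
  have "eventually (\<lambda>m::real. C * m powr (-1/3) \<le> 1) at_top" using C by real_asymp
  note evC = eventually_mu[OF this]
  define CC where "CC = (K1 + 1) / c0 + (K2 + 1) / c0 + (K3 + 1) / c0 + exp (\<eta>0 / 64)"
  have CC: "CC > 0" "(K1 + 1) / c0 \<le> CC" "(K2 + 1) / c0 \<le> CC" "(K3 + 1) / c0 \<le> CC" "exp (\<eta>0 / 64) \<le> CC"
    using c0 K1 K2 K3 by (auto simp: CC_def intro!: add_pos_pos add_nonneg_nonneg add_increasing add_increasing2)
  let ?T = "\<lambda>x. \<forall>(y1::real) (\<eta>::real) (r::nat). y1 > 3 \<and> \<eta> > 1 \<and> \<bar>real r - ln (ln x) / 2\<bar> < (ln (ln x) / 2) powr (2/3) \<longrightarrow>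
      real (card {n \<in> S_r r x. \<not> comfortably_spaced y1 n})
         \<le> CC * (real (Phi r x) * (1 / ln y1 + ln x powr (- 1/2 + \<epsilon>))) \<and>
      real (card {n \<in> S_r r x. \<not> regularly_spaced \<eta> n})
         \<le> CC * (real (Phi r x) * exp (- (1/64) * \<eta>)) \<and>
      real (card {n \<in> S_r r x. \<not> extravagantly_spaced x n})
         \<le> CC * (real (Phi r x) * exp (- (ln (ln (ln x)) powr (1/3 - \<epsilon>))))"
  have "eventually ?T at_top"
    using ev evP evM ev2 ev3 evA evC
  proof eventually_elim
    case (elim x)
    show ?case
    proof (intro allI impI)
      fix y1 \<eta> :: real and r :: nat assume a: "y1 > 3 \<and> \<eta> > 1 \<and> \<bar>real r - ln (ln x) / 2\<bar> < (ln (ln x) / 2) powr (2/3)"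
      hence r: "in_range r x" by (simp add: in_range_def mu_def)
      hence r3: "r \<ge> 3" "real r \<le> 2 * mu x" "\<bar>real (r - 1) / Lam x - 1\<bar> \<le> C * mu x powr (-1/3)" using elim(1) by auto
      then obtain k where k: "r = Suc k" "k \<ge> 2" by (cases r) auto
      define X \<Phi> M where "X = x / ln x" and "\<Phi> = real (Phi r x)" and "M = main_term k x"
      have x: "x > 1" "x \<ge> 2" "ln x \<ge> 1" "X > 0" using elim by (auto simp: X_def intro!: divide_pos_pos)
      have Phi: "c0 * X * M \<le> \<Phi>" using elim(2) r k by (simp add: X_def M_def \<Phi>_def)
      have M: "M \<ge> ln x powr (1/2 - \<epsilon>)" "M \<ge> 1"
      proof -
        show "M \<ge> ln x powr (1/2 - \<epsilon>)" using elim(3) r k by (simp add: M_def)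
        have "M \<ge> ln x powr (1/2 - 1/4)" using elim(4) r k by (simp add: M_def)
        moreover have "ln x powr (1/2 - 1/4) \<ge> 1" using x by (intro ge_one_powr_ge_zero) auto
        ultimately show "M \<ge> 1" by linarith
      qed
      have XM: "X * M \<le> \<Phi> / c0" using Phi c0 by (simp add: field_simps)
      have X1: "X \<le> X * M" using x M by simp
      have Phi0: "\<Phi> \<ge> 0" by (simp add: \<Phi>_def)
      have combine: "(K + 1) * (X * M) * e \<le> CC * (\<Phi> * e)" if "(K + 1) / c0 \<le> CC" "e \<ge> 0" "K > 0" for K e
      proof -
        have "(K + 1) * (X * M) * e \<le> (K + 1) * (\<Phi> / c0) * e" using XM that by (intro mult_right_mono mult_left_mono) auto
        also have "\<dots> = (K + 1) / c0 * (\<Phi> * e)" by simp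
        also have "\<dots> \<le> CC * (\<Phi> * e)" using that Phi0 by (intro mult_right_mono) auto
        finally show ?thesis .
      qed
      have part1: "real (card {n \<in> S_r r x. \<not> comfortably_spaced y1 n}) \<le> CC * (\<Phi> * (1 / ln y1 + ln x powr (- 1/2 + \<epsilon>)))"
      proof -
        define e where "e = ln x powr (- 1/2 + \<epsilon>)"
        have ly: "ln y1 > 0" using a by simp
        have e0: "e \<ge> 0" by (simp add: e_def)
        \<comment> \<open>This absorbs the contribution \<open>x / ln x\<close> that lacks the
          factor \<open>M\<close>.\<close>
        have Me: "1 \<le> M * e"
        proof -
          have "ln x powr (1/2 - \<epsilon>) * e = ln x powr 0" unfolding e_def powr_add[symmetric] by simp
          hence "1 = ln x powr (1/2 - \<epsilon>) * e" using x by simp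
          also have "\<dots> \<le> M * e" using M e0 by (intro mult_right_mono) auto
          finally show ?thesis .
        qed
        have "real (card {n \<in> S_r r x. \<not> comfortably_spaced y1 n}) \<le> sqrt x + K1 * X * (M / ln y1) + K1 * X"
        proof -
          have "real k / Lam x \<le> 2" using r3(3) elim(8) k unfolding abs_le_iff by simp
          moreover have "Lam x > 0" using elim(1) by linarith
          ultimately have "real k \<le> 2 * Lam x" by (simp add: field_simps)
          thus ?thesis using K1(2)[of x y1 k] elim(7) x a k by (simp add: X_def M_def)
        qed
        also have "\<dots> \<le> X + K1 * X * (M / ln y1) + K1 * X" using elim(7) by (simp add: X_def)
        also have "\<dots> = (K1 + 1) * X * 1 + K1 * (X * M) * (1 / ln y1)" by (simp add: algebra_simps)
        also have "\<dots> \<le> (K1 + 1) * X * (M * e) + (K1 + 1) * (X * M) * (1 / ln y1)"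
          using Me K1 x ly M by (intro add_mono mult_left_mono mult_right_mono) auto
        also have "\<dots> = (K1 + 1) * (X * M) * (1 / ln y1 + e)" by (simp add: algebra_simps)
        also have "\<dots> \<le> CC * (\<Phi> * (1 / ln y1 + e))" using CC K1 e0 ly by (intro combine) auto
        finally show ?thesis by (simp add: e_def)
      qed
      have part2: "real (card {n \<in> S_r r x. \<not> regularly_spaced \<eta> n}) \<le> CC * (\<Phi> * exp (- (1/64) * \<eta>))"
      proof -
        \<comment> \<open>For small \<open>\<eta>\<close> the trivial bound suffices, as
          \<open>CC\<close> contains \<open>exp (\<eta>0 / 64)\<close>; for large
          \<open>\<eta>\<close> there are no exceptions; in between the Chernoff estimate is
          used.\<close>
        consider "\<eta> < \<eta>0" | "\<eta> > 2 * mu x" | "\<eta>0 \<le> \<eta>" "\<eta> \<le> 2 * mu x" by linarith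
        thus ?thesis
        proof cases
          case 1
          have "card {n \<in> S_r r x. \<not> regularly_spaced \<eta> n} \<le> Phi r x"
            unfolding Phi_def by (intro card_mono) auto
          hence "real (card {n \<in> S_r r x. \<not> regularly_spaced \<eta> n}) \<le> \<Phi> * 1" by (simp add: \<Phi>_def)
          also have "\<dots> \<le> \<Phi> * (CC * exp (- (1/64) * \<eta>))"
          proof (intro mult_left_mono Phi0)
            have "exp (\<eta> / 64) \<le> exp (\<eta>0 / 64)" using 1 by simp
            hence "exp (\<eta> / 64) \<le> CC" using CC(5) by linarith
            hence "exp (\<eta> / 64) * exp (- (1/64) * \<eta>) \<le> CC * exp (- (1/64) * \<eta>)" by (intro mult_right_mono) auto
            thus "1 \<le> CC * exp (- (1/64) * \<eta>)" by (simp add: exp_add[symmetric])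
          qed
          finally show ?thesis by (simp add: mult_ac)
        next
          case 2
          hence "{n \<in> S_r r x. \<not> regularly_spaced \<eta> n} = {}"
            using regularly_spaced_of_large[of _ r x \<eta>] x elim(1) r3 by auto
          hence "real (card {n \<in> S_r r x. \<not> regularly_spaced \<eta> n}) = 0" by (simp only: card.empty)
          moreover have "0 \<le> CC * (\<Phi> * exp (- (1/64) * \<eta>))" using CC(1) Phi0 by simp
          ultimately show ?thesis by linarith
        next
          case 3
          define e where "e = exp (- \<eta> / 64)"
          have "exp (- ln (ln x) / 64) \<le> e" using 3 by (simp add: e_def mu_def)
          hence "X * exp (- ln (ln x) / 64) \<le> X * e" using x by (intro mult_left_mono) auto
          hence "sqrt x \<le> X * e" using elim(7) by (simp add: X_def)
          moreover have "X * e \<le> (X * M) * e" using X1 by (intro mult_right_mono) (auto simp: e_def)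
          moreover have "real (card {n \<in> S_r r x. \<not> regularly_spaced \<eta> n}) \<le> sqrt x + K2 * X * M * e"
            using elim(5) 3 a r k by (simp add: X_def M_def e_def)
          ultimately have "real (card {n \<in> S_r r x. \<not> regularly_spaced \<eta> n}) \<le> (K2 + 1) * (X * M) * e" by (simp add: algebra_simps)
          also have "\<dots> \<le> CC * (\<Phi> * e)" using CC K2 by (intro combine) (auto simp: e_def)
          finally show ?thesis by (simp add: e_def)
        qed
      qed
      have part3: "real (card {n \<in> S_r r x. \<not> extravagantly_spaced x n}) \<le> CC * (\<Phi> * exp (- (ln (ln (ln x)) powr (1/3 - \<epsilon>))))"
      proof -
        define e where "e = exp (- c * ln (ln (ln x)) powr (1/3))"
        have "sqrt x \<le> X * e" using elim(7) by (simp add: X_def e_def)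
        moreover have "X * e \<le> (X * M) * e" using X1 by (intro mult_right_mono) (auto simp: e_def)
        moreover have "real (card {n \<in> S_r r x. \<not> extravagantly_spaced x n}) \<le> sqrt x + K3 * X * M * e"
          using elim(6) r k by (simp add: X_def M_def e_def)
        ultimately have "real (card {n \<in> S_r r x. \<not> extravagantly_spaced x n}) \<le> (K3 + 1) * (X * M) * e" by (simp add: algebra_simps)
        also have "\<dots> \<le> CC * (\<Phi> * e)" using CC K3 by (intro combine) (auto simp: e_def)
        also have "\<dots> \<le> CC * (\<Phi> * exp (- (ln (ln (ln x)) powr (1/3 - \<epsilon>))))"
          using CC Phi0 elim(7) by (intro mult_left_mono) (auto simp: e_def)
        finally show ?thesis .
      qed
      show "real (card {n \<in> S_r r x. \<not> comfortably_spaced y1 n})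
         \<le> CC * (real (Phi r x) * (1 / ln y1 + ln x powr (- 1/2 + \<epsilon>))) \<and>
      real (card {n \<in> S_r r x. \<not> regularly_spaced \<eta> n})
         \<le> CC * (real (Phi r x) * exp (- (1/64) * \<eta>)) \<and>
      real (card {n \<in> S_r r x. \<not> extravagantly_spaced x n})
         \<le> CC * (real (Phi r x) * exp (- (ln (ln (ln x)) powr (1/3 - \<epsilon>))))"
        using part1 part2 part3 unfolding \<Phi>_def by blast
    qed
  qed
  then obtain x0 where "\<And>x. x \<ge> x0 \<Longrightarrow> ?T x"
    unfolding eventually_at_top_linorder by blast
  thus "\<exists>C x0 :: real. C > 0 \<and>
        (\<forall>(x::real) (y1::real) (\<eta>::real) (r::nat).
          x \<ge> x0 \<and> y1 > 3 \<and> \<eta> > 1 \<and>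
          \<bar>real r - ln (ln x) / 2\<bar> < (ln (ln x) / 2) powr (2/3) \<longrightarrow>
            real (card {n \<in> S_r r x. \<not> comfortably_spaced y1 n})
              \<le> C * (real (Phi r x) * (1 / ln y1 + ln x powr (- 1/2 + \<epsilon>))) \<and>
            real (card {n \<in> S_r r x. \<not> regularly_spaced \<eta> n})
              \<le> C * (real (Phi r x) * exp (- (1/64) * \<eta>)) \<and>
            real (card {n \<in> S_r r x. \<not> extravagantly_spaced x n})
              \<le> C * (real (Phi r x) * exp (- (ln (ln (ln x)) powr (1/3 - \<epsilon>)))))"
    using CC(1) by blast
qed simp

end
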